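(* Suppose that the quasi-log likelihood $\mathbb{H}_n$ satisfies (A1), the prior densities $\pi_n$ satisfy (A2), the random field $\mathbb{Z}_n$ satisfies (A3) (conditions listed in the context), and that $\hat\theta_n\to\theta_0$ in probability. Then, as $n\to\infty$: (i) $$\log\Big(\int_{\Theta}e^{\mathbb{H}_n(\theta)}\pi_n(\theta)\,d\theta\Big)=\mathbb{H}_n(\theta_0)+\sum_{k=1}^{K}p_k\log a_{k,n}(\theta_0)-\frac12\log|\Gamma_0|+\frac p2\log 2\pi+\frac12\big\|\Gamma_0^{-1/2}\Delta_n\big\|^2+\log\pi_n(\theta_0)+o_p(1).$$ (ii) If further $\log a_{k,n}(\hat\theta_n)=\log a_{k,n}(\theta_0)+o_p(1)$ for $k=1,\dots,K$ and $\log\pi_n(\hat\theta_n)=\log\pi_n(\theta_0)+o_p(1)$, then $$\log\Big(\int_{\Theta}e^{\mathbb{H}_n(\theta)}\pi_n(\theta)\,d\theta\Big)=\mathbb{H}_n(\hat\theta_n)+\sum_{k=1}^{K}p_k\log a_{k,n}(\hat\theta_n)+\frac p2\log2\pi-\frac12\log\big|\Gamma_n(\hat\theta_n)\big|+\log\pi_n(\hat\theta_n)+o_p(1)$$ $$=\mathbb{H}_n(\hat\theta_n)+\frac p2\log2\pi-\frac12\log\big|-\partial_\theta^2\mathbb{H}_n(\hat\theta_n)\big|+\log\pi_n(\hat\theta_n)+o_p(1).$$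
   Context: Setting. $\Theta=\prod_{k=1}^K\Theta_k\subset\mathbb{R}^p$, where each $\Theta_k\subset\mathbb{R}^{p_k}$ is a bounded convex domain and $p=\sum_{k=1}^Kp_k$; write $\theta=(\theta_1,\dots,\theta_K)$. For each $n$, $\mathbb{H}_n(\theta)=\mathbb{H}_n(\mathbf{X}_n|\theta)$ is a real random function on $\Theta$ (the quasi-log likelihood, a function of the data $\mathbf{X}_n$ defined on a probability space $(\Omega,\mathcal{F},\mathbb{P})$), a.s. continuous on the compact set $\bar\Theta$. The QMLE $\hat\theta_n$ is any maximizer of $\mathbb{H}_n$ over $\bar\Theta$. $\pi_n:\Theta\to(0,\infty)$ is a probability density (the prior). $\theta_0\in\Theta$ is a constant. The rate matrix is $$A_n(\theta_0)=\mathrm{diag}\big(a_{1,n}(\theta_0)I_{p_1},\dots,a_{K,n}(\theta_0)I_{p_K}\big),$$ where the $a_{k,n}(\theta)>0$ are deterministic functions of $\theta$ with $a_{k,n}(\theta_0)\to0$ (decreasing in $n$) and $a_{i,n}(\theta_0)/a_{j,n}(\theta_0)\to0$ for $i<j$. Standing assumption: $A_n(\theta_0)^{-1}(\hat\theta_n-\theta_0)$ converges in distribution to a non-trivial limit distribution. $A_{n,ii}(\theta_0)$ is the $(i,i)$ entry of $A_n(\theta_0)$, $\theta^i$ is the $i$th coordinate of $\theta$, and $|A|=\det A$ for a square matrix $A$ (the logarithms of determinants at $\hat\theta_n$ are well defined with probability tending to one). For a matrix $\Gamma$ and a vector $\Delta$, $\Gamma[u,u]=u'\Gamma u$ and $\Delta[u]=\Delta'u$.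 Put $\Delta_n=A_n(\theta_0)\partial_\theta\mathbb{H}_n(\theta_0)$, $\Gamma_n(\theta)=-A_n(\theta_0)\partial_\theta^2\mathbb{H}_n(\theta)A_n(\theta_0)$, $\Gamma_n=\Gamma_n(\theta_0)$, $\mathbb{U}_n(\theta_0)=\{u\in\mathbb{R}^p:\theta_0+A_n(\theta_0)u\in\Theta\}$ and $\mathbb{Z}_n(u)=\exp\{\mathbb{H}_n(\theta_0+A_n(\theta_0)u)-\mathbb{H}_n(\theta_0)\}$ for $u\in\mathbb{U}_n(\theta_0)$. (A1) $\mathbb{H}_n$ is of class $\mathcal{C}^3(\Theta)$ and: (i) $\Delta_n=O_p(1)$; (ii) $\Gamma_n=\Gamma_0+o_p(1)$ for a (possibly random) matrix $\Gamma_0$ with $\mathbb{P}(\Gamma_0>0)=1$ (positive definite); (iii) $\max_{i,j,k\in\{1,\dots,p\}}\sup_{\theta}\big|A_{n,ii}(\theta_0)A_{n,jj}(\theta_0)A_{n,kk}(\theta_0)\,\partial_{\theta^i}\partial_{\theta^j}\partial_{\theta^k}\mathbb{H}_n(\theta)\big|=o_p(1)$. (A2) (i) $\pi_n(\theta_0)>0$ for all $n$ and $\sup_n\sup_\theta\pi_n(\theta)<\infty$; (ii) for each $M>0$, $\sup_{|u|<M}|\pi_n(\theta_0+A_n(\theta_0)u)-\pi_n(\theta_0)|\to0$ as $n\to\infty$. (A3) For any $\epsilon>0$ there exist $M>0$ and $N$ such that $\sup_{n\ge N}\mathbb{P}\big(\int_{\mathbb{U}_n(\theta_0)\cap\{|u|\ge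 M\}}\mathbb{Z}_n(u)\,du>\epsilon\big)<\epsilon$.
   Formalization: The formal theorem also assumes that the prior densities at θ_0 are bounded below uniformly in n (inf_n π_n(θ_0) > 0); with only π_n(θ_0) > 0 for each n, as in (A2)(i), the expansion can fail. *)

theory Defs
  imports "HOL-Probability.Probability"
begin

section \<open>Stochastic orders and convergence in distribution\<close>

text \<open>
  Outer probability is used because some of the events below (suprema over \<open>\<theta>\<close>, integrals of
  paths that are only almost surely continuous) are measurable only up to null sets, and
  \<^const>\<open>measure\<close> is \<open>0\<close> on non-measurable sets. On measurable events
  \<^const>\<open>outer_measure_of\<close> is \<^const>\<open>emeasure\<close>, so this is the usual notion.
\<close>

definition small_op :: "'w measure \<Rightarrow> (nat \<Rightarrow> 'w \<Rightarrow> 'b::real_normed_vector) \<Rightarrow> bool" where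
  "small_op M Y \<longleftrightarrow>
     (\<forall>\<epsilon>>0. (\<lambda>n. outer_measure_of M {\<omega> \<in> space M. \<epsilon> < norm (Y n \<omega>)}) \<longlonglongrightarrow> 0)"

definition big_Op :: "'w measure \<Rightarrow> (nat \<Rightarrow> 'w \<Rightarrow> 'b::real_normed_vector) \<Rightarrow> bool" where
  "big_Op M Y \<longleftrightarrow>
     (\<forall>\<epsilon>>0. \<exists>C. \<forall>\<^sub>F n in sequentially.
        outer_measure_of M {\<omega> \<in> space M. C < norm (Y n \<omega>)} < ennreal \<epsilon>)"

definition converges_in_law ::
  "'w measure \<Rightarrow> (nat \<Rightarrow> 'w \<Rightarrow> 'b::euclidean_space) \<Rightarrow> 'b measure \<Rightarrow> bool" where
  "converges_in_law M Y \<mu> \<longleftrightarrow>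
     (\<forall>f::'b \<Rightarrow> real. continuous_on UNIV f \<and> bounded (range f) \<longrightarrow>
        (\<lambda>n. \<integral>\<omega>. f (Y n \<omega>) \<partial>M) \<longlonglongrightarrow> (\<integral>y. f y \<partial>\<mu>))"

section \<open>The block-structured parameter space\<close>

text \<open>
  Coordinates of \<open>\<real>\<^sup>p = real ^ 'p\<close> are distributed over the blocks \<open>1, \<dots>, K\<close> by
  \<open>blk :: 'p \<Rightarrow> nat\<close>; the factor \<open>\<real>\<^bsup>p\<^sub>k\<^esup>\<close> is the coordinate subspace \<open>block_space blk k\<close>.
\<close>

definition block_space :: "('p::finite \<Rightarrow> nat) \<Rightarrow> nat \<Rightarrow> (real ^ 'p) set" where
  "block_space blk k = {x. \<forall>i. blk i \<noteq> k \<longrightarrow> x $ i = 0}"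

definition block_proj :: "('p::finite \<Rightarrow> nat) \<Rightarrow> nat \<Rightarrow> real ^ 'p \<Rightarrow> real ^ 'p" where
  "block_proj blk k x = (\<chi> i. if blk i = k then x $ i else 0)"

definition block_dim :: "('p::finite \<Rightarrow> nat) \<Rightarrow> nat \<Rightarrow> nat" where
  "block_dim blk k = card {i. blk i = k}"

definition bounded_convex_block_domain ::
  "('p::finite \<Rightarrow> nat) \<Rightarrow> nat \<Rightarrow> (real ^ 'p) set \<Rightarrow> bool" where
  "bounded_convex_block_domain blk k D \<longleftrightarrow>
     D \<noteq> {} \<and> openin (top_of_set (block_space blk k)) D \<and> convex D \<and> bounded D"

definition block_product ::
  "('p::finite \<Rightarrow> nat) \<Rightarrow> nat \<Rightarrow> (nat \<Rightarrow> (real ^ 'p) set) \<Rightarrow> (real ^ 'p) set" where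
  "block_product blk K D = {\<theta>. \<forall>k\<in>{1..K}. block_proj blk k \<theta> \<in> D k}"

definition rate_matrix ::
  "('p::finite \<Rightarrow> nat) \<Rightarrow> (nat \<Rightarrow> nat \<Rightarrow> real ^ 'p \<Rightarrow> real) \<Rightarrow> nat \<Rightarrow> real ^ 'p \<Rightarrow> real ^ 'p ^ 'p" where
  "rate_matrix blk a n \<theta> = (\<chi> i j. if i = j then a (blk i) n \<theta> else 0)"

section \<open>Derivatives and positive definite matrices\<close>

definition partial_d :: "'p::finite \<Rightarrow> (real ^ 'p \<Rightarrow> real) \<Rightarrow> real ^ 'p \<Rightarrow> real" where
  "partial_d i f x = frechet_derivative f (at x) (axis i 1)"

primrec C_k_on :: "nat \<Rightarrow> (real ^ 'p::finite) set \<Rightarrow> (real ^ 'p \<Rightarrow> real) \<Rightarrow> bool" where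
  "C_k_on 0 S f \<longleftrightarrow> continuous_on S f"
| "C_k_on (Suc k) S f \<longleftrightarrow>
     (\<forall>x\<in>S. f differentiable (at x)) \<and> (\<forall>i. C_k_on k S (partial_d i f))"

definition gradient :: "(real ^ 'p::finite \<Rightarrow> real) \<Rightarrow> real ^ 'p \<Rightarrow> real ^ 'p" where
  "gradient f x = (\<chi> i. partial_d i f x)"

definition hessian :: "(real ^ 'p::finite \<Rightarrow> real) \<Rightarrow> real ^ 'p \<Rightarrow> real ^ 'p ^ 'p" where
  "hessian f x = (\<chi> i j. partial_d i (partial_d j f) x)"

definition pos_definite :: "real ^ 'p ^ 'p::finite \<Rightarrow> bool" where
  "pos_definite G \<longleftrightarrow> transpose G = G \<and> (\<forall>u. u \<noteq> 0 \<longrightarrow> 0 < u \<bullet> (G *v u))"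

text \<open>For positive definite \<open>G\<close> such a matrix exists and is unique.\<close>

definition inv_sqrt_matrix :: "real ^ 'p ^ 'p::finite \<Rightarrow> real ^ 'p ^ 'p" where
  "inv_sqrt_matrix G = (SOME S. pos_definite S \<and> S ** S = matrix_inv G)"

section \<open>Local quantities and conditions\<close>

text \<open>
  \<open>A\<close> is the rate matrix at \<open>\<theta>0\<close>, \<open>h\<close> one path \<open>\<theta> \<mapsto> H\<^sub>n(\<theta>)\<close>.
\<close>

definition Delta :: "real ^ 'p ^ 'p::finite \<Rightarrow> (real ^ 'p \<Rightarrow> real) \<Rightarrow> real ^ 'p \<Rightarrow> real ^ 'p" where
  "Delta A h \<theta>0 = A *v gradient h \<theta>0"

definition Gam :: "real ^ 'p ^ 'p::finite \<Rightarrow> (real ^ 'p \<Rightarrow> real) \<Rightarrow> real ^ 'p \<Rightarrow> real ^ 'p ^ 'p" where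
  "Gam A h \<theta> = - (A ** hessian h \<theta> ** A)"

definition local_set ::
  "(real ^ 'p) set \<Rightarrow> real ^ 'p ^ 'p::finite \<Rightarrow> real ^ 'p \<Rightarrow> (real ^ 'p) set" where
  "local_set \<Theta> A \<theta>0 = {u. \<theta>0 + A *v u \<in> \<Theta>}"

definition local_field ::
  "real ^ 'p ^ 'p::finite \<Rightarrow> (real ^ 'p \<Rightarrow> real) \<Rightarrow> real ^ 'p \<Rightarrow> real ^ 'p \<Rightarrow> real" where
  "local_field A h \<theta>0 u = exp (h (\<theta>0 + A *v u) - h \<theta>0)"

text \<open>The suprema are taken in \<^typ>\<open>ereal\<close> since third derivatives may be unbounded on \<open>\<Theta>\<close>.\<close>

definition third_order_sup ::
  "(real ^ 'p) set \<Rightarrow> real ^ 'p ^ 'p::finite \<Rightarrow> (real ^ 'p \<Rightarrow> real) \<Rightarrow> ereal" where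
  "third_order_sup \<Theta> A h =
     (SUP i. SUP j. SUP k. SUP \<theta>\<in>\<Theta>.
        ereal \<bar>A $ i $ i * A $ j $ j * A $ k $ k
               * partial_d i (partial_d j (partial_d k h)) \<theta>\<bar>)"

definition cond_A1 ::
  "'w measure \<Rightarrow> (real ^ 'p) set \<Rightarrow> (nat \<Rightarrow> real ^ 'p ^ 'p) \<Rightarrow> real ^ 'p::finite
   \<Rightarrow> (nat \<Rightarrow> 'w \<Rightarrow> real ^ 'p \<Rightarrow> real) \<Rightarrow> ('w \<Rightarrow> real ^ 'p ^ 'p) \<Rightarrow> bool" where
  "cond_A1 M \<Theta> A \<theta>0 H \<Gamma>0 \<longleftrightarrow>
     (\<forall>n. AE \<omega> in M. C_k_on 3 \<Theta> (H n \<omega>)) \<and>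
     big_Op M (\<lambda>n \<omega>. Delta (A n) (H n \<omega>) \<theta>0) \<and>
     \<Gamma>0 \<in> borel_measurable M \<and>
     (AE \<omega> in M. pos_definite (\<Gamma>0 \<omega>)) \<and>
     small_op M (\<lambda>n \<omega>. Gam (A n) (H n \<omega>) \<theta>0 - \<Gamma>0 \<omega>) \<and>
     (\<forall>\<epsilon>>0. (\<lambda>n. outer_measure_of M
               {\<omega> \<in> space M. ereal \<epsilon> < third_order_sup \<Theta> (A n) (H n \<omega>)}) \<longlonglongrightarrow> 0)"

definition cond_A2 ::
  "(real ^ 'p) set \<Rightarrow> (nat \<Rightarrow> real ^ 'p ^ 'p) \<Rightarrow> real ^ 'p::finite
   \<Rightarrow> (nat \<Rightarrow> real ^ 'p \<Rightarrow> real) \<Rightarrow> bool" where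
  "cond_A2 \<Theta> A \<theta>0 \<pi> \<longleftrightarrow>
     (\<forall>n. 0 < \<pi> n \<theta>0) \<and>
     bdd_above {\<pi> n \<theta> |n \<theta>. \<theta> \<in> \<Theta>} \<and>
     (\<forall>r>0. (\<lambda>n. SUP u\<in>{u \<in> local_set \<Theta> (A n) \<theta>0. norm u < r}.
                    \<bar>\<pi> n (\<theta>0 + A n *v u) - \<pi> n \<theta>0\<bar>) \<longlonglongrightarrow> 0)"

text \<open>
  The positivity of \<open>\<pi> n \<theta>0\<close> has to be uniform in \<open>n\<close>; positivity for each \<open>n\<close> does not suffice
  for the expansion of the marginal likelihood, because the last part of \<^const>\<open>cond_A2\<close> is an
  absolute, not a relative, bound. Take \<open>\<Theta> = (-1,1)\<close>, \<open>\<theta>0 = 0\<close>, rate \<open>1 / sqrt n\<close>,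
  \<open>H n \<theta> = - n * (\<theta> - X)\<^sup>2 / 2\<close> with \<open>X\<close> the mean of \<open>n\<close> standard normal variables,
  \<open>\<pi> n 0 = 1 / n\<close>, \<open>\<pi> n \<theta> = 2 / n\<close> for \<open>0 < \<bar>\<theta>\<bar> < 1 / 2\<close>, and \<open>\<pi> n \<theta> = 1 - 2 / n\<close> elsewhere:
  everything else holds, but \<open>ln (\<pi> n \<theta>0)\<close> is off by \<open>ln 2\<close>. (The jump at \<open>0\<close> can be smoothed.)
\<close>

definition prior_bounded_below :: "real ^ 'p::finite \<Rightarrow> (nat \<Rightarrow> real ^ 'p \<Rightarrow> real) \<Rightarrow> bool" where
  "prior_bounded_below \<theta>0 \<pi> \<longleftrightarrow> (\<exists>c>0. \<forall>n. c \<le> \<pi> n \<theta>0)"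

definition cond_A3 ::
  "'w measure \<Rightarrow> (real ^ 'p) set \<Rightarrow> (nat \<Rightarrow> real ^ 'p ^ 'p) \<Rightarrow> real ^ 'p::finite
   \<Rightarrow> (nat \<Rightarrow> 'w \<Rightarrow> real ^ 'p \<Rightarrow> real) \<Rightarrow> bool" where
  "cond_A3 M \<Theta> A \<theta>0 H \<longleftrightarrow>
     (\<forall>\<epsilon>>0. \<exists>r>0. \<exists>N.
        (SUP n\<in>{N..}. outer_measure_of M
           {\<omega> \<in> space M.
              ennreal \<epsilon> < (\<integral>\<^sup>+u\<in>local_set \<Theta> (A n) \<theta>0 \<inter> {u. r \<le> norm u}.
                               ennreal (local_field (A n) (H n \<omega>) \<theta>0 u) \<partial>lborel)})
        < ennreal \<epsilon>)"

definition prior_densities :: "(real ^ 'p::finite) set \<Rightarrow> (nat \<Rightarrow> real ^ 'p \<Rightarrow> real) \<Rightarrow> bool" where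
  "prior_densities \<Theta> \<pi> \<longleftrightarrow>
     (\<forall>n. (\<forall>\<theta>\<in>\<Theta>. 0 < \<pi> n \<theta>) \<and> set_borel_measurable lborel \<Theta> (\<pi> n) \<and>
          (\<integral>\<^sup>+\<theta>\<in>\<Theta>. ennreal (\<pi> n \<theta>) \<partial>lborel) = 1)"

text \<open>Each path need only be continuous almost surely, so a maximizer exists only almost surely.\<close>

definition is_QMLE ::
  "'w measure \<Rightarrow> (real ^ 'p::finite) set \<Rightarrow> (nat \<Rightarrow> 'w \<Rightarrow> real ^ 'p \<Rightarrow> real)
   \<Rightarrow> (nat \<Rightarrow> 'w \<Rightarrow> real ^ 'p) \<Rightarrow> bool" where
  "is_QMLE M \<Theta> H \<theta>h \<longleftrightarrow>
     (\<forall>n. \<theta>h n \<in> borel_measurable M \<and>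
          (AE \<omega> in M. \<theta>h n \<omega> \<in> closure \<Theta> \<and>
                      (\<forall>\<theta>\<in>closure \<Theta>. H n \<omega> \<theta> \<le> H n \<omega> (\<theta>h n \<omega>))))"

definition marginal_likelihood ::
  "(real ^ 'p::finite) set \<Rightarrow> (real ^ 'p \<Rightarrow> real) \<Rightarrow> (real ^ 'p \<Rightarrow> real) \<Rightarrow> real" where
  "marginal_likelihood \<Theta> h p = (LINT \<theta>:\<Theta>|lborel. exp (h \<theta>) * p \<theta>)"

end

theory Submission
  imports Defs
begin

text \<open>
  With the rescaling \<open>\<theta> = \<theta>0 + A\<^sub>n u\<close> the marginal likelihood becomes
  \<open>det A\<^sub>n \<sqdot> exp (H\<^sub>n(\<theta>0))\<close> times the integral of \<open>Z\<^sub>n(u) \<pi>\<^sub>n(\<theta>0 + A\<^sub>n u)\<close>. On a fixed ball, a third order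
  Taylor expansion shows that \<open>ln Z\<^sub>n\<close> is uniformly close to the concave quadratic
  \<open>q(u) = \<Delta>\<^sub>n \<bullet> u - u \<bullet> \<Gamma>\<^sub>0 u / 2\<close> and that \<open>\<pi>\<^sub>n\<close> is nearly constant; outside a large ball both
  \<open>Z\<^sub>n\<close>, by (A3), and \<open>exp q\<close> have negligible mass. So the integral is \<open>\<pi>\<^sub>n(\<theta>0)\<close> times the Gaussian
  integral of \<open>exp q\<close>, which gives (i). All estimates are deterministic and uniform as long as
  \<open>\<Delta>\<^sub>n\<close> stays bounded and \<open>\<Gamma>\<^sub>0\<close> stays in a compact set of positive definite matrices, which happens
  with probability close to one.

  For (ii), the rescaled maximizer is tight because it converges in law. Up to the uniform error
  between \<open>ln Z\<^sub>n\<close> and \<open>q\<close>, the maximum of \<open>ln Z\<^sub>n\<close> is therefore the maximum of \<open>q\<close>, that is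
  \<open>\<parallel>\<Gamma>\<^sub>0\<^sup>-\<^sup>1\<^sup>/\<^sup>2 \<Delta>\<^sub>n\<parallel>\<^sup>2 / 2\<close>, so no expansion of the score at the maximizer is needed. The third derivative
  bound also moves \<open>\<Gamma>\<^sub>n\<close> from \<open>\<theta>0\<close> to the maximizer at negligible cost.
\<close>

text \<open>The obstacle is the order in which constants are chosen. The relative accuracy
  \<open>s\<close> and the admissible tail mass \<open>\<tau>\<close> come first and depend only on
  \<open>\<epsilon>\<close>, the prior bound \<open>B\<close> and lower bounds for the Gaussian mass
  and for \<open>\<pi> n \<theta>0\<close>. The radius \<open>r\<close> depends on
  \<open>\<tau>\<close> through (A3) and through the Gaussian tail. The tolerance
  \<open>\<eta>\<close> comes last, since the Taylor error grows like \<open>r ^ 3\<close>. The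
  uniform lower bound on the prior at \<open>\<theta>0\<close> enters here: it turns the absolute
  errors \<open>B * \<tau>\<close> and \<open>\<eta>\<close> into relative ones. The bounds
  \<open>m\<close> and \<open>C\<close> on \<open>\<Gamma>0\<close> and on the score precede all of
  these and depend on the permitted failure probability. The argument therefore runs at a fixed
  failure probability \<open>\<delta>\<close> (\<open>ev_prob\<close>), and o_p statements are
  recovered by letting \<open>\<delta>\<close> vary. Since \<open>ln\<close> and the integral are
  total functions with conventional values, finiteness and positivity of the mass and positivity of
  the determinants are part of what is proved.\<close>

section \<open>Positive definite matrices\<close>

text \<open>Induction on the dimension, relative to an invariant subspace \<open>V\<close> so that
  the hypothesis applies to the complement of one eigenvector inside \<open>V\<close>. The
  eigenvector is a maximizer of \<open>x \<bullet> f x\<close> on the unit sphere of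
  \<open>V\<close>.\<close>

lemma selfadjoint_eigenbasis:
  fixes f :: "'a::euclidean_space \<Rightarrow> 'a"
  assumes lin: "linear f" and sa: "\<And>x y. x \<bullet> f y = f x \<bullet> y"
  shows "subspace V \<Longrightarrow> f ` V \<subseteq> V \<Longrightarrow>
    \<exists>B. B \<subseteq> V \<and> pairwise orthogonal B \<and> (\<forall>b\<in>B. norm b = 1 \<and> (\<exists>c. f b = c *\<^sub>R b)) \<and> span B = V"
proof (induction "dim V" arbitrary: V rule: less_induct)
  case less
  interpret f: linear f by fact
  show ?case
  proof (cases "V = {0}")
    case True
    then show ?thesis by (intro exI[of _ "{}"]) auto
  next
    case False
    then obtain v where v: "v \<in> V" "v \<noteq> 0"
      using subspace_0[OF less.prems(1)] by auto
    have comp: "compact (V \<inter> sphere 0 1)"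
      using closed_subspace[OF less.prems(1)] by (simp add: closed_Int_compact)
    have ne: "V \<inter> sphere 0 1 \<noteq> {}"
    proof -
      have "v /\<^sub>R norm v \<in> V \<inter> sphere 0 1"
        using v less.prems(1) by (auto simp: subspace_scale)
      then show ?thesis by blast
    qed
    have "continuous_on (V \<inter> sphere 0 1) (\<lambda>x. x \<bullet> f x)"
      by (intro continuous_intros linear_continuous_on_compose[OF _ lin])
    from continuous_attains_sup[OF comp ne this] obtain e where
      e: "e \<in> V" "norm e = 1" and emax: "\<And>x. x \<in> V \<Longrightarrow> norm x = 1 \<Longrightarrow> x \<bullet> f x \<le> e \<bullet> f e"
      by auto
    define l where "l = e \<bullet> f e"
    have bound: "x \<bullet> f x \<le> l * (norm x)\<^sup>2" if "x \<in> V" for x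
    proof (cases "x = 0")
      case False
      have "(x /\<^sub>R norm x) \<bullet> f (x /\<^sub>R norm x) \<le> l"
        unfolding l_def using that False less.prems(1) by (intro emax) (auto simp: subspace_scale)
      then have "(x \<bullet> f x) / (norm x)\<^sup>2 \<le> l"
        by (simp add: f.scaleR power2_eq_square divide_inverse ac_simps)
      then show ?thesis using False by (simp add: field_simps)
    qed (simp add: f.zero)
    \<comment> \<open>First variation: moving \<open>e\<close> in an orthogonal direction
      \<open>v\<close> changes the squared norm only to second order, so a nonzero first-order
      change of the form would contradict maximality.\<close>
    have orth: "v \<bullet> f e = 0" if v: "v \<in> V" "v \<bullet> e = 0" for v
    proof (rule ccontr)
      assume nz: "v \<bullet> f e \<noteq> 0"
      define c where "c = l * (norm v)\<^sup>2 - v \<bullet> f v"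
      have c0: "c \<ge> 0" using bound[OF v(1)] by (simp add: c_def)
      have key: "2 * t * (v \<bullet> f e) \<le> t\<^sup>2 * c" for t
      proof -
        have "(e + t *\<^sub>R v) \<bullet> f (e + t *\<^sub>R v) \<le> l * (norm (e + t *\<^sub>R v))\<^sup>2"
          using e v less.prems(1) by (intro bound) (auto simp: subspace_add subspace_scale)
        moreover have "(norm (e + t *\<^sub>R v))\<^sup>2 = 1 + t\<^sup>2 * (norm v)\<^sup>2"
          unfolding power2_norm_eq_inner
          using e v by (simp add: inner_simps inner_commute power2_eq_square norm_eq_1)
        moreover have "(e + t *\<^sub>R v) \<bullet> f (e + t *\<^sub>R v) = l + 2 * t * (v \<bullet> f e) + t\<^sup>2 * (v \<bullet> f v)"
        proof -
          have "e \<bullet> f v = v \<bullet> f e" using sa[of e v] by (simp add: inner_commute)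
          then show ?thesis
            by (simp add: f.add f.scaleR inner_simps l_def power2_eq_square algebra_simps)
        qed
        ultimately show ?thesis by (simp add: c_def algebra_simps)
      qed
      \<comment> \<open>The \<open>+ 1\<close> keeps the denominator positive when
        \<open>c = 0\<close>, and the resulting factor \<open>c / (c + 1)\<close> stays below 1,
        against a factor 2 on the left of \<open>key\<close>.\<close>
      define t where "t = (v \<bullet> f e) / (c + 1)"
      have "2 * ((v \<bullet> f e)\<^sup>2 / (c + 1)) \<le> (v \<bullet> f e)\<^sup>2 / (c + 1) * (c / (c + 1))"
        using key[of t] c0 by (simp add: t_def power2_eq_square)
      moreover have "(v \<bullet> f e)\<^sup>2 / (c + 1) * (c / (c + 1)) \<le> (v \<bullet> f e)\<^sup>2 / (c + 1) * 1"
        using c0 by (intro mult_left_mono) (auto simp: field_simps)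
      moreover have "(v \<bullet> f e)\<^sup>2 / (c + 1) > 0" using nz c0 by simp
      ultimately show False by simp
    qed
    have eig: "f e = l *\<^sub>R e"
    proof -
      \<comment> \<open>The residual is itself an admissible direction for \<open>orth\<close>,
        which forces its norm to vanish.\<close>
      define w where "w = f e - l *\<^sub>R e"
      have wV: "w \<in> V" using e less.prems by (auto simp: w_def subspace_diff subspace_scale)
      have we: "w \<bullet> e = 0" using e by (simp add: w_def inner_diff_left l_def inner_commute[of "f e" e] norm_eq_1)
      from orth[OF wV we] have "w \<bullet> w = 0"
        using we by (simp add: w_def inner_simps)
      then show ?thesis by (simp add: w_def)
    qed
    define W where "W = V \<inter> {x. x \<bullet> e = 0}"
    have sW: "subspace W"
      unfolding W_def using less.prems(1)
      by (auto simp: subspace_def inner_simps)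
    have eW: "e \<notin> W" using e by (auto simp: W_def norm_eq_1)
    have "dim W < dim V"
    proof -
      have "W \<subseteq> V" by (auto simp: W_def)
      then have "W \<subset> V" using e(1) eW by blast
      then show ?thesis
        using sW less.prems(1) by (intro dim_psubset) (simp add: span_eq_iff[THEN iffD2])
    qed
    moreover have "f ` W \<subseteq> W"
    proof
      fix y assume "y \<in> f ` W"
      then obtain x where x: "x \<in> V" "x \<bullet> e = 0" "y = f x" by (auto simp: W_def)
      have "f x \<bullet> e = x \<bullet> f e" by (simp add: sa)
      also have "\<dots> = 0" using x eig by simp
      finally show "y \<in> W" using x less.prems(2) by (auto simp: W_def)
    qed
    ultimately obtain B where B: "B \<subseteq> W" "pairwise orthogonal B"
      "\<forall>b\<in>B. norm b = 1 \<and> (\<exists>c. f b = c *\<^sub>R b)" "span B = W"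
      using less.hyps[of W] sW by blast
    have "span (insert e B) = V"
    proof
      show "span (insert e B) \<subseteq> V"
        using e B less.prems(1) by (intro span_minimal) (auto simp: W_def)
      show "V \<subseteq> span (insert e B)"
      proof
        fix x assume x: "x \<in> V"
        have "x - (x \<bullet> e) *\<^sub>R e \<in> W"
          using x e less.prems(1)
          by (auto simp: W_def subspace_diff subspace_scale inner_simps norm_eq_1)
        then show "x \<in> span (insert e B)"
          using B(4) by (auto simp: span_breakdown_eq)
      qed
    qed
    moreover have "pairwise orthogonal (insert e B)"
      using B by (intro pairwise_orthogonal_insert) (auto simp: W_def orthogonal_def inner_commute)
    ultimately show ?thesis
      using B e eig by (intro exI[of _ "insert e B"]) (auto simp: W_def)
  qed
qed

section \<open>Diagonalization, positivity and inverse square roots of matrices\<close>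

definition diag_matrix :: "('n \<Rightarrow> real) \<Rightarrow> real ^ 'n ^ 'n::finite" where
  "diag_matrix d = (\<chi> i j. if i = j then d i else 0)"

lemma diag_matrix_mult: "diag_matrix c ** diag_matrix d = diag_matrix (\<lambda>i. c i * d i)"
  by (simp add: diag_matrix_def matrix_matrix_mult_def vec_eq_iff if_distrib[of "\<lambda>x. x * _"]
      cong: if_cong)

lemma diag_matrix_1: "diag_matrix (\<lambda>_. 1) = mat 1"
  by (simp add: diag_matrix_def mat_def)

lemma transpose_diag_matrix [simp]: "transpose (diag_matrix d) = diag_matrix d"
  by (auto simp: diag_matrix_def transpose_def vec_eq_iff)

lemma det_diag_matrix: "det (diag_matrix d) = (\<Prod>i\<in>UNIV. d i)"
  by (subst det_diagonal) (auto simp: diag_matrix_def)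

lemma diag_matrix_mv_nth [simp]: "(diag_matrix d *v u) $ i = d i * u $ i"
  by (simp add: diag_matrix_def matrix_vector_mult_def if_distrib[of "\<lambda>x. x * _"] cong: if_cong)

lemma symmetric_matrix_diagonalizable:
  fixes G :: "real ^ 'n ^ 'n::finite"
  assumes "transpose G = G"
  shows "\<exists>P d. orthogonal_matrix P \<and> G = P ** diag_matrix d ** transpose P"
proof -
  have sa: "x \<bullet> (G *v y) = (G *v x) \<bullet> y" for x y
    using dot_lmul_matrix[of x G y] assms by (metis transpose_matrix_vector)
  obtain B where B: "pairwise orthogonal B" "\<And>b. b \<in> B \<Longrightarrow> norm b = 1"
     "\<And>b. b \<in> B \<Longrightarrow> \<exists>c. G *v b = c *\<^sub>R b" "span B = UNIV"
    using selfadjoint_eigenbasis[of "(*v) G" UNIV] sa by auto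
  have ind: "independent B"
    using B by (intro pairwise_orthogonal_independent) force+
  \<comment> \<open>The basis has as many elements as the index type, so it can be indexed by it and
    supply the columns of a square matrix.\<close>
  have "card B = CARD('n)"
    using dim_span_eq_card_independent[OF ind] B(4) by simp
  then obtain b where b: "bij_betw b (UNIV :: 'n set) B"
    using finiteI_independent[OF ind] by (metis bij_betw_iff_card finite)
  have bB: "b i \<in> B" for i using b by (auto simp: bij_betw_def)
  have orthn: "b i \<bullet> b j = (if i = j then 1 else 0)" for i j
  proof (cases "i = j")
    case False
    then have "b i \<noteq> b j" using b by (auto simp: bij_betw_def inj_def)
    then show ?thesis using False B(1) bB by (auto simp: pairwise_def orthogonal_def)
  qed (use B(2)[OF bB] in \<open>simp add: norm_eq_1\<close>)
  have "\<forall>i. \<exists>c. G *v b i = c *\<^sub>R b i" using B(3) bB by simp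
  from choice[OF this] obtain d where d: "\<And>i. G *v b i = d i *\<^sub>R b i" by auto
  define P :: "real^'n^'n" where "P = (\<chi> i j. b j $ i)"
  have P: "orthogonal_matrix P"
    unfolding orthogonal_matrix
    by (auto simp: vec_eq_iff matrix_matrix_mult_def transpose_def P_def mat_def orthn[unfolded inner_vec_def inner_real_def])
  then have PP: "P ** transpose P = mat 1" by (simp add: orthogonal_matrix_def)
  have "G ** P = P ** diag_matrix d"
  proof -
    have "(\<Sum>k\<in>UNIV. G $ i $ k * b j $ k) = d j * b j $ i" for i j
    proof -
      have "(G *v b j) $ i = (d j *\<^sub>R b j) $ i" by (simp only: d)
      then show ?thesis by (simp only: matrix_vector_mult_def vec_lambda_beta vector_scaleR_component real_scaleR_def)
    qed
    moreover have "(\<Sum>k\<in>UNIV. P $ i $ k * diag_matrix d $ k $ j) = d j * b j $ i" for i j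
    proof -
      have "(\<Sum>k\<in>UNIV. P $ i $ k * diag_matrix d $ k $ j) = (\<Sum>k\<in>UNIV. if k = j then d j * b j $ i else 0)"
        by (intro sum.cong) (auto simp: P_def diag_matrix_def)
      then show ?thesis by simp
    qed
    ultimately show ?thesis
      by (simp add: vec_eq_iff matrix_matrix_mult_def) (simp add: P_def)
  qed
  then have "P ** diag_matrix d ** transpose P = G ** (P ** transpose P)"
    by (simp only: matrix_mul_assoc)
  also have "\<dots> = G" by (simp only: PP matrix_mul_rid)
  finally show ?thesis using P by (intro exI[of _ P] exI[of _ d] conjI) (simp_all only:)
qed

lemma inner_sandwich:
  fixes P :: "real ^ 'n ^ 'n::finite"
  shows "u \<bullet> ((P ** X ** transpose P) *v u) = (transpose P *v u) \<bullet> (X *v (transpose P *v u))"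
  by (simp only: matrix_vector_mul_assoc[symmetric] transpose_matrix_vector dot_lmul_matrix)

lemma pos_definite_diagonalizable:
  fixes G :: "real ^ 'n ^ 'n::finite"
  assumes "pos_definite G"
  shows "\<exists>P d. orthogonal_matrix P \<and> G = P ** diag_matrix d ** transpose P \<and> (\<forall>i. d i > 0)"
proof -
  obtain P d where P: "orthogonal_matrix P" and G: "G = P ** diag_matrix d ** transpose P"
    using symmetric_matrix_diagonalizable[of G] assms by (auto simp: pos_definite_def)
  have PP: "transpose P ** P = mat 1" using P by (simp add: orthogonal_matrix)
  have "d i > 0" for i
  proof -
    \<comment> \<open>\<open>u\<close> is column \<open>i\<close> of \<open>P\<close>, an
      eigenvector for \<open>d i\<close>, so the quadratic form at \<open>u\<close> has the value
      \<open>d i\<close>.\<close>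
    define u where "u = P *v axis i 1"
    have tu: "transpose P *v u = axis i 1"
      using PP by (simp add: u_def matrix_vector_mul_assoc del: transpose_matrix_vector)
    then have "u \<noteq> 0" by (auto simp: axis_eq_0_iff)
    then have "0 < u \<bullet> (G *v u)" using assms by (auto simp: pos_definite_def)
    also have "u \<bullet> (G *v u) = (transpose P *v u) \<bullet> (diag_matrix d *v (transpose P *v u))"
      unfolding G by (rule inner_sandwich)
    also have "\<dots> = d i" by (simp only: tu) (simp add: inner_axis')
    finally show ?thesis .
  qed
  with P G show ?thesis by blast
qed

lemma det_orthogonal_sandwich:
  fixes P :: "real ^ 'n ^ 'n::finite"
  assumes "orthogonal_matrix P"
  shows "det (P ** X ** transpose P) = det X"
  using det_orthogonal_matrix[OF assms] by (auto simp: det_mul)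

lemma pos_definite_det_pos:
  assumes "pos_definite G"
  shows "0 < det G"
proof -
  obtain P d where "orthogonal_matrix P" "G = P ** diag_matrix d ** transpose P" "\<And>i. d i > 0"
    using pos_definite_diagonalizable[OF assms(1)] by blast
  then show ?thesis
    by (simp add: det_orthogonal_sandwich det_diag_matrix prod_pos)
qed

text \<open>The constant is the smallest eigenvalue, because \<open>transpose P\<close> preserves
  norms. This supplies the coercivity clause of \<open>pd_compact\<close>.\<close>

lemma pos_definite_lower_bound:
  fixes G :: "real ^ 'n ^ 'n::finite"
  assumes "pos_definite G"
  obtains \<kappa> where "\<kappa> > 0" "\<And>u. \<kappa> * (norm u)\<^sup>2 \<le> u \<bullet> (G *v u)"
proof -
  obtain P d where P: "orthogonal_matrix P" and G: "G = P ** diag_matrix d ** transpose P"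
    and d: "\<And>i. d i > 0"
    using pos_definite_diagonalizable[OF assms(1)] by blast
  define \<kappa> where "\<kappa> = Min (range d)"
  have "\<kappa> > 0" using d by (auto simp: \<kappa>_def)
  moreover have "\<kappa> * (norm u)\<^sup>2 \<le> u \<bullet> (G *v u)" for u
  proof -
    define v where "v = transpose P *v u"
    have nv: "norm v = norm u"
      using P orthogonal_transformation_matrix[of "(*v) (transpose P)"]
      by (simp add: v_def orthogonal_matrix_transpose orthogonal_transformation)
    have "\<kappa> * (norm v)\<^sup>2 = (\<Sum>i\<in>UNIV. \<kappa> * (v $ i)\<^sup>2)"
      by (simp add: norm_vec_def L2_set_def sum_nonneg sum_distrib_left)
    also have "\<dots> \<le> (\<Sum>i\<in>UNIV. d i * (v $ i)\<^sup>2)"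
      by (intro sum_mono mult_right_mono) (auto simp: \<kappa>_def)
    also have "\<dots> = v \<bullet> (diag_matrix d *v v)"
      by (simp add: inner_vec_def power2_eq_square ac_simps)
    also have "\<dots> = u \<bullet> (G *v u)"
      unfolding G v_def by (rule inner_sandwich[symmetric])
    finally show ?thesis by (simp add: nv)
  qed
  ultimately show thesis using that by blast
qed

lemma matrix_inv_eqI:
  fixes A :: "real ^ 'n ^ 'n::finite"
  assumes "A ** B = mat 1"
  shows "matrix_inv A = B"
proof -
  have BA: "B ** A = mat 1" using assms matrix_left_right_inverse[of A B] by blast
  have "A ** matrix_inv A = mat 1 \<and> matrix_inv A ** A = mat 1"
    unfolding matrix_inv_def by (rule someI[of _ B]) (simp add: assms BA)
  then have "matrix_inv A = (B ** A) ** matrix_inv A" by (simp add: BA)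
  also have "\<dots> = B" using \<open>A ** matrix_inv A = mat 1 \<and> _\<close>
    by (metis matrix_mul_assoc matrix_mul_rid)
  finally show ?thesis .
qed

text \<open>\<open>inv_sqrt_matrix\<close> is a choice, so a witness has to be exhibited: the same
  eigenvectors with eigenvalues \<open>1 / sqrt (d i)\<close>. The two properties fix the squared
  norm of \<open>S *v \<Delta>\<close> as the value at \<open>\<Delta>\<close> of the inverse
  quadratic form.\<close>

lemma inv_sqrt_matrix_props:
  fixes G :: "real ^ 'n ^ 'n::finite"
  assumes "pos_definite G"
  defines "S \<equiv> inv_sqrt_matrix G"
  shows "transpose S = S" "G ** (S ** S) = mat 1"
proof -
  obtain P d where P: "orthogonal_matrix P" and G: "G = P ** diag_matrix d ** transpose P"
    and d: "\<And>i. d i > 0"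
    using pos_definite_diagonalizable[OF assms(1)] by blast
  have PP: "transpose P ** P = mat 1" "P ** transpose P = mat 1"
    using P by (simp_all add: orthogonal_matrix_def)
  have mult: "(P ** X ** transpose P) ** (P ** Y ** transpose P) = P ** (X ** Y) ** transpose P" for X Y
  proof -
    have "(P ** X ** transpose P) ** (P ** Y ** transpose P)
        = P ** X ** (transpose P ** P) ** Y ** transpose P"
      by (simp only: matrix_mul_assoc)
    then show ?thesis by (simp only: PP matrix_mul_rid matrix_mul_assoc)
  qed
  define R where "R = P ** diag_matrix (\<lambda>i. 1 / sqrt (d i)) ** transpose P"
  have [simp]: "sqrt (d i) * sqrt (d i) = d i" "d i \<noteq> 0" for i
    using d[of i] by auto
  have [simp]: "\<bar>d i\<bar> = d i" for i
    using d[of i] by auto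
  have "G ** (R ** R) = P ** mat 1 ** transpose P"
    unfolding G R_def mult diag_matrix_mult by (simp add: diag_matrix_1)
  then have GR: "G ** (R ** R) = mat 1" by (simp add: PP)
  have "pos_definite R"
    unfolding pos_definite_def
  proof (intro conjI allI impI)
    show "transpose R = R"
      by (simp add: R_def matrix_transpose_mul transpose_transpose matrix_mul_assoc)
    fix u :: "real^'n" assume "u \<noteq> 0"
    define v where "v = transpose P *v u"
    have "v \<noteq> 0"
    proof
      assume "v = 0"
      then have "P *v v = 0" by simp
      then have "u = 0" using PP(2)
        by (simp add: v_def matrix_vector_mul_assoc del: transpose_matrix_vector)
      with \<open>u \<noteq> 0\<close> show False by simp
    qed
    then obtain i where "v $ i \<noteq> 0" by (auto simp: vec_eq_iff)
    then have "0 < (\<Sum>i\<in>UNIV. 1 / sqrt (d i) * (v $ i)\<^sup>2)"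
      using d by (intro sum_pos2[where i=i]) (auto simp: less_imp_le)
    also have "\<dots> = v \<bullet> (diag_matrix (\<lambda>i. 1 / sqrt (d i)) *v v)"
      by (simp add: inner_vec_def power2_eq_square ac_simps)
    also have "\<dots> = u \<bullet> (R *v u)"
      unfolding R_def v_def by (rule inner_sandwich[symmetric])
    finally show "0 < u \<bullet> (R *v u)" .
  qed
  moreover have "R ** R = matrix_inv G" using matrix_inv_eqI[OF GR] by simp
  ultimately have "pos_definite S \<and> S ** S = matrix_inv G"
    unfolding S_def inv_sqrt_matrix_def
    by (intro someI[of "\<lambda>S. pos_definite S \<and> S ** S = matrix_inv G" R]) simp
  then show "transpose S = S" "G ** (S ** S) = mat 1"
    by (simp_all add: pos_definite_def matrix_inv_eqI[OF GR] GR)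
qed

section \<open>Gaussian integrals\<close>

lemma nn_integral_lborel_translation:
  fixes f :: "'a::euclidean_space \<Rightarrow> ennreal"
  assumes [measurable]: "f \<in> borel_measurable borel"
  shows "(\<integral>\<^sup>+x. f (x + t) \<partial>lborel) = (\<integral>\<^sup>+x. f x \<partial>lborel)"
proof -
  have "(\<integral>\<^sup>+x. f x \<partial>lborel) = (\<integral>\<^sup>+x. f x \<partial>(distr lborel borel ((+) t)))"
    by (simp only: lborel_distr_plus)
  also have "\<dots> = (\<integral>\<^sup>+x. f (x + t) \<partial>lborel)"
    by (subst nn_integral_distr) (auto simp: add.commute)
  finally show ?thesis by simp
qed

text \<open>
  The linear change of variables of the library needs a well-ordered index type. The uniqueness of
  Haar measure, applied to the image measure and tested on the unit ball, gives the orthogonal case.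
\<close>

lemma distr_lborel_orthogonal:
  fixes f :: "'a::euclidean_space \<Rightarrow> 'a"
  assumes f: "orthogonal_transformation f"
  shows "distr lborel borel f = lborel"
proof -
  have lin: "linear f" using f by (simp add: orthogonal_transformation)
  have nf: "norm (f x) = norm x" for x using f by (simp add: orthogonal_transformation)
  have mf [measurable]: "f \<in> borel_measurable borel"
    using lin by (intro borel_measurable_continuous_onI linear_continuous_on) (simp add: linear_linear)
  define \<nu> where "\<nu> = distr lborel borel f"
  have [simp]: "sets \<nu> = sets borel" "space \<nu> = UNIV" by (simp_all add: \<nu>_def)
  have [measurable_cong]: "sets \<nu> = sets borel" by simp
  have fball: "f -` ball 0 r = ball 0 r" for r by (auto simp: nf)
  \<comment> \<open>Required by Fubini. An orthogonal map preserves centered balls, so the image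
    measure is finite on them.\<close>
  have "sigma_finite_measure \<nu>"
  proof
    show "\<exists>A. countable A \<and> A \<subseteq> sets \<nu> \<and> \<Union> A = space \<nu> \<and> (\<forall>a\<in>A. emeasure \<nu> a \<noteq> \<infinity>)"
    proof (intro exI[of _ "range (\<lambda>n. ball 0 (real n))"] conjI ballI)
      show "\<Union> (range (\<lambda>n. ball (0::'a) (real n))) = space \<nu>"
        using reals_Archimedean2 by auto
      fix a assume "a \<in> range (\<lambda>n. ball (0::'a) (real n))"
      then show "emeasure \<nu> a \<noteq> \<infinity>"
        using emeasure_lborel_ball_finite[of "0::'a"]
        by (auto simp: \<nu>_def emeasure_distr fball less_top)
    qed auto
  qed
  then interpret pair_sigma_finite lborel \<nu>
    by (auto simp: pair_sigma_finite_def lborel.sigma_finite_measure_axioms)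
  have \<nu>_int: "(\<integral>\<^sup>+y. h y \<partial>\<nu>) = (\<integral>\<^sup>+y. h (f y) \<partial>lborel)" if "h \<in> borel_measurable borel" for h
    using that by (simp add: \<nu>_def nn_integral_distr)
  \<comment> \<open>Translating the image by \<open>t\<close> amounts to translating the argument by
    a preimage \<open>s\<close> of \<open>t\<close>, so translation invariance is inherited.\<close>
  have \<nu>_transl: "(\<integral>\<^sup>+y. h (y + t) \<partial>\<nu>) = (\<integral>\<^sup>+y. h y \<partial>\<nu>)"
    if [measurable]: "h \<in> borel_measurable borel" for h t
  proof -
    obtain s where s: "t = f s"
      using orthogonal_transformation_surj[OF f] by (meson surjD)
    have "(\<integral>\<^sup>+y. h (y + t) \<partial>\<nu>) = (\<integral>\<^sup>+y. h (f (y + s)) \<partial>lborel)"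
      by (subst \<nu>_int) (simp_all add: s linear_add[OF lin])
    also have "\<dots> = (\<integral>\<^sup>+y. h (f y) \<partial>lborel)"
      by (rule nn_integral_lborel_translation) simp
    finally show ?thesis by (simp add: \<nu>_int)
  qed
  define g :: "'a \<Rightarrow> ennreal" where "g = indicator (ball 0 1)"
  have g[measurable]: "g \<in> borel_measurable borel" 
    unfolding g_def by (rule borel_measurable_indicator) simp
  define c where "c = (\<integral>\<^sup>+x. g x \<partial>lborel)"
  have c: "c = emeasure lborel (ball (0::'a) 1)" by (simp add: c_def g_def)
  have vol: "unit_ball_vol (real DIM('a)) \<noteq> 0"
    using unit_ball_vol_pos[of "real DIM('a)"] by (metis less_irrefl of_nat_0_le_iff)
  have c0: "c \<noteq> 0" "c \<noteq> \<infinity>"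
    using emeasure_lborel_ball_finite[of "0::'a" 1] vol
    by (auto simp: c less_top emeasure_ball)
  have g\<nu>: "(\<integral>\<^sup>+y. g (x - y) \<partial>\<nu>) = c" for x
  proof -
    have "(\<integral>\<^sup>+y. g (x - y) \<partial>\<nu>) = (\<integral>\<^sup>+y. g (y + - x) \<partial>\<nu>)"
      by (intro nn_integral_cong) (auto simp: g_def indicator_def norm_minus_commute)
    also have "\<dots> = (\<integral>\<^sup>+y. g (f y) \<partial>lborel)" by (simp only: \<nu>_transl[OF g] \<nu>_int[OF g])
    also have "\<dots> = c" unfolding c_def by (intro nn_integral_cong) (simp add: g_def nf indicator_def)
    finally show ?thesis .
  qed
  have "emeasure \<nu> A = emeasure lborel A" if A: "A \<in> sets borel" for A
  proof -
    note [measurable] = A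
    \<comment> \<open>One double integral is evaluated in two ways. Shifting \<open>y\<close> by
      \<open>x\<close>, exchanging the integrals and substituting \<open>x - y\<close> for
      \<open>x\<close> moves the indicator of \<open>A\<close> from \<open>\<nu>\<close> to Lebesgue
      measure; the factor \<open>c\<close> then cancels.\<close>
    have "c * emeasure \<nu> A = (\<integral>\<^sup>+x. \<integral>\<^sup>+y. g x * indicator A y \<partial>\<nu> \<partial>lborel)"
      using A by (simp add: nn_integral_cmult nn_integral_multc c_def)
    also have "\<dots> = (\<integral>\<^sup>+x. \<integral>\<^sup>+y. g x * indicator A (y + x) \<partial>\<nu> \<partial>lborel)"
    proof (rule nn_integral_cong)
      fix x :: 'a
      have "(\<lambda>y. g x * indicator A y) \<in> borel_measurable borel" by measurable
      from \<nu>_transl[OF this, of x]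
      show "(\<integral>\<^sup>+y. g x * indicator A y \<partial>\<nu>) = (\<integral>\<^sup>+y. g x * indicator A (y + x) \<partial>\<nu>)"
        by simp
    qed
    also have "\<dots> = (\<integral>\<^sup>+y. \<integral>\<^sup>+x. g x * indicator A (y + x) \<partial>lborel \<partial>\<nu>)"
      by (intro Fubini'[symmetric]) measurable
    also have "\<dots> = (\<integral>\<^sup>+y. \<integral>\<^sup>+x. g (x - y) * indicator A x \<partial>lborel \<partial>\<nu>)"
    proof (rule nn_integral_cong)
      fix y :: 'a
      show "(\<integral>\<^sup>+x. g x * indicator A (y + x) \<partial>lborel) = (\<integral>\<^sup>+x. g (x - y) * indicator A x \<partial>lborel)"
        using nn_integral_lborel_translation[of "\<lambda>x. g (x - y) * indicator A x" y]
        by (simp add: add.commute)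
    qed
    also have "\<dots> = (\<integral>\<^sup>+x. \<integral>\<^sup>+y. g (x - y) * indicator A x \<partial>\<nu> \<partial>lborel)"
      by (intro Fubini') measurable
    also have "\<dots> = (\<integral>\<^sup>+x. c * indicator A x \<partial>lborel)"
      by (rule nn_integral_cong) (simp add: nn_integral_multc g\<nu>)
    also have "\<dots> = c * emeasure lborel A"
      using A by (simp add: nn_integral_cmult)
    finally show ?thesis using c0 by (simp add: ennreal_mult_cancel_left)
  qed
  then show ?thesis unfolding \<nu>_def[symmetric] by (intro measure_eqI) auto
qed

lemma nn_integral_exp_neg_square:
  assumes "l > 0"
  shows "(\<integral>\<^sup>+x. ennreal (exp (- (l * x\<^sup>2) / 2)) \<partial>lborel) = ennreal (sqrt (2 * pi / l))"
proof -
  define s where "s = 1 / sqrt l"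
  have s: "s > 0" "s\<^sup>2 = 1 / l" using assms by (simp_all add: s_def power_divide)
  have "exp (- (l * x\<^sup>2) / 2) = sqrt (2 * pi / l) * normal_density 0 s x" for x
    using assms s by (simp add: normal_density_def real_sqrt_divide)
  then have "(\<integral>\<^sup>+x. ennreal (exp (- (l * x\<^sup>2) / 2)) \<partial>lborel)
     = (\<integral>\<^sup>+x. ennreal (sqrt (2 * pi / l)) * ennreal (normal_density 0 s x) \<partial>lborel)"
    using assms by (simp add: ennreal_mult)
  also have "\<dots> = ennreal (sqrt (2 * pi / l)) * (\<integral>\<^sup>+x. ennreal (normal_density 0 s x) \<partial>lborel)"
    by (rule nn_integral_cmult) simp
  also have "(\<integral>\<^sup>+x. ennreal (normal_density 0 s x) \<partial>lborel) = 1"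
    using s by (subst nn_integral_eq_integral) auto
  finally show ?thesis by simp
qed

lemma continuous_on_matrix_vector_mult [continuous_intros]:
  fixes G :: "real ^ 'n ^ 'm"
  assumes "continuous_on S f"
  shows "continuous_on S (\<lambda>x. G *v f x)"
  by (rule continuous_on_compose2[OF linear_continuous_on[OF matrix_vector_mul_bounded_linear] assms]) auto

text \<open>Rotation by the eigenvector matrix leaves Lebesgue measure unchanged and turns the
  exponent into a weighted sum of squares; the integral becomes a product of one-dimensional
  Gaussians, one per eigenvalue.\<close>

lemma nn_integral_centered_gaussian:
  fixes G :: "real ^ 'n ^ 'n::finite"
  assumes "pos_definite G"
  shows "(\<integral>\<^sup>+u. ennreal (exp (- (u \<bullet> (G *v u)) / 2)) \<partial>lborel)
    = ennreal (sqrt ((2 * pi) ^ CARD('n) / det G))"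
proof -
  obtain P d where P: "orthogonal_matrix P" and G: "G = P ** diag_matrix d ** transpose P"
    and d: "\<And>i. d i > 0"
    using pos_definite_diagonalizable[OF assms] by blast
  have PP: "transpose P ** P = mat 1" using P by (simp add: orthogonal_matrix)
  have orth: "orthogonal_transformation ((*v) P)"
    using P by (simp add: orthogonal_transformation_matrix)
  have Pv: "(P *v v) \<bullet> (G *v (P *v v)) = (\<Sum>i\<in>UNIV. d i * (v $ i)\<^sup>2)" for v
  proof -
    have "transpose P *v (P *v v) = v" by (simp only: matrix_vector_mul_assoc PP matrix_vector_mul_lid)
    then have "(P *v v) \<bullet> (G *v (P *v v)) = v \<bullet> (diag_matrix d *v v)"
      unfolding G by (simp only: inner_sandwich)
    then show ?thesis by (simp add: inner_vec_def power2_eq_square ac_simps)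
  qed
  \<comment> \<open>The product formula for \<open>lborel\<close> runs over \<open>Basis\<close>,
    the eigenvalues over the index type; \<open>D\<close> carries each eigenvalue to its axis
    vector.\<close>
  define D where "D b = d (THE i. b = axis i (1::real))" for b :: "real^'n"
  have D: "D (axis i 1) = d i" for i
    by (simp add: D_def axis_eq_axis)
  have prodB: "(\<Prod>b\<in>Basis. F b) = (\<Prod>i\<in>UNIV. F (axis i (1::real)))" for F :: "real^'n \<Rightarrow> 'b::comm_monoid_mult"
  proof -
    have B: "(Basis :: (real^'n) set) = (\<lambda>i. axis i 1) ` UNIV" by (auto simp: Basis_vec_def)
    show ?thesis unfolding B by (subst prod.reindex) (auto simp: inj_def axis_eq_axis)
  qed
  have "(\<integral>\<^sup>+u. ennreal (exp (- (u \<bullet> (G *v u)) / 2)) \<partial>lborel)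
      = (\<integral>\<^sup>+u. ennreal (exp (- (u \<bullet> (G *v u)) / 2)) \<partial>distr lborel borel ((*v) P))"
    by (simp only: distr_lborel_orthogonal[OF orth])
  also have "\<dots> = (\<integral>\<^sup>+v. ennreal (exp (- (\<Sum>i\<in>UNIV. d i * (v $ i)\<^sup>2) / 2)) \<partial>lborel)"
    by (subst nn_integral_distr)
      (auto simp: Pv intro!: borel_measurable_continuous_onI measurable_compose[OF _ measurable_ennreal] continuous_intros)
  also have "\<dots> = (\<integral>\<^sup>+v. (\<Prod>b\<in>Basis. ennreal (exp (- (D b * (v \<bullet> b)\<^sup>2) / 2))) \<partial>lborel)"
    by (intro nn_integral_cong)
      (simp add: prodB D inner_axis prod_ennreal sum_divide_distrib sum_negf flip: exp_sum)
  also have "\<dots> = (\<Prod>b\<in>Basis. (\<integral>\<^sup>+x. ennreal (exp (- (D b * x\<^sup>2) / 2)) \<partial>lborel))"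
    by (rule nn_integral_lborel_prod) auto
  also have "\<dots> = (\<Prod>i\<in>UNIV. ennreal (sqrt (2 * pi / d i)))"
    unfolding prodB D by (simp only: nn_integral_exp_neg_square d)
  also have "\<dots> = ennreal (\<Prod>i\<in>UNIV. sqrt (2 * pi / d i))"
    using d by (intro prod_ennreal) (simp add: less_imp_le)
  also have "(\<Prod>i\<in>UNIV. sqrt (2 * pi / d i)) = sqrt (\<Prod>i\<in>UNIV. 2 * pi / d i)"
  proof -
    have "(\<Prod>i\<in>A. sqrt (F i)) = sqrt (\<Prod>i\<in>A. F i)" for A :: "'n set" and F
      by (induct A rule: infinite_finite_induct) (auto simp: real_sqrt_mult)
    then show ?thesis .
  qed
  also have "(\<Prod>i\<in>UNIV. 2 * pi / d i) = (2 * pi) ^ CARD('n) / det G"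
    unfolding G by (simp add: det_orthogonal_sandwich[OF P] det_diag_matrix prod_dividef)
  finally show ?thesis .
qed

section \<open>Gaussian integrals with a linear term\<close>

definition log_quad :: "real ^ 'n \<Rightarrow> real ^ 'n ^ 'n \<Rightarrow> real ^ 'n \<Rightarrow> real" where
  "log_quad \<Delta> G u = \<Delta> \<bullet> u - (u \<bullet> (G *v u)) / 2"

lemma continuous_log_quad [continuous_intros]: "continuous_on S (log_quad \<Delta> G)"
  unfolding log_quad_def by (intro continuous_intros) simp

lemma borel_measurable_log_quad [measurable]: "log_quad \<Delta> G \<in> borel_measurable borel"
  by (intro borel_measurable_continuous_onI continuous_log_quad)

text \<open>\<open>w\<close> is the vertex, the solution of \<open>G *v w = \<Delta>\<close>. It is
  written through the inverse square root because the maximal value then appears as the squared norm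
  in the theorem.\<close>

lemma log_quad_complete_square:
  fixes G :: "real ^ 'n ^ 'n::finite" and \<Delta> :: "real ^ 'n"
  assumes G: "pos_definite G"
  defines "S \<equiv> inv_sqrt_matrix G"
  defines "w \<equiv> S *v (S *v \<Delta>)"
  shows "log_quad \<Delta> G (v + w) = (norm (S *v \<Delta>))\<^sup>2 / 2 - (v \<bullet> (G *v v)) / 2"
proof -
  have S: "transpose S = S" "G ** (S ** S) = mat 1"
    using inv_sqrt_matrix_props[OF G] by (simp_all add: S_def)
  have Gw: "G *v w = \<Delta>"
    unfolding w_def by (simp only: matrix_vector_mul_assoc S(2) matrix_vector_mul_lid)
  have sG: "x \<bullet> (G *v y) = (G *v x) \<bullet> y" for x y
    using G dot_lmul_matrix[of x G y] by (metis transpose_matrix_vector pos_definite_def)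
  have Dw: "\<Delta> \<bullet> w = (norm (S *v \<Delta>))\<^sup>2"
    unfolding w_def using dot_lmul_matrix[of \<Delta> S "S *v \<Delta>"] S(1)
    by (metis power2_norm_eq_inner transpose_matrix_vector)
  have wv: "w \<bullet> (G *v v) = \<Delta> \<bullet> v" by (simp add: sG Gw)
  show ?thesis
    unfolding log_quad_def
    by (simp add: matrix_vector_right_distrib inner_add_left inner_add_right Gw wv Dw inner_commute[of w \<Delta>] inner_commute[of v \<Delta>])
       (simp add: field_simps)
qed

text \<open>The total mass of \<open>exp (log_quad \<Delta> G u)\<close>. It stays one symbol in the
  asymptotic statements; \<open>ln_gauss_mass\<close> later splits its logarithm into the dimension,
  determinant and score terms.\<close>

definition gauss_mass :: "real ^ 'n \<Rightarrow> real ^ 'n ^ 'n \<Rightarrow> real" where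
  "gauss_mass \<Delta> G = sqrt ((2 * pi) ^ CARD('n) / det G)
     * exp ((norm (inv_sqrt_matrix G *v \<Delta>))\<^sup>2 / 2)"

lemma nn_integral_gaussian:
  fixes G :: "real ^ 'n ^ 'n::finite"
  assumes G: "pos_definite G"
  shows "(\<integral>\<^sup>+u. ennreal (exp (log_quad \<Delta> G u)) \<partial>lborel) = ennreal (gauss_mass \<Delta> G)"
proof -
  define S where "S = inv_sqrt_matrix G"
  define w where "w = S *v (S *v \<Delta>)"
  have "(\<integral>\<^sup>+u. ennreal (exp (log_quad \<Delta> G u)) \<partial>lborel)
     = (\<integral>\<^sup>+v. ennreal (exp (log_quad \<Delta> G (v + w))) \<partial>lborel)"
    by (rule nn_integral_lborel_translation[symmetric]) simp
  also have "\<dots> = (\<integral>\<^sup>+v. ennreal (exp ((norm (S *v \<Delta>))\<^sup>2 / 2)) * ennreal (exp (- (v \<bullet> (G *v v)) / 2)) \<partial>lborel)"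
    by (simp add: w_def S_def log_quad_complete_square[OF G] ennreal_mult[symmetric] diff_conv_add_uminus exp_add[symmetric] del: add_uminus_conv_diff)
  also have "\<dots> = ennreal (exp ((norm (S *v \<Delta>))\<^sup>2 / 2)) * (\<integral>\<^sup>+v. ennreal (exp (- (v \<bullet> (G *v v)) / 2)) \<partial>lborel)"
    by (intro nn_integral_cmult measurable_compose[OF _ measurable_ennreal] borel_measurable_continuous_onI)
      (auto intro!: continuous_intros borel_measurable_continuous_onI)
  also have "\<dots> = ennreal (gauss_mass \<Delta> G)"
    using pos_definite_det_pos[OF G]
    unfolding nn_integral_centered_gaussian[OF G]
    by (simp add: gauss_mass_def S_def ennreal_mult[symmetric] mult.commute)
  finally show ?thesis .
qed

lemma ln_gauss_mass:
  fixes G :: "real ^ 'n ^ 'n::finite"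
  assumes G: "pos_definite G"
  shows "gauss_mass \<Delta> G > 0"
    "ln (gauss_mass \<Delta> G) = real CARD('n) / 2 * ln (2 * pi) - 1/2 * ln (det G)
       + 1/2 * (norm (inv_sqrt_matrix G *v \<Delta>))\<^sup>2"
  using pos_definite_det_pos[OF G]
  by (simp_all add: gauss_mass_def ln_mult ln_sqrt ln_div ln_realpow field_simps)

section \<open>Stochastic orders\<close>

text \<open>A fixed \<open>\<delta>\<close> instead of a limit allows the events to involve
  constants that depend on \<open>\<delta>\<close>, such as bounds for \<open>\<Gamma>0\<close> and
  the score, and lets finitely many events be intersected at the cost of adding their
  \<open>\<delta>\<close>.\<close>

definition ev_prob :: "'w measure \<Rightarrow> real \<Rightarrow> (nat \<Rightarrow> 'w \<Rightarrow> bool) \<Rightarrow> bool" where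
  "ev_prob M \<delta> P \<longleftrightarrow>
     (\<forall>\<^sub>F n in sequentially. outer_measure_of M {\<omega> \<in> space M. \<not> P n \<omega>} < ennreal \<delta>)"

text \<open>Each set has a measurable cover with the same outer measure, which reduces the claim to
  measurable sets.\<close>

lemma outer_measure_of_Un_le:
  assumes "A \<subseteq> space M" "B \<subseteq> space M"
  shows "outer_measure_of M (A \<union> B) \<le> outer_measure_of M A + outer_measure_of M B"
proof -
  obtain E F where EF: "E \<in> sets M" "A \<subseteq> E" "outer_measure_of M A = emeasure M E"
    "F \<in> sets M" "B \<subseteq> F" "outer_measure_of M B = emeasure M F"
    using outer_measure_of_attain assms by metis
  have "outer_measure_of M (A \<union> B) \<le> outer_measure_of M (E \<union> F)"
    using EF by (intro outer_measure_of_mono) auto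
  also have "\<dots> = emeasure M (E \<union> F)" using EF by simp
  also have "\<dots> \<le> emeasure M E + emeasure M F" using EF by (intro emeasure_subadditive)
  finally show ?thesis using EF by simp
qed

lemma ev_prob_mono:
  assumes "ev_prob M \<delta> P" "\<delta> \<le> \<delta>'"
    and "\<forall>\<^sub>F n in sequentially. \<forall>\<omega>\<in>space M. P n \<omega> \<longrightarrow> Q n \<omega>"
  shows "ev_prob M \<delta>' Q"
  using assms(1) assms(3) unfolding ev_prob_def
proof eventually_elim
  case (elim n)
  have "outer_measure_of M {\<omega> \<in> space M. \<not> Q n \<omega>} \<le> outer_measure_of M {\<omega> \<in> space M. \<not> P n \<omega>}"
    using elim(2) by (intro outer_measure_of_mono) auto
  also note elim(1)
  also have "ennreal \<delta> \<le> ennreal \<delta>'" using assms(2) by (rule ennreal_leI)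
  finally show ?case .
qed

lemma ev_prob_weaken:
  assumes "ev_prob M \<delta> P" "\<And>n \<omega>. \<omega> \<in> space M \<Longrightarrow> P n \<omega> \<Longrightarrow> Q n \<omega>"
  shows "ev_prob M \<delta> Q"
  by (rule ev_prob_mono[OF assms(1) order_refl]) (simp add: assms(2))

lemma ev_prob_conj:
  assumes "ev_prob M \<delta> P" "ev_prob M \<delta>' Q"
  shows "ev_prob M (\<delta> + \<delta>') (\<lambda>n \<omega>. P n \<omega> \<and> Q n \<omega>)"
  using assms unfolding ev_prob_def
proof eventually_elim
  case (elim n)
  have "{\<omega> \<in> space M. \<not> (P n \<omega> \<and> Q n \<omega>)} = {\<omega> \<in> space M. \<not> P n \<omega>} \<union> {\<omega> \<in> space M. \<not> Q n \<omega>}"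
    by auto
  then have "outer_measure_of M {\<omega> \<in> space M. \<not> (P n \<omega> \<and> Q n \<omega>)}
    \<le> outer_measure_of M {\<omega> \<in> space M. \<not> P n \<omega>} + outer_measure_of M {\<omega> \<in> space M. \<not> Q n \<omega>}"
    by (simp only:) (rule outer_measure_of_Un_le; blast)
  also have "\<dots> < ennreal (\<delta> + \<delta>')" using elim by (rule add_mono_ennreal)
  finally show ?case .
qed

lemma ev_prob_conj_half:
  assumes "ev_prob M (\<delta> / 2) P" "ev_prob M (\<delta> / 2) Q"
  shows "ev_prob M \<delta> (\<lambda>n \<omega>. P n \<omega> \<and> Q n \<omega>)"
  using ev_prob_conj[OF assms] by simp

lemma ev_prob_AE:
  assumes "\<And>n. AE \<omega> in M. P n \<omega>" "\<delta> > 0"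
  shows "ev_prob M \<delta> P"
  unfolding ev_prob_def
proof (intro always_eventually allI)
  fix n
  obtain N where N: "N \<in> sets M" "emeasure M N = 0" "{\<omega> \<in> space M. \<not> P n \<omega>} \<subseteq> N"
    using assms(1)[of n] by (auto elim!: AE_E)
  have "outer_measure_of M {\<omega> \<in> space M. \<not> P n \<omega>} \<le> outer_measure_of M N"
    using N by (intro outer_measure_of_mono) auto
  then show "outer_measure_of M {\<omega> \<in> space M. \<not> P n \<omega>} < ennreal \<delta>" using N assms(2) by simp
qed

lemma tendsto_0_ennreal_iff:
  fixes X :: "'a \<Rightarrow> ennreal"
  shows "(X \<longlongrightarrow> 0) F \<longleftrightarrow> (\<forall>\<delta>>0. \<forall>\<^sub>F n in F. X n < ennreal \<delta>)"
proof
  assume "(X \<longlongrightarrow> 0) F"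
  then show "\<forall>\<delta>>0. \<forall>\<^sub>F n in F. X n < ennreal \<delta>"
    by (auto intro: order_tendstoD(2))
next
  assume *: "\<forall>\<delta>>0. \<forall>\<^sub>F n in F. X n < ennreal \<delta>"
  show "(X \<longlongrightarrow> 0) F"
  proof (rule order_tendstoI)
    fix a :: ennreal assume "0 < a"
    \<comment> \<open>\<open>a\<close> may be infinite, so a real level strictly below it is
      inserted.\<close>
    then obtain r where r: "0 < ennreal r" "ennreal r < a"
      using dense[of 0 a] by (metis ennreal_cases less_top order_less_trans top.not_eq_extremum)
    then have "r > 0" by simp
    with * have "\<forall>\<^sub>F n in F. X n < ennreal r" by blast
    then show "\<forall>\<^sub>F n in F. X n < a" by eventually_elim (use r in auto)
  qed simp
qed

lemma outer_tendsto_0_iff: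
  "(\<lambda>n. outer_measure_of M {\<omega> \<in> space M. \<not> P n \<omega>}) \<longlonglongrightarrow> 0 \<longleftrightarrow> (\<forall>\<delta>>0. ev_prob M \<delta> P)"
  by (simp add: tendsto_0_ennreal_iff ev_prob_def)

lemma small_op_iff:
  "small_op M Y \<longleftrightarrow> (\<forall>\<epsilon>>0. \<forall>\<delta>>0. ev_prob M \<delta> (\<lambda>n \<omega>. norm (Y n \<omega>) \<le> \<epsilon>))"
  by (simp add: small_op_def tendsto_0_ennreal_iff ev_prob_def not_le)

lemma small_opD:
  "small_op M Y \<Longrightarrow> \<epsilon> > 0 \<Longrightarrow> \<delta> > 0 \<Longrightarrow> ev_prob M \<delta> (\<lambda>n \<omega>. norm (Y n \<omega>) \<le> \<epsilon>)"
  by (simp add: small_op_iff)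

lemma big_OpD:
  assumes "big_Op M Y" "\<delta> > 0"
  obtains C where "C > 0" "ev_prob M \<delta> (\<lambda>n \<omega>. norm (Y n \<omega>) \<le> C)"
proof -
  have "\<exists>C. ev_prob M \<delta> (\<lambda>n \<omega>. norm (Y n \<omega>) \<le> C)"
    using assms by (simp add: big_Op_def ev_prob_def not_le)
  then obtain C where C: "ev_prob M \<delta> (\<lambda>n \<omega>. norm (Y n \<omega>) \<le> C)" ..
  have "ev_prob M \<delta> (\<lambda>n \<omega>. norm (Y n \<omega>) \<le> max C 1)"
    by (rule ev_prob_weaken[OF C]) auto
  then show thesis by (intro that[of "max C 1"]) auto
qed

section \<open>Calculus of o_p\<close>

lemma small_op_add:
  assumes "small_op M X" "small_op M Y"
  shows "small_op M (\<lambda>n \<omega>. X n \<omega> + Y n \<omega>)"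
  unfolding small_op_iff
proof (intro allI impI)
  fix \<epsilon> \<delta> :: real assume "0 < \<epsilon>" "0 < \<delta>"
  then have "ev_prob M \<delta> (\<lambda>n \<omega>. norm (X n \<omega>) \<le> \<epsilon>/2 \<and> norm (Y n \<omega>) \<le> \<epsilon>/2)"
    using assms by (intro ev_prob_conj_half small_opD) auto
  then show "ev_prob M \<delta> (\<lambda>n \<omega>. norm (X n \<omega> + Y n \<omega>) \<le> \<epsilon>)"
    by (rule ev_prob_weaken) (auto intro: norm_triangle_le)
qed

lemma small_op_scaleR:
  assumes "small_op M X"
  shows "small_op M (\<lambda>n \<omega>. c *\<^sub>R X n \<omega>)"
  unfolding small_op_iff
proof (intro allI impI)
  fix \<epsilon> \<delta> :: real assume "0 < \<epsilon>" "0 < \<delta>"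
  then have "ev_prob M \<delta> (\<lambda>n \<omega>. norm (X n \<omega>) \<le> \<epsilon> / (\<bar>c\<bar> + 1))"
    using assms by (intro small_opD) auto
  then show "ev_prob M \<delta> (\<lambda>n \<omega>. norm (c *\<^sub>R X n \<omega>) \<le> \<epsilon>)"
  proof (rule ev_prob_weaken)
    fix n \<omega> assume "norm (X n \<omega>) \<le> \<epsilon> / (\<bar>c\<bar> + 1)"
    then have "norm (X n \<omega>) * (\<bar>c\<bar> + 1) \<le> \<epsilon>" by (simp add: field_simps)
    then show "norm (c *\<^sub>R X n \<omega>) \<le> \<epsilon>"
      by (simp add: algebra_simps) (use norm_ge_zero[of "X n \<omega>"] in linarith)
  qed
qed

lemma small_op_zero: "small_op M (\<lambda>n \<omega>. 0)"
  by (simp add: small_op_def outer_measure_of_eq)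

lemma small_op_sum:
  assumes "\<And>k. k \<in> I \<Longrightarrow> small_op M (X k)"
  shows "small_op M (\<lambda>n \<omega>. \<Sum>k\<in>I. X k n \<omega>)"
  using assms by (induct I rule: infinite_finite_induct) (auto simp: small_op_zero intro: small_op_add)

text \<open>Logarithms can be split or combined only where their arguments are positive. Such
  identities hold on events of high probability, which is enough to transfer o_p.\<close>

lemma small_op_cong_ev:
  assumes "small_op M X" "\<And>\<delta>. \<delta> > 0 \<Longrightarrow> ev_prob M \<delta> (\<lambda>n \<omega>. X n \<omega> = Y n \<omega>)"
  shows "small_op M Y"
  unfolding small_op_iff
proof (intro allI impI)
  fix \<epsilon> \<delta> :: real assume "0 < \<epsilon>" "0 < \<delta>"
  then have "ev_prob M \<delta> (\<lambda>n \<omega>. norm (X n \<omega>) \<le> \<epsilon> \<and> X n \<omega> = Y n \<omega>)"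
    using assms by (intro ev_prob_conj_half small_opD) auto
  then show "ev_prob M \<delta> (\<lambda>n \<omega>. norm (Y n \<omega>) \<le> \<epsilon>)"
    by (rule ev_prob_weaken) auto
qed

text \<open>Convergence in law is tested on continuous functions, so the indicator of the complement
  of a ball is dominated by a continuous ramp. The ramp has small integral under the limit law once
  \<open>k\<close> is large, and then under the laws of \<open>Y n\<close> for large
  \<open>n\<close>.\<close>

lemma converges_in_law_tight:
  fixes Y :: "nat \<Rightarrow> 'w \<Rightarrow> 'b::euclidean_space"
  assumes M: "prob_space M" and \<mu>: "prob_space \<mu>" and sets: "sets \<mu> = sets borel"
    and Y [measurable]: "\<And>n. Y n \<in> borel_measurable M"
    and conv: "converges_in_law M Y \<mu>" and "\<delta> > 0"
  obtains C where "C > 0" "ev_prob M \<delta> (\<lambda>n \<omega>. norm (Y n \<omega>) \<le> C)"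
proof -
  interpret M: prob_space M by fact
  interpret \<mu>: prob_space \<mu> by fact
  note sets [measurable_cong]
  \<comment> \<open>The ramp vanishes up to norm \<open>k\<close> and equals 1 from
    \<open>k + 1\<close> on, hence the bound \<open>k + 1\<close> obtained below.\<close>
  define f where "f k y = min 1 (max 0 (norm y - real k))" for k and y :: 'b
  have f01: "0 \<le> f k y" "f k y \<le> 1" for k y by (auto simp: f_def)
  have cont: "continuous_on UNIV (f k)" for k
    unfolding f_def by (intro continuous_intros)
  then have [measurable]: "f k \<in> borel_measurable borel" for k
    by (rule borel_measurable_continuous_onI)
  have "(\<lambda>k. \<integral>y. f k y \<partial>\<mu>) \<longlonglongrightarrow> (\<integral>y. 0 \<partial>\<mu>)"
  proof (rule integral_dominated_convergence[where w = "\<lambda>_. 1"])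
    show "AE y in \<mu>. (\<lambda>k. f k y) \<longlonglongrightarrow> 0"
    proof (intro AE_I2 tendsto_eventually)
      fix y :: 'b
      obtain m where "norm y \<le> real m" using real_arch_simple by blast
      then show "\<forall>\<^sub>F k in sequentially. f k y = 0"
        unfolding eventually_sequentially by (intro exI[of _ m]) (auto simp: f_def)
    qed
  qed (use f01 in auto)
  then have "\<forall>\<^sub>F k in sequentially. (\<integral>y. f k y \<partial>\<mu>) < \<delta>"
    using \<open>\<delta> > 0\<close> by (intro order_tendstoD(2)) auto
  then obtain k where k: "(\<integral>y. f k y \<partial>\<mu>) < \<delta>" using eventually_happens[of _ sequentially] by auto
  have "bounded (range (f k))"
    using f01 by (intro boundedI[of _ 1]) auto
  then have "(\<lambda>n. \<integral>\<omega>. f k (Y n \<omega>) \<partial>M) \<longlonglongrightarrow> (\<integral>y. f k y \<partial>\<mu>)"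
    using conv cont by (simp add: converges_in_law_def)
  then have ev: "\<forall>\<^sub>F n in sequentially. (\<integral>\<omega>. f k (Y n \<omega>) \<partial>M) < \<delta>"
    using k by (rule order_tendstoD(2))
  have "ev_prob M \<delta> (\<lambda>n \<omega>. norm (Y n \<omega>) \<le> real k + 1)"
    unfolding ev_prob_def using ev
  proof eventually_elim
    case (elim n)
    define B where "B = {\<omega> \<in> space M. \<not> norm (Y n \<omega>) \<le> real k + 1}"
    have [measurable]: "B \<in> sets M" unfolding B_def by measurable
    have "measure M B = (\<integral>\<omega>. indicat_real B \<omega> \<partial>M)" by simp
    also have "\<dots> \<le> (\<integral>\<omega>. f k (Y n \<omega>) \<partial>M)"
    proof (rule integral_mono)
      show "integrable M (\<lambda>\<omega>. f k (Y n \<omega>))"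
        using f01 by (intro M.integrable_const_bound[where B = 1]) auto
      show "indicat_real B \<omega> \<le> f k (Y n \<omega>)" for \<omega>
        using f01 by (auto simp: indicator_def B_def f_def)
    qed (auto intro: M.integrable_const_bound[where B = 1] simp: indicator_def)
    finally have "measure M B < \<delta>" using elim by simp
    then show ?case
      unfolding B_def[symmetric] by (simp add: M.emeasure_eq_measure ennreal_less_iff)
  qed
  then show thesis by (intro that[of "real k + 1"]) auto
qed

text \<open>Continuity from above for the exceptional sets, with closedness providing measurability.
  It confines \<open>\<Gamma>0\<close> to one of the sets \<open>pd_compact\<close> at a level
  independent of \<open>n\<close>.\<close>

lemma AE_exhaustion_ev_prob:
  fixes K :: "nat \<Rightarrow> 'b::topological_space set"
  assumes M: "prob_space M" and X [measurable]: "X \<in> borel_measurable M"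
    and K: "\<And>m. closed (K m)" "\<And>m. K m \<subseteq> K (Suc m)"
    and ae: "AE \<omega> in M. \<exists>m. X \<omega> \<in> K m" and "\<delta> > 0"
  obtains m where "ev_prob M \<delta> (\<lambda>n \<omega>. X \<omega> \<in> K m)"
proof -
  interpret M: prob_space M by fact
  define B where "B m = {\<omega> \<in> space M. X \<omega> \<notin> K m}" for m
  have [measurable]: "K m \<in> sets borel" for m using K by simp
  have [measurable]: "B m \<in> sets M" for m unfolding B_def by measurable
  have "(\<lambda>m. emeasure M (B m)) \<longlonglongrightarrow> emeasure M (\<Inter>m. B m)"
  proof (rule Lim_emeasure_decseq)
    show "decseq B" using K(2) by (intro decseq_SucI) (auto simp: B_def)
  qed auto
  moreover have "emeasure M (\<Inter>m. B m) = 0"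
  proof -
    have "AE \<omega> in M. \<omega> \<notin> (\<Inter>m. B m)" using ae by eventually_elim (auto simp: B_def)
    then show ?thesis by (subst (asm) AE_iff_measurable[of "\<Inter>m. B m"]) (auto simp: B_def)
  qed
  ultimately have "\<forall>\<^sub>F m in sequentially. emeasure M (B m) < ennreal \<delta>"
    using \<open>\<delta> > 0\<close> by (simp add: tendsto_0_ennreal_iff)
  then obtain m where "emeasure M (B m) < ennreal \<delta>" using eventually_happens[of _ sequentially] by auto
  then have "outer_measure_of M (B m) < ennreal \<delta>" by simp
  then have "ev_prob M \<delta> (\<lambda>n \<omega>. X \<omega> \<in> K m)" by (simp add: ev_prob_def B_def)
  then show thesis by (rule that)
qed

section \<open>Local expansions\<close>

text \<open>Smoothness and the third-order condition are phrased through iterated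
  \<open>partial_d\<close>, so Taylor arguments run along segments with directional derivatives
  expanded into partial ones.\<close>

lemma has_real_derivative_along_line:
  fixes f :: "real ^ 'n::finite \<Rightarrow> real"
  assumes "f differentiable (at (x + t *\<^sub>R v))"
  shows "((\<lambda>t. f (x + t *\<^sub>R v)) has_real_derivative
    (\<Sum>i\<in>UNIV. v $ i * partial_d i f (x + t *\<^sub>R v))) (at t)"
proof -
  define f' where "f' = frechet_derivative f (at (x + t *\<^sub>R v))"
  have f': "(f has_derivative f') (at (x + t *\<^sub>R v))"
    using assms unfolding f'_def by (simp add: frechet_derivative_works)
  then have lin: "linear f'" by (rule has_derivative_linear)
  have "f' v = f' (\<Sum>i\<in>UNIV. v $ i *\<^sub>R axis i 1)"
    using basis_expansion[of v] by (simp add: scalar_mult_eq_scaleR)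
  also have "\<dots> = (\<Sum>i\<in>UNIV. v $ i * partial_d i f (x + t *\<^sub>R v))"
    by (simp add: linear_sum[OF lin] linear_cmul[OF lin]) (simp add: partial_d_def f'_def)
  finally have f'v: "f' v = (\<Sum>i\<in>UNIV. v $ i * partial_d i f (x + t *\<^sub>R v))" .
  have "((\<lambda>t. x + t *\<^sub>R v) has_derivative (\<lambda>s. s *\<^sub>R v)) (at t)"
    by (auto intro!: derivative_eq_intros)
  from has_derivative_compose[OF this f']
  have "((\<lambda>t. f (x + t *\<^sub>R v)) has_derivative (\<lambda>s. f' (s *\<^sub>R v))) (at t)" .
  moreover have "(\<lambda>s. f' (s *\<^sub>R v)) = (*) (f' v)" by (auto simp: linear_cmul[OF lin])
  ultimately show ?thesis by (simp add: has_field_derivative_def f'v)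
qed

lemma convex_line_point:
  fixes x v :: "'a::real_vector"
  assumes "convex S" "x \<in> S" "x + v \<in> S" "0 \<le> t" "t \<le> 1"
  shows "x + t *\<^sub>R v \<in> S"
  using convexD_alt[OF assms] by (simp add: algebra_simps)

lemma C_3_onD:
  assumes "C_k_on 3 S h" "x \<in> S"
  shows "h differentiable (at x)" "partial_d i h differentiable (at x)"
    "partial_d j (partial_d i h) differentiable (at x)"
  using assms by (auto simp: numeral_3_eq_3)

lemma third_order_supD:
  fixes A :: "real ^ 'n ^ 'n::finite"
  assumes "third_order_sup S A h \<le> ereal \<eta>" "x \<in> S"
  shows "\<bar>A $ i $ i * A $ j $ j * A $ k $ k * partial_d i (partial_d j (partial_d k h)) x\<bar> \<le> \<eta>"
proof -
  have "ereal \<bar>A $ i $ i * A $ j $ j * A $ k $ k * partial_d i (partial_d j (partial_d k h)) x\<bar>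
    \<le> third_order_sup S A h"
    unfolding third_order_sup_def
    by (rule SUP_upper2[of i], simp, rule SUP_upper2[of j], simp, rule SUP_upper2[of k], simp,
        rule SUP_upper2[OF assms(2)], simp)
  also note assms(1)
  finally show ?thesis by simp
qed

text \<open>Taylor expansion along the segment from \<open>x\<close> to \<open>x + A *v u\<close>.
  As \<open>A\<close> is diagonal, the three direction factors in the remainder contribute exactly
  the weights of \<open>third_order_sup\<close>, which leaves the cube of the l1 norm of
  \<open>u\<close>.\<close>

lemma local_taylor_bound:
  fixes u :: "real ^ 'n::finite"
  assumes S: "convex S" "x \<in> S" "x + A *v u \<in> S" and h: "C_k_on 3 S h"
    and A: "A = diag_matrix c" and \<eta>: "third_order_sup S A h \<le> ereal \<eta>"
  shows "\<bar>h (x + A *v u) - h x - log_quad (Delta A h x) (Gam A h x) u\<bar> \<le> \<eta> * (\<Sum>i\<in>UNIV. \<bar>u $ i\<bar>) ^ 3 / 6"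
proof -
  define v where "v = A *v u"
  have v: "v $ i = c i * u $ i" for i by (simp add: v_def A)
  have inS: "x + t *\<^sub>R v \<in> S" if "0 \<le> t" "t \<le> 1" for t
    using convex_line_point[OF S(1,2) _ that] S(3) by (simp add: v_def)
  \<comment> \<open>The successive derivatives in \<open>t\<close> of \<open>h\<close> along the
    segment, in the form required by Maclaurin's theorem.\<close>
  define d where "d m t = (if m = 0 then h (x + t *\<^sub>R v)
    else if m = 1 then \<Sum>k\<in>UNIV. v $ k * partial_d k h (x + t *\<^sub>R v)
    else if m = 2 then \<Sum>k\<in>UNIV. v $ k * (\<Sum>j\<in>UNIV. v $ j * partial_d j (partial_d k h) (x + t *\<^sub>R v))
    else \<Sum>k\<in>UNIV. v $ k * (\<Sum>j\<in>UNIV. v $ j * (\<Sum>i\<in>UNIV. v $ i * partial_d i (partial_d j (partial_d k h)) (x + t *\<^sub>R v))))"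
    for m :: nat and t :: real
  have "\<exists>t>0. t < 1 \<and> d 0 1 = (\<Sum>m<3. d m 0 / fact m * 1 ^ m) + d 3 t / fact 3 * 1 ^ 3"
  proof (rule Maclaurin[of 1 3 d "d 0"]; (intro allI impI)?)
    fix m :: nat and t :: real assume m: "m < 3 \<and> 0 \<le> t \<and> t \<le> 1"
    note D = has_real_derivative_along_line[OF C_3_onD(1)[OF h inS]]
      has_real_derivative_along_line[OF C_3_onD(2)[OF h inS]]
      has_real_derivative_along_line[OF C_3_onD(3)[OF h inS]]
    from m consider "m = 0" | "m = 1" | "m = 2" by linarith
    then show "(d m has_real_derivative d (Suc m) t) (at t)"
    proof cases
      case 1 then show ?thesis unfolding d_def using m by (simp add: D)
    next
      case 2 then show ?thesis unfolding d_def using m by (auto intro!: DERIV_sum DERIV_cmult D)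
    next
      case 3 then show ?thesis unfolding d_def using m by (auto intro!: DERIV_sum DERIV_cmult D)
    qed
  qed auto
  then obtain t where t: "0 < t" "t < 1"
    and eq: "d 0 1 = d 0 0 + d 1 0 + d 2 0 / 2 + d 3 t / 6"
    by (auto simp: numeral_3_eq_3 numeral_2_eq_2)
  have d1: "d 1 0 = Delta A h x \<bullet> u"
    by (simp add: d_def Delta_def gradient_def inner_vec_def v A ac_simps)
  have "(Gam A h x *v u) = - (A *v (hessian h x *v (A *v u)))"
  proof -
    have "(- X) *v u = - (X *v u)" for X :: "real^'n^'n"
      by (simp add: matrix_vector_mult_def vec_eq_iff sum_negf)
    then show ?thesis by (simp only: Gam_def matrix_vector_mul_assoc matrix_mul_assoc)
  qed
  then have "u \<bullet> (Gam A h x *v u) = - (\<Sum>i\<in>UNIV. u $ i * (c i * (\<Sum>j\<in>UNIV. hessian h x $ i $ j * (c j * u $ j))))"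
    by (simp add: inner_vec_def A sum_negf matrix_vector_mult_def[of "hessian h x"])
  also have "\<dots> = - (\<Sum>i\<in>UNIV. \<Sum>j\<in>UNIV. v $ i * (v $ j * partial_d i (partial_d j h) x))"
    by (simp add: hessian_def v sum_distrib_left ac_simps)
  \<comment> \<open>In \<open>d 2\<close> the outer sum carries the index differentiated first, in
    the Hessian form it carries the one differentiated last, hence the exchange of sums.\<close>
  also have "\<dots> = - d 2 0"
    by (subst sum.swap) (simp add: d_def sum_distrib_left ac_simps)
  finally have d2: "u \<bullet> (Gam A h x *v u) = - d 2 0" .
  have "\<bar>d 3 t\<bar> \<le> (\<Sum>k\<in>UNIV. \<Sum>j\<in>UNIV. \<Sum>i\<in>UNIV. \<bar>u $ k\<bar> * \<bar>u $ j\<bar> * \<bar>u $ i\<bar> * \<eta>)"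
  proof -
    have "d 3 t = (\<Sum>k\<in>UNIV. \<Sum>j\<in>UNIV. \<Sum>i\<in>UNIV. v $ k * v $ j * v $ i * partial_d i (partial_d j (partial_d k h)) (x + t *\<^sub>R v))"
      by (simp add: d_def sum_distrib_left mult.assoc)
    also have "\<bar>\<dots>\<bar> \<le> (\<Sum>k\<in>UNIV. \<Sum>j\<in>UNIV. \<Sum>i\<in>UNIV. \<bar>v $ k * v $ j * v $ i * partial_d i (partial_d j (partial_d k h)) (x + t *\<^sub>R v)\<bar>)"
      by (intro order_trans[OF sum_abs] sum_mono order_refl)
    also have "\<dots> \<le> (\<Sum>k\<in>UNIV. \<Sum>j\<in>UNIV. \<Sum>i\<in>UNIV. \<bar>u $ k\<bar> * \<bar>u $ j\<bar> * \<bar>u $ i\<bar> * \<eta>)"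
    proof (intro sum_mono)
      fix i j k
      have "\<bar>v $ k * v $ j * v $ i * partial_d i (partial_d j (partial_d k h)) (x + t *\<^sub>R v)\<bar>
        = \<bar>u $ k\<bar> * \<bar>u $ j\<bar> * \<bar>u $ i\<bar> * \<bar>A $ i $ i * A $ j $ j * A $ k $ k * partial_d i (partial_d j (partial_d k h)) (x + t *\<^sub>R v)\<bar>"
        by (simp add: v A diag_matrix_def abs_mult)
      also have "\<dots> \<le> \<bar>u $ k\<bar> * \<bar>u $ j\<bar> * \<bar>u $ i\<bar> * \<eta>"
        using t by (intro mult_left_mono third_order_supD[OF \<eta>] inS) auto
      finally show "\<bar>v $ k * v $ j * v $ i * partial_d i (partial_d j (partial_d k h)) (x + t *\<^sub>R v)\<bar>
         \<le> \<bar>u $ k\<bar> * \<bar>u $ j\<bar> * \<bar>u $ i\<bar> * \<eta>" .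
    qed
    finally show ?thesis .
  qed
  also have "\<dots> = \<eta> * (\<Sum>i\<in>UNIV. \<bar>u $ i\<bar>) ^ 3"
    by (simp add: power3_eq_cube sum_distrib_right sum_distrib_left[symmetric] ac_simps)
  finally have d3: "\<bar>d 3 t\<bar> \<le> \<eta> * (\<Sum>i\<in>UNIV. \<bar>u $ i\<bar>) ^ 3" .
  have "h (x + A *v u) - h x - log_quad (Delta A h x) (Gam A h x) u = d 3 t / 6"
    using eq by (simp add: log_quad_def d2 flip: d1) (simp add: d_def v_def)
  then show ?thesis using d3 by (simp only: abs_divide)
qed

lemma norm_matrix_le_sum:
  fixes G :: "real ^ 'n ^ 'm::finite"
  shows "norm G \<le> (\<Sum>i\<in>UNIV. \<Sum>j\<in>UNIV. \<bar>G $ i $ j\<bar>)"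
proof -
  have "norm G \<le> (\<Sum>i\<in>UNIV. norm (G $ i))"
    unfolding norm_vec_def[of G] by (rule L2_set_le_sum) simp
  also have "\<dots> \<le> (\<Sum>i\<in>UNIV. \<Sum>j\<in>UNIV. \<bar>G $ i $ j\<bar>)"
    by (intro sum_mono norm_le_l1_cart)
  finally show ?thesis .
qed

lemma l1_le_card_norm:
  fixes u :: "real ^ 'n::finite"
  shows "(\<Sum>i\<in>UNIV. \<bar>u $ i\<bar>) \<le> real CARD('n) * norm u"
  using sum_bounded_above[of UNIV "\<lambda>i. \<bar>u $ i\<bar>" "norm u"] component_le_norm_cart by auto

text \<open>Mean value theorem for each entry: two weights come from the conjugation by
  \<open>A\<close>, the third from the displacement \<open>A *v u\<close>, so
  \<open>third_order_sup\<close> applies. In the constant, two factors \<open>CARD('n)\<close> count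
  the entries and one compares the l1 norm with the Euclidean norm.\<close>

lemma Gam_variation_bound:
  fixes u :: "real ^ 'n::finite"
  assumes S: "convex S" "x \<in> S" "x + A *v u \<in> S" and h: "C_k_on 3 S h"
    and A: "A = diag_matrix c" and \<eta>: "third_order_sup S A h \<le> ereal \<eta>" and "\<eta> \<ge> 0"
  shows "norm (Gam A h (x + A *v u) - Gam A h x) \<le> real CARD('n) ^ 3 * \<eta> * norm u"
proof -
  define v where "v = A *v u"
  have v: "v $ i = c i * u $ i" for i by (simp add: v_def A)
  have inS: "x + t *\<^sub>R v \<in> S" if "0 \<le> t" "t \<le> 1" for t
    using convex_line_point[OF S(1,2) _ that] S(3) by (simp add: v_def)
  have G: "Gam A h y $ i $ j = - (c i * c j * partial_d i (partial_d j h) y)" for y i j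
  proof -
    have "(diag_matrix c ** hessian h y ** diag_matrix c) $ i $ j = c i * c j * hessian h y $ i $ j"
    proof -
      have 1: "(diag_matrix c ** X) $ i $ j = c i * X $ i $ j" for X :: "real^'n^'n" and i j
      proof -
        have "(\<Sum>k\<in>UNIV. diag_matrix c $ i $ k * X $ k $ j) = (\<Sum>k\<in>UNIV. if k = i then c i * X $ i $ j else 0)"
          by (intro sum.cong) (auto simp: diag_matrix_def)
        then show ?thesis by (simp add: matrix_matrix_mult_def)
      qed
      have 2: "(X ** diag_matrix c) $ i $ j = X $ i $ j * c j" for X :: "real^'n^'n" and i j
      proof -
        have "(\<Sum>k\<in>UNIV. X $ i $ k * diag_matrix c $ k $ j) = (\<Sum>k\<in>UNIV. if k = j then X $ i $ j * c j else 0)"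
          by (intro sum.cong) (auto simp: diag_matrix_def)
        then show ?thesis by (simp add: matrix_matrix_mult_def)
      qed
      show ?thesis by (simp add: 1 2)
    qed
    then show ?thesis by (simp add: Gam_def A hessian_def)
  qed
  have entry: "\<bar>(Gam A h (x + v) - Gam A h x) $ i $ j\<bar> \<le> \<eta> * (\<Sum>k\<in>UNIV. \<bar>u $ k\<bar>)" for i j
  proof -
    let ?f = "partial_d i (partial_d j h)"
    have "\<exists>t>0. t < 1 \<and> ?f (x + 1 *\<^sub>R v) - ?f (x + 0 *\<^sub>R v)
       = (1 - 0) * (\<Sum>k\<in>UNIV. v $ k * partial_d k ?f (x + t *\<^sub>R v))"
      by (rule MVT2) (auto intro!: has_real_derivative_along_line C_3_onD(3)[OF h] inS)
    then obtain t where t: "0 < t" "t < 1"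
      and eq: "?f (x + v) - ?f x = (\<Sum>k\<in>UNIV. v $ k * partial_d k ?f (x + t *\<^sub>R v))" by auto
    have G_eq: "(Gam A h (x + v) - Gam A h x) $ i $ j
      = - (\<Sum>k\<in>UNIV. u $ k * (A $ k $ k * A $ i $ i * A $ j $ j * partial_d k ?f (x + t *\<^sub>R v)))"
    proof -
      have "(Gam A h (x + v) - Gam A h x) $ i $ j = - (c i * c j * (?f (x + v) - ?f x))"
        by (simp add: G algebra_simps)
      then show ?thesis
        unfolding eq by (simp add: v A diag_matrix_def sum_distrib_left ac_simps)
    qed
    have "\<bar>(Gam A h (x + v) - Gam A h x) $ i $ j\<bar>
      \<le> (\<Sum>k\<in>UNIV. \<bar>u $ k * (A $ k $ k * A $ i $ i * A $ j $ j * partial_d k ?f (x + t *\<^sub>R v))\<bar>)"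
      unfolding G_eq abs_minus_cancel by (rule sum_abs)
    also have "\<dots> \<le> (\<Sum>k\<in>UNIV. \<bar>u $ k\<bar> * \<eta>)"
      unfolding abs_mult[of "u $ _"] using t
      by (intro sum_mono mult_left_mono third_order_supD[OF \<eta>] inS) auto
    finally show ?thesis by (simp add: sum_distrib_left ac_simps)
  qed
  have "norm (Gam A h (x + v) - Gam A h x) \<le> (\<Sum>i\<in>UNIV. \<Sum>j\<in>UNIV. \<bar>(Gam A h (x + v) - Gam A h x) $ i $ j\<bar>)"
    by (rule norm_matrix_le_sum)
  also have "\<dots> \<le> (\<Sum>i\<in>(UNIV::'n set). \<Sum>j\<in>(UNIV::'n set). \<eta> * (\<Sum>k\<in>UNIV. \<bar>u $ k\<bar>))"
    by (intro sum_mono entry)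
  also have "\<dots> = real CARD('n) ^ 2 * \<eta> * (\<Sum>k\<in>UNIV. \<bar>u $ k\<bar>)"
    by (simp add: power2_eq_square)
  also have "\<dots> \<le> real CARD('n) ^ 2 * \<eta> * (real CARD('n) * norm u)"
    using \<open>\<eta> \<ge> 0\<close> by (intro mult_left_mono l1_le_card_norm) auto
  finally show ?thesis by (simp add: v_def power3_eq_cube power2_eq_square ac_simps)
qed

section \<open>The Laplace approximation\<close>

text \<open>The radius has to be uniform in \<open>\<Delta>\<close> and \<open>G\<close>. Half of
  the decay \<open>\<kappa> / 2 * (norm u)\<^sup>2\<close> absorbs the linear term; the remaining
  half is split again, one part making the tail small and the other keeping it integrable.\<close>

lemma gaussian_tail_uniform:
  fixes C \<kappa> \<tau> :: real
  assumes C: "C \<ge> 0" and \<kappa>: "\<kappa> > 0" and \<tau>: "\<tau> > 0"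
  shows "\<exists>r0>0. \<forall>\<Delta> (G :: real ^ 'n ^ 'n::finite) r.
       norm \<Delta> \<le> C \<longrightarrow> (\<forall>u. \<kappa> * (norm u)\<^sup>2 \<le> u \<bullet> (G *v u)) \<longrightarrow> r0 \<le> r \<longrightarrow>
       (\<integral>\<^sup>+u\<in>{u. r \<le> norm u}. ennreal (exp (log_quad \<Delta> G u)) \<partial>lborel) \<le> ennreal \<tau>"
proof -
  \<comment> \<open>The part of the decay left for integrability is the Gaussian exponent of this
    matrix.\<close>
  define G1 :: "real ^ 'n ^ 'n" where "G1 = diag_matrix (\<lambda>_. \<kappa> / 4)"
  have G1: "u \<bullet> (G1 *v u) = \<kappa> / 4 * (norm u)\<^sup>2" for u
    by (simp add: G1_def inner_vec_def norm_vec_def L2_set_def sum_nonneg sum_distrib_left power2_eq_square ac_simps)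
  have "pos_definite G1"
    using \<kappa> by (auto simp: pos_definite_def G1) (simp add: G1_def)
  define j where "j = sqrt ((2 * pi) ^ CARD('n) / det G1)"
  have j: "j > 0" using pos_definite_det_pos[OF \<open>pos_definite G1\<close>] by (simp add: j_def)
  have J: "(\<integral>\<^sup>+u. ennreal (exp (- (\<kappa> / 8 * (norm u)\<^sup>2))) \<partial>(lborel :: (real^'n) measure)) = ennreal j"
    using nn_integral_centered_gaussian[OF \<open>pos_definite G1\<close>] by (simp add: G1 j_def)
  \<comment> \<open>The second entry makes \<open>exp (C\<^sup>2 / \<kappa> - X) * j\<close> at most
    \<open>\<tau>\<close>; the first keeps \<open>X\<close>, and with it \<open>r0\<close>,
    positive.\<close>
  define X where "X = max 1 (C\<^sup>2 / \<kappa> + ln (j / \<tau>))"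
  define r0 where "r0 = sqrt (8 / \<kappa> * X)"
  have X: "X > 0" by (simp add: X_def)
  have r0: "r0 > 0" "\<kappa> * r0\<^sup>2 / 8 = X" using X \<kappa> by (simp_all add: r0_def)
  show ?thesis
  proof (intro exI[of _ r0] conjI r0(1) allI impI)
    fix \<Delta> :: "real ^ 'n" and G :: "real ^ 'n ^ 'n" and r :: real
    assume \<Delta>: "norm \<Delta> \<le> C" and G: "\<forall>u. \<kappa> * (norm u)\<^sup>2 \<le> u \<bullet> (G *v u)" and r: "r0 \<le> r"
    have bound: "log_quad \<Delta> G u \<le> (C\<^sup>2 / \<kappa> - X) - \<kappa> / 8 * (norm u)\<^sup>2" if "r \<le> norm u" for u
    proof -
      have "\<Delta> \<bullet> u \<le> C * norm u"
        using norm_cauchy_schwarz[of \<Delta> u] mult_right_mono[OF \<Delta> norm_ge_zero[of u]] by linarith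
      moreover have "C * norm u \<le> C\<^sup>2 / \<kappa> + \<kappa> / 4 * (norm u)\<^sup>2"
      proof -
        have "0 \<le> (2 * C - \<kappa> * norm u)\<^sup>2 / (4 * \<kappa>)" using \<kappa> by simp
        also have "\<dots> = C\<^sup>2 / \<kappa> + \<kappa> / 4 * (norm u)\<^sup>2 - C * norm u"
          using \<kappa> by (simp add: field_simps power2_eq_square)
        finally show ?thesis by simp
      qed
      moreover have "X \<le> \<kappa> / 8 * (norm u)\<^sup>2"
      proof -
        have "r0\<^sup>2 \<le> (norm u)\<^sup>2" using r0(1) r that by (intro power_mono) auto
        then have "\<kappa> / 8 * r0\<^sup>2 \<le> \<kappa> / 8 * (norm u)\<^sup>2" using \<kappa> by (intro mult_left_mono) auto
        then show ?thesis using r0(2) by simp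
      qed
      ultimately show ?thesis using G[rule_format, of u] by (simp add: log_quad_def)
    qed
    have "(\<integral>\<^sup>+u\<in>{u. r \<le> norm u}. ennreal (exp (log_quad \<Delta> G u)) \<partial>lborel)
        \<le> (\<integral>\<^sup>+u. ennreal (exp (C\<^sup>2 / \<kappa> - X)) * ennreal (exp (- (\<kappa> / 8 * (norm u)\<^sup>2))) \<partial>(lborel :: (real^'n) measure))"
      using bound by (intro nn_integral_mono) (auto simp: indicator_def ennreal_mult[symmetric] simp flip: exp_add)
    also have "\<dots> = ennreal (exp (C\<^sup>2 / \<kappa> - X)) * ennreal j"
      unfolding J[symmetric] by (rule nn_integral_cmult) measurable
    also have "\<dots> = ennreal (exp (C\<^sup>2 / \<kappa> - X) * j)" using j by (simp add: ennreal_mult)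
    also have "\<dots> \<le> ennreal \<tau>"
    proof (rule ennreal_leI)
      have "exp (C\<^sup>2 / \<kappa> - X) \<le> exp (- ln (j / \<tau>))" by (simp add: X_def)
      also have "\<dots> = \<tau> / j" using j \<tau> by (simp add: exp_minus)
      finally show "exp (C\<^sup>2 / \<kappa> - X) * j \<le> \<tau>" using j by (simp add: field_simps)
    qed
    finally show "(\<integral>\<^sup>+u\<in>{u. r \<le> norm u}. ennreal (exp (log_quad \<Delta> G u)) \<partial>lborel) \<le> ennreal \<tau>" .
  qed
qed

text \<open>Inside the ball the integrands are compared pointwise, outside only masses are bounded.
  The upper bound pays \<open>B * \<tau>\<close> for the outer part of \<open>I\<close>; the lower
  bound drops that part and loses \<open>\<tau>\<close> of the Gaussian mass.\<close>

lemma laplace_sandwich: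
  fixes U :: "(real ^ 'n::finite) set"
  assumes G: "pos_definite G"
    and meas: "(\<lambda>u. ennreal (exp (l u)) * indicator U u) \<in> borel_measurable borel"
    and U: "{u. norm u < r} \<subseteq> U"
    and l: "\<And>u. norm u < r \<Longrightarrow> \<bar>l u - log_quad \<Delta> G u\<bar> \<le> s"
    and p: "\<And>u. norm u < r \<Longrightarrow> \<bar>p u - p0\<bar> \<le> s * p0" "\<And>u. u \<in> U \<Longrightarrow> 0 \<le> p u" "\<And>u. u \<in> U \<Longrightarrow> p u \<le> B"
    and tail: "(\<integral>\<^sup>+u\<in>U \<inter> {u. r \<le> norm u}. ennreal (exp (l u)) \<partial>lborel) \<le> ennreal \<tau>"
    and gtail: "(\<integral>\<^sup>+u\<in>{u. r \<le> norm u}. ennreal (exp (log_quad \<Delta> G u)) \<partial>lborel) \<le> ennreal \<tau>"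
    and s: "0 \<le> s" "s < 1" and pos: "0 < p0" "0 < B" "0 < \<tau>"
  defines "I \<equiv> (\<integral>\<^sup>+u\<in>U. ennreal (exp (l u) * p u) \<partial>lborel)"
  shows "I \<le> ennreal ((1 + s) * exp s * p0 * gauss_mass \<Delta> G + B * \<tau>)"
    and "ennreal ((1 - s) * exp (- s) * p0 * (gauss_mass \<Delta> G - \<tau>)) \<le> I"
proof -
  note [measurable] = meas
  let ?m = "gauss_mass \<Delta> G"
  let ?q = "\<lambda>u. ennreal (exp (log_quad \<Delta> G u))"
  have m: "(\<integral>\<^sup>+u. ?q u \<partial>lborel) = ennreal ?m" "?m > 0"
    using nn_integral_gaussian[OF G] ln_gauss_mass(1)[OF G] by auto
  define c1 where "c1 = (1 + s) * exp s * p0"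
  define c2 where "c2 = (1 - s) * exp (- s) * p0"
  have c: "c1 \<ge> 0" "c2 \<ge> 0" using s pos by (simp_all add: c1_def c2_def)
  \<comment> \<open>The tail integrand as a product of indicators, so that its measurability is
    inherited from \<open>meas\<close>.\<close>
  define w where "w u = ennreal (exp (l u)) * indicator U u * indicator {u. r \<le> norm u} u" for u
  have [measurable]: "w \<in> borel_measurable borel" unfolding w_def by measurable
  have "(\<integral>\<^sup>+u. w u \<partial>lborel) = (\<integral>\<^sup>+u\<in>U \<inter> {u. r \<le> norm u}. ennreal (exp (l u)) \<partial>lborel)"
    by (rule nn_integral_cong) (auto simp: w_def indicator_def)
  with tail have w: "(\<integral>\<^sup>+u. w u \<partial>lborel) \<le> ennreal \<tau>" by simp
  have "I \<le> (\<integral>\<^sup>+u. ennreal c1 * ?q u + ennreal B * w u \<partial>lborel)"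
    unfolding I_def
  proof (rule nn_integral_mono)
    fix u :: "real^'n"
    show "ennreal (exp (l u) * p u) * indicator U u
      \<le> ennreal c1 * ?q u + ennreal B * w u"
    proof (cases "norm u < r")
      case True
      have "exp (l u) \<le> exp (s + log_quad \<Delta> G u)" using l[OF True] by auto
      moreover have "p u \<le> (1 + s) * p0" using p(1)[OF True] by (auto simp: algebra_simps)
      ultimately have "exp (l u) * p u \<le> exp (s + log_quad \<Delta> G u) * ((1 + s) * p0)"
        using p(2) U True by (intro mult_mono) auto
      also have "\<dots> = c1 * exp (log_quad \<Delta> G u)" by (simp add: c1_def exp_add)
      finally have "ennreal (exp (l u) * p u) \<le> ennreal c1 * ?q u"
        using c by (simp add: ennreal_mult[symmetric])
      also have "\<dots> \<le> ennreal c1 * ?q u + ennreal B * w u" by simp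
      finally show ?thesis using U True by (auto simp: indicator_def)
    next
      case False
      have "ennreal (exp (l u) * p u) \<le> ennreal B * ennreal (exp (l u))" if "u \<in> U"
        using p(3)[OF that] pos by (subst ennreal_mult[symmetric]) (auto intro!: ennreal_leI simp: mult.commute)
      then show ?thesis using False by (auto simp: w_def indicator_def intro: add_increasing)
    qed
  qed
  also have "\<dots> = ennreal c1 * ennreal ?m
     + ennreal B * (\<integral>\<^sup>+u. w u \<partial>lborel)"
    by (subst nn_integral_add) (simp_all add: nn_integral_cmult m)
  also have "\<dots> \<le> ennreal c1 * ennreal ?m + ennreal B * ennreal \<tau>"
    using w by (intro add_left_mono mult_left_mono) auto
  also have "\<dots> = ennreal (c1 * ?m + B * \<tau>)"
    using c m pos by (simp add: ennreal_mult ennreal_plus)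
  finally show "I \<le> ennreal ((1 + s) * exp s * p0 * ?m + B * \<tau>)" by (simp add: c1_def)
  define Q where "Q = (\<integral>\<^sup>+u\<in>{u. norm u < r}. ?q u \<partial>lborel)"
  have "ennreal ?m = (\<integral>\<^sup>+u. ?q u * indicator {u. norm u < r} u + ?q u * indicator {u. r \<le> norm u} u \<partial>lborel)"
    unfolding m(1)[symmetric] by (intro nn_integral_cong) (auto simp: indicator_def)
  also have "\<dots> = Q + (\<integral>\<^sup>+u\<in>{u. r \<le> norm u}. ?q u \<partial>lborel)"
    unfolding Q_def by (rule nn_integral_add) auto
  also have "\<dots> \<le> Q + ennreal \<tau>" using gtail by (intro add_left_mono)
  \<comment> \<open>Subtraction in \<open>ennreal\<close> is truncated at 0, and so is
    \<open>ennreal\<close> of a negative real: the bound is valid, if trivial, when the Gaussian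
    mass is below \<open>\<tau>\<close>.\<close>
  finally have "ennreal ?m - ennreal \<tau> \<le> Q" by (simp add: ennreal_minus_le_iff add.commute)
  then have Q: "ennreal (?m - \<tau>) \<le> Q" using pos by (simp add: ennreal_minus)
  have "ennreal c2 * ennreal (?m - \<tau>) \<le> ennreal c2 * Q"
    using Q by (intro mult_left_mono) auto
  also have "\<dots> = (\<integral>\<^sup>+u. ennreal c2 * (?q u * indicator {u. norm u < r} u) \<partial>lborel)"
    unfolding Q_def by (rule nn_integral_cmult[symmetric]) measurable
  also have "\<dots> \<le> I"
    unfolding I_def
  proof (rule nn_integral_mono)
    fix u :: "real^'n"
    show "ennreal c2 * (?q u * indicator {u. norm u < r} u) \<le> ennreal (exp (l u) * p u) * indicator U u"
    proof (cases "norm u < r")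
      case True
      have "exp (- s + log_quad \<Delta> G u) \<le> exp (l u)" using l[OF True] by auto
      moreover have "(1 - s) * p0 \<le> p u" using p(1)[OF True] by (auto simp: algebra_simps)
      ultimately have "exp (- s + log_quad \<Delta> G u) * ((1 - s) * p0) \<le> exp (l u) * p u"
        using s pos by (intro mult_mono) auto
      also have "exp (- s + log_quad \<Delta> G u) * ((1 - s) * p0) = c2 * exp (log_quad \<Delta> G u)"
        by (simp add: c2_def exp_diff exp_minus field_simps)
      finally have "ennreal c2 * ?q u \<le> ennreal (exp (l u) * p u)"
        using c by (simp add: ennreal_mult[symmetric] ennreal_leI)
      then show ?thesis using U True by (auto simp: indicator_def)
    qed (simp add: indicator_def)
  qed
  finally show "ennreal ((1 - s) * exp (- s) * p0 * (?m - \<tau>)) \<le> I"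
    using c by (simp add: c2_def ennreal_mult')
qed

text \<open>\<open>s\<close> keeps the multiplicative errors within
  \<open>exp (\<epsilon> / 2)\<close>, and \<open>\<tau>\<close> makes the additive ones fit into
  the other half of \<open>\<epsilon>\<close>. An additive error becomes a relative one only through
  the lower bounds \<open>m0\<close> and \<open>c\<close>.\<close>

lemma laplace_constants:
  fixes \<epsilon> m0 c B :: real
  assumes pos: "\<epsilon> > 0" "m0 > 0" "c > 0" "B > 0"
  shows "\<exists>s \<tau>. 0 < s \<and> s < 1 \<and> 0 < \<tau> \<and>
    (\<forall>m p0 I. m0 \<le> m \<longrightarrow> c \<le> p0 \<longrightarrow> (1 - s) * exp (- s) * p0 * (m - \<tau>) \<le> I
       \<longrightarrow> I \<le> (1 + s) * exp s * p0 * m + B * \<tau> \<longrightarrow> 0 < I \<and> \<bar>ln I - (ln p0 + ln m)\<bar> \<le> \<epsilon>)"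
proof -
  have "((\<lambda>s::real. (1 + s) * exp s) \<longlongrightarrow> (1 + 0) * exp 0) (at_right 0)"
    by (intro tendsto_intros)
  then have e1: "\<forall>\<^sub>F s in at_right 0. (1 + s) * exp s < exp (\<epsilon> / 2)"
    using pos by (intro order_tendstoD(2)) auto
  have "((\<lambda>s::real. (1 - s) * exp (- s)) \<longlongrightarrow> (1 - 0) * exp (- 0)) (at_right 0)"
    by (intro tendsto_intros)
  then have e2: "\<forall>\<^sub>F s in at_right 0. exp (- \<epsilon> / 2) < (1 - s) * exp (- s)"
    using pos by (intro order_tendstoD(1)) auto
  have "\<forall>\<^sub>F s in at_right (0::real). 0 < s \<and> s < 1"
    using eventually_at_right_less[of "0::real"] eventually_at_right_real[of "0::real" 1]
    by (auto elim: eventually_elim2)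
  from eventually_happens'[OF _ eventually_conj[OF this eventually_conj[OF e1 e2]]]
  obtain s where s: "0 < s" "s < 1" and s1: "(1 + s) * exp s < exp (\<epsilon> / 2)"
    and s2: "exp (- \<epsilon> / 2) < (1 - s) * exp (- s)"
    by (auto simp: trivial_limit_at_right_real)
  \<comment> \<open>The first entry is dictated by the upper bound, where \<open>B * \<tau>\<close>
    is compared with \<open>p0 * m\<close>; the second by the lower bound, where
    \<open>m - \<tau>\<close> is compared with \<open>m\<close>.\<close>
  define \<tau> where "\<tau> = min ((exp \<epsilon> - exp (\<epsilon> / 2)) * (c * m0) / B) (m0 * (1 - exp (- \<epsilon> / 2)))"
  have \<tau>: "\<tau> > 0" using pos by (simp add: \<tau>_def)
  show ?thesis
  proof (rule exI[of _ s], rule exI[of _ \<tau>], intro conjI s \<tau> allI impI)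
    fix m p0 I :: real
    assume m: "m0 \<le> m" and p0: "c \<le> p0" and lo: "(1 - s) * exp (- s) * p0 * (m - \<tau>) \<le> I"
      and up: "I \<le> (1 + s) * exp s * p0 * m + B * \<tau>"
    have pm: "p0 * m > 0" "m > 0" "p0 > 0" using m p0 pos by auto
    have "B * \<tau> \<le> (exp \<epsilon> - exp (\<epsilon> / 2)) * (c * m0)"
      using pos by (simp add: \<tau>_def min_def field_simps)
    also have "\<dots> \<le> (exp \<epsilon> - exp (\<epsilon> / 2)) * (p0 * m)"
      using pos m p0 by (intro mult_left_mono mult_mono) auto
    finally have "I \<le> exp (\<epsilon> / 2) * (p0 * m) + (exp \<epsilon> - exp (\<epsilon> / 2)) * (p0 * m)"
      using up mult_right_mono[OF less_imp_le[OF s1] less_imp_le[OF pm(1)]] by (simp add: mult.assoc)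
    then have up': "I \<le> exp \<epsilon> * (p0 * m)" by (simp add: algebra_simps)
    have "\<tau> \<le> m * (1 - exp (- \<epsilon> / 2))"
    proof -
      have "\<tau> \<le> m0 * (1 - exp (- \<epsilon> / 2))" by (simp add: \<tau>_def)
      also have "\<dots> \<le> m * (1 - exp (- \<epsilon> / 2))" using m pos by (intro mult_right_mono) auto
      finally show ?thesis .
    qed
    then have mt: "m * exp (- \<epsilon> / 2) \<le> m - \<tau>" by (simp add: algebra_simps)
    have "exp (- \<epsilon>) * (p0 * m) = exp (- \<epsilon> / 2) * p0 * (m * exp (- \<epsilon> / 2))"
      by (simp add: mult_exp_exp algebra_simps flip: exp_add)
    also have "\<dots> \<le> (1 - s) * exp (- s) * p0 * (m - \<tau>)"
      using s2 pm mt s by (intro mult_mono) auto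
    also note lo
    finally have lo': "exp (- \<epsilon>) * (p0 * m) \<le> I" .
    then have I: "I > 0" using pm by (smt (verit) exp_gt_zero mult_pos_pos)
    have "ln I \<le> ln (exp \<epsilon> * (p0 * m))" using up' I by simp
    moreover have "ln (exp (- \<epsilon>) * (p0 * m)) \<le> ln I" using lo' I pm by (subst ln_le_cancel_iff) auto
    ultimately show "\<bar>ln I - (ln p0 + ln m)\<bar> \<le> \<epsilon>"
      using pm I by (simp add: ln_mult abs_le_iff)
    show "0 < I" by fact
  qed
qed

section \<open>Change of variables in the marginal likelihood\<close>

lemma nn_integral_lborel_diag_affine:
  fixes F :: "real ^ 'n::finite \<Rightarrow> ennreal"
  assumes F [measurable]: "F \<in> borel_measurable borel" and c: "\<And>i. c i > 0"
  shows "(\<integral>\<^sup>+y. F y \<partial>lborel) = ennreal (\<Prod>i\<in>UNIV. c i) * (\<integral>\<^sup>+u. F (x + diag_matrix c *v u) \<partial>lborel)"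
proof -
  define C where "C b = c (THE i. b = axis i (1::real))" for b :: "real^'n"
  have C: "C (axis i 1) = c i" for i
    by (simp add: C_def axis_eq_axis)
  have B: "(Basis :: (real^'n) set) = (\<lambda>i. axis i 1) ` UNIV" by (auto simp: Basis_vec_def)
  have inj: "inj (\<lambda>i. axis i (1::real) :: real^'n)" by (auto simp: inj_def axis_eq_axis)
  have prod: "(\<Prod>b\<in>Basis. \<bar>C b\<bar>) = (\<Prod>i\<in>UNIV. c i)"
    unfolding B by (subst prod.reindex[OF inj]) (simp add: C c less_imp_le)
  have T: "x + (\<Sum>b\<in>Basis. (C b * (u \<bullet> b)) *\<^sub>R b) = x + diag_matrix c *v u" for u
  proof -
    have "(\<Sum>i\<in>UNIV. (c i * u $ i) *\<^sub>R axis i (1::real)) $ k = c k * u $ k" for k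
    proof -
      have "(\<Sum>i\<in>UNIV. (c i * u $ i) *\<^sub>R axis i (1::real)) $ k = (\<Sum>i\<in>UNIV. if i = k then c k * u $ k else 0)"
        unfolding sum_component by (intro sum.cong) (auto simp: axis_def)
      then show ?thesis by simp
    qed
    then show ?thesis
      unfolding B by (subst sum.reindex[OF inj]) (simp add: C inner_axis vec_eq_iff)
  qed
  have c0: "C b \<noteq> 0" if "b \<in> Basis" for b
  proof -
    from that obtain i where "b = axis i 1" by (auto simp: B)
    then show ?thesis using c[of i] by (simp add: C)
  qed
  have [measurable]: "(\<lambda>u. x + diag_matrix c *v u) \<in> borel_measurable borel"
    by (intro borel_measurable_continuous_onI continuous_intros)
  have "(\<integral>\<^sup>+y. F y \<partial>lborel)
     = (\<integral>\<^sup>+y. F y \<partial>density (distr lborel borel (\<lambda>u. x + diag_matrix c *v u)) (\<lambda>_. ennreal (\<Prod>i\<in>UNIV. c i)))"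
    using lborel_affine_euclidean[of C x] c0 by (simp add: T prod)
  also have "\<dots> = ennreal (\<Prod>i\<in>UNIV. c i) * (\<integral>\<^sup>+y. F y \<partial>(distr lborel borel (\<lambda>u. x + diag_matrix c *v u)))"
    by (subst nn_integral_density) (auto simp: nn_integral_cmult)
  also have "(\<integral>\<^sup>+y. F y \<partial>(distr lborel borel (\<lambda>u. x + diag_matrix c *v u))) = (\<integral>\<^sup>+u. F (x + diag_matrix c *v u) \<partial>lborel)"
    by (rule nn_integral_distr) auto
  finally show ?thesis .
qed

text \<open>Both sides are 0 by convention when the mass is infinite, so the identity is available
  before finiteness is established in \<open>laplace_expansion\<close>.\<close>

lemma marginal_likelihood_rescale:
  fixes S :: "(real ^ 'n::finite) set"
  assumes S: "open S" and h: "continuous_on S h" and p: "set_borel_measurable lborel S p"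
    and p0: "\<And>x. x \<in> S \<Longrightarrow> 0 \<le> p x" and A: "A = diag_matrix c" and c: "\<And>i. c i > 0"
  shows "marginal_likelihood S h p = (\<Prod>i\<in>UNIV. c i) * exp (h x) *
    enn2real (\<integral>\<^sup>+u\<in>local_set S A x. ennreal (exp (h (x + A *v u) - h x) * p (x + A *v u)) \<partial>lborel)"
proof -
  have [measurable]: "S \<in> sets borel" using S by simp
  have mh: "(\<lambda>y. indicator S y *\<^sub>R exp (h y)) \<in> borel_measurable borel"
    using h by (intro borel_measurable_continuous_on_indicator continuous_intros) auto
  have mp: "(\<lambda>y. indicator S y *\<^sub>R p y) \<in> borel_measurable borel"
    using p by (simp add: set_borel_measurable_def)
  have "(\<lambda>y. (indicator S y *\<^sub>R exp (h y)) * (indicator S y *\<^sub>R p y)) \<in> borel_measurable borel"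
    using mh mp by (rule borel_measurable_times)
  moreover have "(\<lambda>y. (indicator S y *\<^sub>R exp (h y)) * (indicator S y *\<^sub>R p y)) = (\<lambda>y. indicator S y *\<^sub>R (exp (h y) * p y))"
    by (auto simp: indicator_def)
  ultimately have m: "(\<lambda>y. indicator S y *\<^sub>R (exp (h y) * p y)) \<in> borel_measurable borel" by simp
  let ?F = "\<lambda>y. ennreal (indicator S y *\<^sub>R (exp (h y) * p y))"
  let ?I = "\<integral>\<^sup>+u\<in>local_set S A x. ennreal (exp (h (x + A *v u) - h x) * p (x + A *v u)) \<partial>lborel"
  let ?f = "\<lambda>u. ennreal (exp (h (x + A *v u) - h x) * p (x + A *v u)) * indicator (local_set S A x) u"
  have [measurable]: "(\<lambda>u. x + A *v u) \<in> borel_measurable borel"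
    by (intro borel_measurable_continuous_onI continuous_intros)
  have Ff: "?F (x + A *v u) = ennreal (exp (h x)) * ?f u" for u
    by (auto simp: indicator_def local_set_def exp_diff p0 simp flip: ennreal_mult)
  then have "?f = (\<lambda>u. ennreal (exp (- h x)) * ?F (x + A *v u))"
    by (simp add: mult.assoc[symmetric] ennreal_mult[symmetric] flip: exp_add)
  moreover have "(\<lambda>u. ?F (x + A *v u)) \<in> borel_measurable borel"
    using m by measurable
  ultimately have mf: "?f \<in> borel_measurable borel" by simp
  have "marginal_likelihood S h p = enn2real (\<integral>\<^sup>+y. ?F y \<partial>lborel)"
    unfolding marginal_likelihood_def set_lebesgue_integral_def
    using m p0 by (intro integral_eq_nn_integral) (auto simp: indicator_def)
  also have "(\<integral>\<^sup>+y. ?F y \<partial>lborel) = ennreal (\<Prod>i\<in>UNIV. c i) * (\<integral>\<^sup>+u. ?F (x + A *v u) \<partial>lborel)"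
    unfolding A using m c by (intro nn_integral_lborel_diag_affine) auto
  also have "(\<integral>\<^sup>+u. ?F (x + A *v u) \<partial>lborel) = ennreal (exp (h x)) * ?I"
    unfolding Ff using mf by (intro nn_integral_cmult) simp
  finally show ?thesis
    using c by (simp add: enn2real_mult prod_nonneg less_imp_le mult.assoc)
qed

text \<open>One level \<open>m\<close> gathers the bounds over which constants are uniform: the norm
  and the lower determinant bound for \<open>ln (det G)\<close>, the upper determinant bound for a
  lower bound on the Gaussian mass, coercivity for its tails. The conditions are closed, hence
  measurable; symmetry is carried by \<open>pos_definite\<close> in
  \<open>regular_path\<close>.\<close>

definition pd_compact :: "real \<Rightarrow> (real ^ 'n ^ 'n::finite) set" where
  "pd_compact m = {G. norm G \<le> m \<and> 1 / m \<le> det G \<and> det G \<le> m \<and> (\<forall>u. (norm u)\<^sup>2 / m \<le> u \<bullet> (G *v u))}"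

lemma continuous_on_det_matrix:
  fixes f :: "'a::topological_space \<Rightarrow> real ^ 'n ^ 'n::finite"
  assumes "continuous_on S f"
  shows "continuous_on S (\<lambda>x. det (f x))"
  unfolding det_def using assms by (intro continuous_intros)

lemma closed_pd_compact: "closed (pd_compact m :: (real ^ 'n ^ 'n::finite) set)"
proof -
  have "closed {G :: real ^ 'n ^ 'n. (norm u)\<^sup>2 / m \<le> u \<bullet> (G *v u)}" for u
    unfolding matrix_vector_mult_def inner_vec_def
    by (intro closed_Collect_le continuous_intros)
  then have "closed {G :: real ^ 'n ^ 'n. \<forall>u. (norm u)\<^sup>2 / m \<le> u \<bullet> (G *v u)}"
    by (intro closed_Collect_all)
  then show ?thesis unfolding pd_compact_def
    by (intro closed_Collect_conj closed_Collect_le continuous_intros continuous_on_det_matrix)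
qed

lemma pd_compact_mono:
  assumes "0 < m" "m \<le> m'"
  shows "pd_compact m \<subseteq> pd_compact m'"
proof
  fix G :: "real ^ 'n ^ 'n" assume G: "G \<in> pd_compact m"
  have "1 / m' \<le> 1 / m" using assms by (intro divide_left_mono) auto
  moreover have "(norm u)\<^sup>2 / m' \<le> (norm u)\<^sup>2 / m" for u :: "real^'n"
    using assms by (intro divide_left_mono) auto
  ultimately show "G \<in> pd_compact m'"
    using G assms unfolding pd_compact_def by (auto intro: order_trans)
qed

lemma pos_definite_in_pd_compact:
  fixes G :: "real ^ 'n ^ 'n::finite"
  assumes "pos_definite G"
  shows "\<exists>n. G \<in> pd_compact (real (Suc n))"
proof -
  obtain \<kappa> where \<kappa>: "\<kappa> > 0" "\<And>u. \<kappa> * (norm u)\<^sup>2 \<le> u \<bullet> (G *v u)"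
    by (rule pos_definite_lower_bound[OF assms]) blast
  have d: "det G > 0" by (rule pos_definite_det_pos[OF assms])
  obtain n where n: "max (max (norm G) (det G)) (max (1 / det G) (1 / \<kappa>)) \<le> real n"
    using real_arch_simple by blast
  have inv: "1 / real (Suc n) \<le> y" if "y > 0" "1 / y \<le> real n" for y
    using that by (simp add: field_simps)
  have "(norm u)\<^sup>2 / real (Suc n) \<le> u \<bullet> (G *v u)" for u
  proof -
    have "1 / real (Suc n) * (norm u)\<^sup>2 \<le> \<kappa> * (norm u)\<^sup>2"
      using n \<kappa> by (intro mult_right_mono inv) auto
    then show ?thesis using \<kappa>(2)[of u] by simp
  qed
  moreover have "1 / real (Suc n) \<le> det G" using n d by (intro inv) auto
  ultimately show ?thesis using n by (intro exI[of _ n]) (auto simp: pd_compact_def)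
qed

text \<open>Uniform continuity controls the difference of determinants; since \<open>det G\<close>
  is at least \<open>1 / m\<close>, this controls their ratio, and \<open>ln\<close> is continuous
  at 1.\<close>

lemma ln_det_uniform_on_pd_compact:
  assumes "m > 0" "\<epsilon> > 0"
  obtains \<eta> where "\<eta> > 0" "\<And>G G' :: real ^ 'n ^ 'n::finite. G \<in> pd_compact m \<Longrightarrow> norm (G' - G) \<le> \<eta> \<Longrightarrow>
     0 < det G' \<and> \<bar>ln (det G') - ln (det G)\<bar> \<le> \<epsilon>"
proof -
  have "isCont ln (1::real)" by (rule isCont_ln) simp
  then obtain \<rho> where \<rho>: "\<rho> > 0" "\<And>z. \<bar>z - 1\<bar> < \<rho> \<Longrightarrow> \<bar>ln z\<bar> < \<epsilon>"
    using assms(2) unfolding continuous_at_eps_delta by (auto simp: dist_real_def)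
  \<comment> \<open>The margin 1 makes room for the perturbed matrix \<open>G'\<close>.\<close>
  have "continuous_on (cball 0 (m + 1)) (det :: real^'n^'n \<Rightarrow> real)"
    by (intro continuous_on_det_matrix continuous_on_id)
  then have "uniformly_continuous_on (cball 0 (m + 1)) (det :: real^'n^'n \<Rightarrow> real)"
    by (rule compact_uniformly_continuous) simp
  \<comment> \<open>The cap at 1 keeps the ratio of determinants positive, so that positivity of
    \<open>det G'\<close> comes out as well.\<close>
  moreover have "min \<rho> 1 / m > 0" using \<rho> assms by simp
  ultimately obtain d where d: "d > 0"
    "\<And>G G' :: real^'n^'n. G \<in> cball 0 (m + 1) \<Longrightarrow> G' \<in> cball 0 (m + 1) \<Longrightarrow> dist G' G < d \<Longrightarrow> dist (det G') (det G) < min \<rho> 1 / m"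
    unfolding uniformly_continuous_on_def by metis
  show thesis
  proof (rule that[of "min 1 (d / 2)"])
    fix G G' :: "real^'n^'n"
    assume G: "G \<in> pd_compact m" and G': "norm (G' - G) \<le> min 1 (d / 2)"
    have det: "1 / m \<le> det G" and nG: "norm G \<le> m" using G by (auto simp: pd_compact_def)
    have pos: "det G > 0" using det assms(1) by (smt (verit) zero_less_divide_1_iff)
    have "norm G' \<le> m + 1" using norm_triangle_sub[of G' G] nG G' by simp
    then have "dist (det G') (det G) < min \<rho> 1 / m"
      using nG G' d(1) by (intro d(2)) (auto simp: dist_norm)
    also have "\<dots> = min \<rho> 1 * (1 / m)" by simp
    also have "\<dots> \<le> min \<rho> 1 * det G" using det \<rho> by (intro mult_left_mono) auto
    finally have lt: "\<bar>det G' - det G\<bar> < min \<rho> 1 * det G" by (simp add: dist_real_def)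
    have "det G' / det G - 1 = (det G' - det G) / det G"
      using pos by (simp add: diff_divide_distrib)
    then have "\<bar>det G' / det G - 1\<bar> = \<bar>det G' - det G\<bar> / det G"
      using pos by (simp only: abs_divide abs_of_pos)
    also have "\<dots> < min \<rho> 1" using lt pos by (simp only: pos_divide_less_eq)
    finally have z: "\<bar>det G' / det G - 1\<bar> < min \<rho> 1" .
    then have "det G' / det G > 0" by auto
    then have "det G' > 0" using pos by (simp add: zero_less_divide_iff)
    moreover have "\<bar>ln (det G' / det G)\<bar> < \<epsilon>" using z by (intro \<rho>) auto
    ultimately show "0 < det G' \<and> \<bar>ln (det G') - ln (det G)\<bar> \<le> \<epsilon>"
      using pos by (simp add: ln_div)
  qed (use d in auto)
qed

lemma norm_matrix_vector_le:
  fixes G :: "real ^ 'n ^ 'm::finite"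
  shows "norm (G *v u) \<le> real CARD('m) * norm G * norm u"
proof -
  have "norm (G *v u) \<le> (\<Sum>i\<in>UNIV. \<bar>(G *v u) $ i\<bar>)" by (rule norm_le_l1_cart)
  also have "\<dots> \<le> (\<Sum>i\<in>(UNIV :: 'm set). norm G * norm u)"
  proof (rule sum_mono)
    fix i
    have "\<bar>(G *v u) $ i\<bar> = \<bar>G $ i \<bullet> u\<bar>" by (simp add: matrix_vector_mult_def inner_vec_def)
    also have "\<dots> \<le> norm (G $ i) * norm u" by (rule Cauchy_Schwarz_ineq2)
    also have "\<dots> \<le> norm G * norm u" by (intro mult_right_mono Finite_Cartesian_Product.norm_nth_le) auto
    finally show "\<bar>(G *v u) $ i\<bar> \<le> norm G * norm u" .
  qed
  finally show ?thesis by (simp add: mult.assoc)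
qed

text \<open>The good event at a single \<open>n\<close> and outcome, stated deterministically. The
  bounds \<open>m\<close> and \<open>C\<close> are fixed in advance, whereas \<open>\<eta>\<close>
  may be made as small as later estimates demand.\<close>

definition regular_path ::
  "(real ^ 'n) set \<Rightarrow> real ^ 'n ^ 'n::finite \<Rightarrow> real ^ 'n \<Rightarrow> real \<Rightarrow> real \<Rightarrow> real \<Rightarrow> (real ^ 'n \<Rightarrow> real) \<Rightarrow> real ^ 'n ^ 'n \<Rightarrow> bool" where
  "regular_path S A x m C \<eta> h G \<longleftrightarrow> C_k_on 3 S h \<and> pos_definite G \<and> G \<in> pd_compact m \<and>
     norm (Delta A h x) \<le> C \<and> norm (Gam A h x - G) \<le> \<eta> \<and> third_order_sup S A h \<le> ereal \<eta>"

text \<open>The cubic term is the Taylor remainder, with its factor 1/6 dropped; the quadratic one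
  is the cost of replacing \<open>Gam A h x\<close> by \<open>G\<close>.\<close>

lemma regular_path_quad_approx:
  fixes u :: "real ^ 'n::finite"
  assumes R: "regular_path S A x m C \<eta> h G" and S: "convex S" "x \<in> S" "x + A *v u \<in> S"
    and A: "A = diag_matrix c" and "\<eta> \<ge> 0" and u: "norm u \<le> r"
  shows "\<bar>h (x + A *v u) - h x - log_quad (Delta A h x) G u\<bar>
    \<le> \<eta> * ((real CARD('n) * r) ^ 3 + real CARD('n) * r\<^sup>2)"
proof -
  let ?N = "real CARD('n)"
  have r: "r \<ge> 0" using norm_ge_zero[of u] u by linarith
  have "\<bar>h (x + A *v u) - h x - log_quad (Delta A h x) (Gam A h x) u\<bar> \<le> \<eta> * (\<Sum>i\<in>UNIV. \<bar>u $ i\<bar>) ^ 3 / 6"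
    using R S A by (intro local_taylor_bound) (auto simp: regular_path_def)
  also have "\<dots> \<le> \<eta> * (\<Sum>i\<in>UNIV. \<bar>u $ i\<bar>) ^ 3" using \<open>\<eta> \<ge> 0\<close> by (simp add: sum_nonneg)
  also have "\<dots> \<le> \<eta> * (?N * r) ^ 3"
  proof (intro mult_left_mono power_mono)
    have "(\<Sum>i\<in>UNIV. \<bar>u $ i\<bar>) \<le> ?N * norm u" by (rule l1_le_card_norm)
    also have "\<dots> \<le> ?N * r" using u by (intro mult_left_mono) auto
    finally show "(\<Sum>i\<in>UNIV. \<bar>u $ i\<bar>) \<le> ?N * r" .
  qed (use \<open>\<eta> \<ge> 0\<close> in \<open>auto simp: sum_nonneg\<close>)
  finally have 1: "\<bar>h (x + A *v u) - h x - log_quad (Delta A h x) (Gam A h x) u\<bar> \<le> \<eta> * (?N * r) ^ 3" .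
  have "log_quad (Delta A h x) (Gam A h x) u - log_quad (Delta A h x) G u = - (u \<bullet> ((Gam A h x - G) *v u)) / 2"
    by (simp add: log_quad_def matrix_vector_mult_diff_rdistrib inner_diff_right field_simps)
  also have "\<bar>\<dots>\<bar> \<le> \<bar>u \<bullet> ((Gam A h x - G) *v u)\<bar>" by simp
  also have "\<dots> \<le> norm u * norm ((Gam A h x - G) *v u)" by (rule Cauchy_Schwarz_ineq2)
  also have "\<dots> \<le> norm u * (?N * norm (Gam A h x - G) * norm u)"
    by (intro mult_left_mono norm_matrix_vector_le) auto
  also have "\<dots> \<le> r * (?N * \<eta> * r)"
    using R u r \<open>\<eta> \<ge> 0\<close> by (intro mult_mono) (auto simp: regular_path_def)
  finally have 2: "\<bar>log_quad (Delta A h x) (Gam A h x) u - log_quad (Delta A h x) G u\<bar> \<le> \<eta> * (?N * r\<^sup>2)"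
    by (simp add: power2_eq_square ac_simps)
  show ?thesis using 1 2 by (simp add: distrib_left)
qed

text \<open>The quantifier order carries the uniformity: \<open>r0\<close> and \<open>\<tau>\<close>
  are fixed first, \<open>\<eta>\<close> may depend on \<open>r\<close>, and the path, matrices and
  prior come last, so one choice serves all \<open>n\<close> and all good outcomes. The radius is
  left free above \<open>r0\<close> because (A3) imposes its own radius once \<open>\<tau>\<close>
  is known.\<close>

lemma laplace_expansion:
  fixes m C c0 B \<epsilon> :: real and S :: "(real ^ 'n::finite) set"
  assumes S: "open S" "convex S" "x \<in> S" and pos: "m > 0" "C > 0" "c0 > 0" "B > 0" "\<epsilon> > 0"
  shows "\<exists>r0 \<tau>. r0 > 0 \<and> \<tau> > 0 \<and>
    (\<forall>r\<ge>r0. \<exists>\<eta>>0. \<forall>A c h G p.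
       regular_path S A x m C \<eta> h G \<longrightarrow> A = diag_matrix c \<longrightarrow> (\<forall>i. c i > 0) \<longrightarrow>
       set_borel_measurable lborel S p \<longrightarrow> (\<forall>y\<in>S. 0 < p y \<and> p y \<le> B) \<longrightarrow> c0 \<le> p x \<longrightarrow>
       {u. norm u < r} \<subseteq> local_set S A x \<longrightarrow> (\<forall>u. norm u < r \<longrightarrow> \<bar>p (x + A *v u) - p x\<bar> \<le> \<eta>) \<longrightarrow>
       (\<integral>\<^sup>+u\<in>local_set S A x \<inter> {u. r \<le> norm u}. ennreal (local_field A h x u) \<partial>lborel) \<le> ennreal \<tau> \<longrightarrow>
       \<bar>ln (marginal_likelihood S h p) - (h x + (\<Sum>i\<in>UNIV. ln (c i)) + ln (gauss_mass (Delta A h x) G) + ln (p x))\<bar> \<le> \<epsilon>)"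
proof -
  let ?N = "real CARD('n)"
  \<comment> \<open>A lower bound for the Gaussian mass over \<open>pd_compact m\<close>: the
    determinant is at most \<open>m\<close> and the exponential factor is at least 1.\<close>
  define m0 where "m0 = sqrt ((2 * pi) ^ CARD('n) / m)"
  have m0: "m0 > 0" using pos by (simp add: m0_def)
  obtain s \<tau> where s: "0 < s" "s < 1" "0 < \<tau>"
    and fin: "\<And>M p0 I. m0 \<le> M \<Longrightarrow> c0 \<le> p0 \<Longrightarrow> (1 - s) * exp (- s) * p0 * (M - \<tau>) \<le> I
       \<Longrightarrow> I \<le> (1 + s) * exp s * p0 * M + B * \<tau> \<Longrightarrow> 0 < I \<and> \<bar>ln I - (ln p0 + ln M)\<bar> \<le> \<epsilon>"
    using laplace_constants[OF pos(5) m0 pos(3,4)] by blast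
  obtain r0 where r0: "r0 > 0"
    and gt: "\<And>\<Delta> (G :: real ^ 'n ^ 'n) r. norm \<Delta> \<le> C \<Longrightarrow> \<forall>u. 1 / m * (norm u)\<^sup>2 \<le> u \<bullet> (G *v u) \<Longrightarrow> r0 \<le> r \<Longrightarrow>
       (\<integral>\<^sup>+u\<in>{u. r \<le> norm u}. ennreal (exp (log_quad \<Delta> G u)) \<partial>lborel) \<le> ennreal \<tau>"
    using gaussian_tail_uniform[of C "1 / m" \<tau>, where ?'n = 'n] pos s by auto
  show ?thesis
  proof (rule exI[of _ r0], rule exI[of _ \<tau>], intro conjI r0 s(3) allI impI)
    fix r assume r: "r0 \<le> r"
    define q where "q = (?N * r) ^ 3 + ?N * r\<^sup>2"
    have q: "q > 0" using r r0 by (simp add: q_def add_pos_pos)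
    \<comment> \<open>The first entry brings the quadratic approximation within \<open>s\<close> on
      the ball; the second makes the prior oscillation at most \<open>s * p x\<close>.\<close>
    define \<eta> where "\<eta> = min (s / q) (s * c0)"
    have \<eta>: "\<eta> > 0" using s q pos by (simp add: \<eta>_def)
    have \<eta>q: "\<eta> * q \<le> s" using q by (simp add: \<eta>_def min_def field_simps)
    have \<eta>c: "\<eta> \<le> s * c0" by (simp add: \<eta>_def)
    show "\<exists>\<eta>>0. \<forall>A c h G p.
       regular_path S A x m C \<eta> h G \<longrightarrow> A = diag_matrix c \<longrightarrow> (\<forall>i. c i > 0) \<longrightarrow>
       set_borel_measurable lborel S p \<longrightarrow> (\<forall>y\<in>S. 0 < p y \<and> p y \<le> B) \<longrightarrow> c0 \<le> p x \<longrightarrow>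
       {u. norm u < r} \<subseteq> local_set S A x \<longrightarrow> (\<forall>u. norm u < r \<longrightarrow> \<bar>p (x + A *v u) - p x\<bar> \<le> \<eta>) \<longrightarrow>
       (\<integral>\<^sup>+u\<in>local_set S A x \<inter> {u. r \<le> norm u}. ennreal (local_field A h x u) \<partial>lborel) \<le> ennreal \<tau> \<longrightarrow>
       \<bar>ln (marginal_likelihood S h p) - (h x + (\<Sum>i\<in>UNIV. ln (c i)) + ln (gauss_mass (Delta A h x) G) + ln (p x))\<bar> \<le> \<epsilon>"
    proof (intro exI[of _ \<eta>] conjI \<eta> allI impI)
      fix A c h G p
      assume R: "regular_path S A x m C \<eta> h G" and A: "A = diag_matrix c" and c: "\<forall>i. c i > 0" and pm: "set_borel_measurable lborel S p"
        and p: "\<forall>y\<in>S. 0 < p y \<and> p y \<le> B" and c0: "c0 \<le> p x"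
        and U: "{u. norm u < r} \<subseteq> local_set S A x"
        and p\<eta>: "\<forall>u. norm u < r \<longrightarrow> \<bar>p (x + A *v u) - p x\<bar> \<le> \<eta>"
        and tail: "(\<integral>\<^sup>+u\<in>local_set S A x \<inter> {u. r \<le> norm u}. ennreal (local_field A h x u) \<partial>lborel) \<le> ennreal \<tau>"
      define l where "l u = h (x + A *v u) - h x" for u
      have G: "pos_definite G" and GK: "G \<in> pd_compact m" and D: "norm (Delta A h x) \<le> C"
        using R by (auto simp: regular_path_def)
      have hd: "continuous_on S h"
        using R C_3_onD(1)[of S h] unfolding regular_path_def
        by (meson continuous_at_imp_continuous_on differentiable_imp_continuous_within)
      have cA: "continuous_on T (\<lambda>u. x + A *v u)" for T by (intro continuous_intros)
      have oU: "open (local_set S A x)"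
        unfolding local_set_def using open_vimage[OF S(1) cA] by (simp add: vimage_def)
      have cl: "continuous_on (local_set S A x) (\<lambda>u. exp (l u))"
        unfolding l_def
        by (intro continuous_intros continuous_on_compose2[OF hd cA]) (auto simp: local_set_def)
      have "(\<lambda>u. ennreal (indicator (local_set S A x) u *\<^sub>R exp (l u))) \<in> borel_measurable borel"
        by (intro measurable_compose[OF borel_measurable_continuous_on_indicator measurable_ennreal] cl) (simp add: oU)
      also have "(\<lambda>u. ennreal (indicator (local_set S A x) u *\<^sub>R exp (l u)))
        = (\<lambda>u. ennreal (exp (l u)) * indicator (local_set S A x) u)"
        by (auto simp: indicator_def)
      finally have meas: "(\<lambda>u. ennreal (exp (l u)) * indicator (local_set S A x) u) \<in> borel_measurable borel" .
      let ?M = "gauss_mass (Delta A h x) G"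
      let ?I = "\<integral>\<^sup>+u\<in>local_set S A x. ennreal (exp (l u) * p (x + A *v u)) \<partial>lborel"
      have L: "\<bar>l u - log_quad (Delta A h x) G u\<bar> \<le> s" if "norm u < r" for u
      proof -
        have "\<bar>h (x + A *v u) - h x - log_quad (Delta A h x) G u\<bar> \<le> \<eta> * q"
          unfolding q_def using that U \<eta> S A
          by (intro regular_path_quad_approx[OF R]) (auto simp: local_set_def)
        with \<eta>q show ?thesis by (simp add: l_def)
      qed
      have px: "0 < p x" using p S by blast
      have "\<eta> \<le> s * p x" using \<eta>c c0 s by (meson mult_left_mono less_imp_le order_trans)
      then have P: "\<bar>p (x + A *v u) - p x\<bar> \<le> s * p x" if "norm u < r" for u
        using p\<eta> that by fastforce
      have gt': "(\<integral>\<^sup>+u\<in>{u. r \<le> norm u}. ennreal (exp (log_quad (Delta A h x) G u)) \<partial>lborel) \<le> ennreal \<tau>"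
        using GK by (intro gt D r) (simp add: pd_compact_def)
      have tail': "(\<integral>\<^sup>+u\<in>local_set S A x \<inter> {u. r \<le> norm u}. ennreal (exp (l u)) \<partial>lborel) \<le> ennreal \<tau>"
        using tail by (simp add: local_field_def l_def)
      have pU: "0 \<le> p (x + A *v u)" "p (x + A *v u) \<le> B" if "u \<in> local_set S A x" for u
        using p that by (auto simp: local_set_def intro: less_imp_le)
      note sw = laplace_sandwich[OF G meas U L P pU tail' gt' less_imp_le[OF s(1)] s(2) px pos(4) s(3)]
      have Mm: "m0 \<le> ?M"
      proof -
        have dG: "0 < det G" "det G \<le> m" using pos_definite_det_pos[OF G] GK by (auto simp: pd_compact_def)
        have "m0 \<le> sqrt ((2 * pi) ^ CARD('n) / det G)"
          unfolding m0_def using dG by (intro real_sqrt_le_mono divide_left_mono) auto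
        also have "\<dots> \<le> ?M"
          using dG mult_left_mono[of 1 "exp ((norm (inv_sqrt_matrix G *v Delta A h x))\<^sup>2 / 2)"
              "sqrt ((2 * pi) ^ CARD('n) / det G)"]
          by (simp add: gauss_mass_def)
        finally show ?thesis .
      qed
      have upI: "?I \<le> ennreal ((1 + s) * exp s * p x * ?M + B * \<tau>)" by (rule sw(1))
      have loI: "ennreal ((1 - s) * exp (- s) * p x * (?M - \<tau>)) \<le> ?I" by (rule sw(2))
      \<comment> \<open>Finiteness of the rescaled mass is read off from the upper bound, positivity
        later from \<open>fin\<close>; both are needed before taking logarithms.\<close>
      have "?I < \<top>" using upI ennreal_less_top by (rule order_le_less_trans)
      then obtain J where J: "?I = ennreal J" "J \<ge> 0" by (cases ?I) auto
      have M: "?M > 0" using Mm m0 by linarith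
      have up: "J \<le> (1 + s) * exp s * p x * ?M + B * \<tau>"
        using upI M s pos px unfolding J(1) by (subst (asm) ennreal_le_iff) auto
      have lo: "(1 - s) * exp (- s) * p x * (?M - \<tau>) \<le> J"
        using loI unfolding J(1) by (simp add: ennreal_le_iff2 J(2)) (use J(2) in auto)
      from fin[OF Mm c0 lo up] have Jp: "0 < J" and lnJ: "\<bar>ln J - (ln (p x) + ln ?M)\<bar> \<le> \<epsilon>" by auto
      have cn: "c i \<noteq> 0" for i using c by (metis less_irrefl)
      have "marginal_likelihood S h p = (\<Prod>i\<in>UNIV. c i) * exp (h x) * J"
        using marginal_likelihood_rescale[OF S(1) hd pm _ A, of x] p c J
        by (simp add: l_def less_imp_le)
      then have "ln (marginal_likelihood S h p) = (\<Sum>i\<in>UNIV. ln (c i)) + h x + ln J"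
        using c Jp cn by (simp add: ln_mult prod_pos ln_prod)
      then show "\<bar>ln (marginal_likelihood S h p) - (h x + (\<Sum>i\<in>UNIV. ln (c i)) + ln ?M + ln (p x))\<bar> \<le> \<epsilon>"
        using lnJ by (simp add: algebra_simps)
    qed
  qed
qed

text \<open>From above, the quadratic at \<open>u\<close> cannot exceed its maximum. From below,
  \<open>u\<close> does at least as well as the vertex \<open>w\<close> of the quadratic. Each
  comparison costs one approximation error, so \<open>w\<close> must also lie in the ball.\<close>

lemma maximum_expansion:
  fixes u :: "real ^ 'n::finite"
  assumes R: "regular_path S A x m C \<eta> h G" and S: "convex S" "x \<in> S"
    and A: "A = diag_matrix c" and pos: "\<eta> \<ge> 0" "m > 0" "C > 0"
    and U: "{u. norm u < r} \<subseteq> local_set S A x" and r: "norm u < r" "m * C < r"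
    and max: "\<And>y. y \<in> S \<Longrightarrow> h y \<le> h (x + A *v u)"
  shows "\<bar>h (x + A *v u) - h x - (norm (inv_sqrt_matrix G *v Delta A h x))\<^sup>2 / 2\<bar>
    \<le> \<eta> * ((real CARD('n) * r) ^ 3 + real CARD('n) * r\<^sup>2)" (is "_ \<le> ?s")
proof -
  define \<Delta> where "\<Delta> = Delta A h x"
  define S' where "S' = inv_sqrt_matrix G"
  define w where "w = S' *v (S' *v \<Delta>)"
  have G: "pos_definite G" and GK: "G \<in> pd_compact m" and D: "norm \<Delta> \<le> C"
    using R by (auto simp: regular_path_def \<Delta>_def)
  have Gw: "G *v w = \<Delta>"
    unfolding w_def S'_def by (simp only: matrix_vector_mul_assoc inv_sqrt_matrix_props(2)[OF G] matrix_vector_mul_lid)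
  \<comment> \<open>Coercivity of \<open>G\<close> together with \<open>G *v w = \<Delta>\<close>
    bounds the vertex by \<open>m * C\<close>, which explains the hypothesis on
    \<open>r\<close>.\<close>
  have "(norm w)\<^sup>2 / m \<le> w \<bullet> \<Delta>" using GK Gw by (auto simp: pd_compact_def dest: spec[of _ w])
  also have "\<dots> \<le> norm w * norm \<Delta>" by (rule norm_cauchy_schwarz)
  also have "\<dots> \<le> norm w * C" using D by (intro mult_left_mono) auto
  finally have "norm w * norm w \<le> norm w * (m * C)"
    using pos by (simp add: field_simps power2_eq_square)
  then have "norm w \<le> m * C" using pos by (cases "norm w = 0") (auto simp: mult_le_cancel_left)
  then have w: "norm w < r" using r by simp
  have cs: "log_quad \<Delta> G (v + w) = (norm (S' *v \<Delta>))\<^sup>2 / 2 - (v \<bullet> (G *v v)) / 2" for v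
    unfolding w_def S'_def by (rule log_quad_complete_square[OF G])
  have ap: "\<bar>h (x + A *v v) - h x - log_quad \<Delta> G v\<bar> \<le> ?s" if "norm v < r" for v
    unfolding \<Delta>_def using that U S A pos by (intro regular_path_quad_approx[OF R]) (auto simp: local_set_def)
  have nn: "0 \<le> v \<bullet> (G *v v)" for v
    using G by (cases "v = 0") (auto simp: pos_definite_def less_imp_le)
  have "log_quad \<Delta> G u \<le> (norm (S' *v \<Delta>))\<^sup>2 / 2"
    using cs[of "u - w"] nn[of "u - w"] by simp
  moreover have "log_quad \<Delta> G w = (norm (S' *v \<Delta>))\<^sup>2 / 2" using cs[of 0] by simp
  moreover have "h (x + A *v w) \<le> h (x + A *v u)" using U w by (intro max) (auto simp: local_set_def)
  ultimately show ?thesis using ap[OF r(1)] ap[OF w] unfolding \<Delta>_def[symmetric] S'_def[symmetric] by linarith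
qed

section \<open>Expansions in probability\<close>

lemma linear_block_proj: "linear (block_proj blk k)"
  by (rule linearI) (auto simp: block_proj_def vec_eq_iff)

lemma block_product_convex:
  assumes "\<And>k. k \<in> {1..K} \<Longrightarrow> bounded_convex_block_domain blk k (D k)"
  shows "convex (block_product blk K D)"
proof -
  have "block_product blk K D = (\<Inter>k\<in>{1..K}. block_proj blk k -` D k)"
    by (auto simp: block_product_def)
  moreover have "convex (block_proj blk k -` D k)" if "k \<in> {1..K}" for k
    using assms[OF that] by (intro convex_linear_vimage linear_block_proj) (simp add: bounded_convex_block_domain_def)
  ultimately show ?thesis by (auto intro: convex_INT)
qed

text \<open>A factor is open only relative to its coordinate subspace. The projection always lands
  in that subspace, so the factor and an ambient open set cutting it out have the same
  preimage.\<close>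

lemma block_product_open:
  assumes "\<And>k. k \<in> {1..K} \<Longrightarrow> bounded_convex_block_domain blk k (D k)"
  shows "open (block_product blk K D)"
proof -
  have "open (block_proj blk k -` D k)" if k: "k \<in> {1..K}" for k
  proof -
    obtain T where T: "open T" "D k = block_space blk k \<inter> T"
      using assms[OF k] by (auto simp: bounded_convex_block_domain_def openin_open)
    have "block_proj blk k x \<in> block_space blk k" for x
      by (simp add: block_proj_def block_space_def)
    then have "block_proj blk k -` D k = block_proj blk k -` T" by (auto simp: T)
    moreover have "continuous_on UNIV (block_proj blk k)"
      using linear_block_proj by (intro linear_continuous_on) (simp add: linear_linear)
    ultimately show ?thesis using T(1) by (simp add: open_vimage)
  qed
  then have "open (\<Inter>k\<in>{1..K}. block_proj blk k -` D k)" by (intro open_INT) auto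
  moreover have "block_product blk K D = (\<Inter>k\<in>{1..K}. block_proj blk k -` D k)"
    by (auto simp: block_product_def)
  ultimately show ?thesis by simp
qed

text \<open>\<open>m\<close> comes from exhausting the law of \<open>\<Gamma>0\<close> and
  \<open>C\<close> from the tightness of the score, both before \<open>\<eta>\<close>. Each of the
  six conditions in the good event receives \<open>\<delta> / 6\<close>.\<close>

lemma regular_path_ev_prob:
  fixes S :: "(real ^ 'n::finite) set"
  assumes M: "prob_space M" and A1: "cond_A1 M S A x H \<Gamma>0" and \<delta>: "\<delta> > 0"
  shows "\<exists>m C. m > 0 \<and> C > 0 \<and>
    (\<forall>\<eta>>0. ev_prob M \<delta> (\<lambda>n \<omega>. regular_path S (A n) x m C \<eta> (H n \<omega>) (\<Gamma>0 \<omega>)))"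
proof -
  from A1 have C3: "\<And>n. AE \<omega> in M. C_k_on 3 S (H n \<omega>)"
    and D: "big_Op M (\<lambda>n \<omega>. Delta (A n) (H n \<omega>) x)"
    and mG: "\<Gamma>0 \<in> borel_measurable M" and pd: "AE \<omega> in M. pos_definite (\<Gamma>0 \<omega>)"
    and G: "small_op M (\<lambda>n \<omega>. Gam (A n) (H n \<omega>) x - \<Gamma>0 \<omega>)"
    and T: "\<And>\<epsilon>. \<epsilon> > 0 \<Longrightarrow> (\<lambda>n. outer_measure_of M {\<omega> \<in> space M. \<not> third_order_sup S (A n) (H n \<omega>) \<le> ereal \<epsilon>}) \<longlonglongrightarrow> 0"
    by (auto simp: cond_A1_def not_le)
  have \<delta>6: "\<delta> / 6 > 0" using \<delta> by simp
  obtain k where K: "ev_prob M (\<delta> / 6) (\<lambda>n \<omega>. \<Gamma>0 \<omega> \<in> pd_compact (real (Suc k)))"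
  proof (rule AE_exhaustion_ev_prob[OF M mG, of "\<lambda>k. pd_compact (real (Suc k))" "\<delta> / 6"])
    show "AE \<omega> in M. \<exists>k. \<Gamma>0 \<omega> \<in> pd_compact (real (Suc k))"
      using pd by eventually_elim (rule pos_definite_in_pd_compact)
    show "pd_compact (real (Suc k)) \<subseteq> (pd_compact (real (Suc (Suc k))) :: (real ^ 'n ^ 'n) set)" for k
      by (rule pd_compact_mono) auto
  qed (use \<delta>6 in \<open>auto intro: closed_pd_compact\<close>)
  obtain C where C: "C > 0" "ev_prob M (\<delta> / 6) (\<lambda>n \<omega>. norm (Delta (A n) (H n \<omega>) x) \<le> C)"
    using big_OpD[OF D \<delta>6] by auto
  have "ev_prob M \<delta> (\<lambda>n \<omega>. regular_path S (A n) x (real (Suc k)) C \<eta> (H n \<omega>) (\<Gamma>0 \<omega>))" if "\<eta> > 0" for \<eta>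
  proof -
    have T\<eta>: "ev_prob M (\<delta> / 6) (\<lambda>n \<omega>. third_order_sup S (A n) (H n \<omega>) \<le> ereal \<eta>)"
      using T[OF that] \<delta>6 by (simp only: outer_tendsto_0_iff)
    have "ev_prob M (\<delta> / 6) (\<lambda>n \<omega>. C_k_on 3 S (H n \<omega>))"
      using C3 by (rule ev_prob_AE[OF _ \<delta>6])
    moreover have "ev_prob M (\<delta> / 6) (\<lambda>n \<omega>. pos_definite (\<Gamma>0 \<omega>))"
      using pd by (rule ev_prob_AE[OF _ \<delta>6])
    moreover note T\<eta>
    ultimately have "ev_prob M (\<delta> / 6 + (\<delta> / 6 + (\<delta> / 6 + (\<delta> / 6 + (\<delta> / 6 + \<delta> / 6)))))
      (\<lambda>n \<omega>. C_k_on 3 S (H n \<omega>) \<and> pos_definite (\<Gamma>0 \<omega>) \<and> \<Gamma>0 \<omega> \<in> pd_compact (real (Suc k)) \<and>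
        norm (Delta (A n) (H n \<omega>) x) \<le> C \<and> norm (Gam (A n) (H n \<omega>) x - \<Gamma>0 \<omega>) \<le> \<eta> \<and>
        third_order_sup S (A n) (H n \<omega>) \<le> ereal \<eta>)"
      using K C(2) small_opD[OF G that \<delta>6] by (intro ev_prob_conj)
    then show ?thesis by (rule ev_prob_mono) (auto simp: regular_path_def)
  qed
  with C(1) show ?thesis by (intro exI[of _ "real (Suc k)"] exI[of _ C]) auto
qed

text \<open>\<open>x\<close> is an interior point and all rates tend to 0, so the image of a fixed
  ball shrinks into \<open>S\<close>.\<close>

lemma eventually_ball_subset_local_set:
  fixes S :: "(real ^ 'n::finite) set"
  assumes S: "open S" "x \<in> S" and A: "\<And>n. A n = diag_matrix (c n)"
    and c: "\<And>i. (\<lambda>n. c n i) \<longlonglongrightarrow> 0"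
  shows "\<forall>\<^sub>F n in sequentially. {u. norm u < r} \<subseteq> local_set S (A n) x"
proof -
  obtain e where e: "e > 0" "ball x e \<subseteq> S" using S openE by blast
  have "(\<lambda>n. \<Sum>i\<in>UNIV. \<bar>c n i\<bar> * \<bar>r\<bar>) \<longlonglongrightarrow> (\<Sum>i\<in>(UNIV :: 'n set). \<bar>0\<bar> * \<bar>r\<bar>)"
    by (intro tendsto_intros c)
  then have "\<forall>\<^sub>F n in sequentially. (\<Sum>i\<in>UNIV. \<bar>c n i\<bar> * \<bar>r\<bar>) < e"
    using e(1) by (intro order_tendstoD(2)) auto
  then show ?thesis
  proof eventually_elim
    case (elim n)
    show ?case
    proof safe
      fix u :: "real^'n" assume u: "norm u < r"
      have "norm (A n *v u) \<le> (\<Sum>i\<in>UNIV. \<bar>(A n *v u) $ i\<bar>)" by (rule norm_le_l1_cart)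
      also have "\<dots> \<le> (\<Sum>i\<in>UNIV. \<bar>c n i\<bar> * \<bar>r\<bar>)"
        using u component_le_norm_cart[of u]
        by (intro sum_mono) (force simp: A abs_mult intro!: mult_left_mono intro: order_trans)
      also note elim
      finally have "x + A n *v u \<in> ball x e" by (simp add: dist_norm)
      then show "u \<in> local_set S (A n) x" using e(2) by (auto simp: local_set_def)
    qed
  qed
qed

lemma cond_A2_eventually:
  fixes S :: "(real ^ 'n::finite) set"
  assumes A2: "cond_A2 S A x p" and p: "\<And>n y. y \<in> S \<Longrightarrow> 0 < p n y" and x: "x \<in> S"
    and ev: "\<forall>\<^sub>F n in sequentially. {u. norm u < r} \<subseteq> local_set S (A n) x" and "r > 0" "\<eta> > 0"
  shows "\<forall>\<^sub>F n in sequentially. \<forall>u. norm u < r \<longrightarrow> \<bar>p n (x + A n *v u) - p n x\<bar> \<le> \<eta>"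
proof -
  obtain B where B: "\<And>n y. y \<in> S \<Longrightarrow> p n y \<le> B"
    using A2 by (fastforce simp: cond_A2_def bdd_above_def)
  have "(\<lambda>n. SUP u\<in>{u \<in> local_set S (A n) x. norm u < r}. \<bar>p n (x + A n *v u) - p n x\<bar>) \<longlonglongrightarrow> 0"
    using A2 \<open>r > 0\<close> by (simp add: cond_A2_def)
  then have "\<forall>\<^sub>F n in sequentially. (SUP u\<in>{u \<in> local_set S (A n) x. norm u < r}. \<bar>p n (x + A n *v u) - p n x\<bar>) < \<eta>"
    using \<open>\<eta> > 0\<close> by (rule order_tendstoD(2))
  then show ?thesis using ev
  proof eventually_elim
    case (elim n)
    show ?case
    proof (intro allI impI)
      fix u :: "real ^ 'n" assume u: "norm u < r"
      have "\<bar>p n (x + A n *v u) - p n x\<bar> \<le> (SUP u\<in>{u \<in> local_set S (A n) x. norm u < r}. \<bar>p n (x + A n *v u) - p n x\<bar>)"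
      proof (rule cSUP_upper)
        show "u \<in> {u \<in> local_set S (A n) x. norm u < r}" using u elim(2) by auto
        \<comment> \<open>A real \<open>SUP\<close> dominates its family only if the family is
          bounded above. Both density values lie between 0 and \<open>B\<close>, which bounds their
          difference.\<close>
        have "\<bar>p n (x + A n *v v) - p n x\<bar> \<le> B" if "v \<in> local_set S (A n) x" for v
          using B[of "x + A n *v v" n] B[OF x, of n] p[of "x + A n *v v" n] p[OF x, of n] that
          by (auto simp: local_set_def abs_le_iff)
        then show "bdd_above ((\<lambda>u. \<bar>p n (x + A n *v u) - p n x\<bar>) ` {u \<in> local_set S (A n) x. norm u < r})"
          by (intro bdd_aboveI[of _ B]) auto
      qed
      with elim(1) show "\<bar>p n (x + A n *v u) - p n x\<bar> \<le> \<eta>" by linarith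
    qed
  qed
qed

text \<open>(A3) uses one number both as threshold and as probability; taking the minimum of
  \<open>\<tau>\<close> and \<open>\<delta>\<close> decouples them. Larger radii are covered because
  the tail integral decreases in \<open>r\<close>.\<close>

lemma cond_A3_ev_prob:
  assumes A3: "cond_A3 M S A x H" and "\<tau> > 0" "\<delta> > 0"
  shows "\<exists>r0>0. \<forall>r\<ge>r0. ev_prob M \<delta> (\<lambda>n \<omega>.
    (\<integral>\<^sup>+u\<in>local_set S (A n) x \<inter> {u. r \<le> norm u}. ennreal (local_field (A n) (H n \<omega>) x u) \<partial>lborel) \<le> ennreal \<tau>)"
proof -
  define \<epsilon> where "\<epsilon> = min \<tau> \<delta>"
  let ?I = "\<lambda>r n \<omega>. \<integral>\<^sup>+u\<in>local_set S (A n) x \<inter> {u. r \<le> norm u}. ennreal (local_field (A n) (H n \<omega>) x u) \<partial>lborel"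
  have "\<epsilon> > 0" using assms by (simp add: \<epsilon>_def)
  with A3 obtain r0 N where r0: "r0 > 0"
    and sup: "(SUP n\<in>{N..}. outer_measure_of M {\<omega> \<in> space M. ennreal \<epsilon> < ?I r0 n \<omega>}) < ennreal \<epsilon>"
    unfolding cond_A3_def by blast
  have ev: "ev_prob M \<epsilon> (\<lambda>n \<omega>. ?I r0 n \<omega> \<le> ennreal \<epsilon>)"
    unfolding ev_prob_def not_le eventually_sequentially
    by (intro exI[of _ N] allI impI order_le_less_trans[OF SUP_upper sup]) simp
  have "ev_prob M \<delta> (\<lambda>n \<omega>. ?I r n \<omega> \<le> ennreal \<tau>)" if r: "r0 \<le> r" for r
  proof (rule ev_prob_mono[OF ev])
    show "\<epsilon> \<le> \<delta>" by (simp add: \<epsilon>_def)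
    have "?I r n \<omega> \<le> ennreal \<tau>" if "?I r0 n \<omega> \<le> ennreal \<epsilon>" for n \<omega>
    proof -
      have "?I r n \<omega> \<le> ?I r0 n \<omega>"
        using r by (intro nn_integral_mono) (auto simp: indicator_def)
      also note that
      also have "ennreal \<epsilon> \<le> ennreal \<tau>" by (intro ennreal_leI) (simp add: \<epsilon>_def)
      finally show ?thesis .
    qed
    then show "\<forall>\<^sub>F n in sequentially. \<forall>\<omega>\<in>space M. ?I r0 n \<omega> \<le> ennreal \<epsilon> \<longrightarrow> ?I r n \<omega> \<le> ennreal \<tau>"
      by (intro always_eventually) blast
  qed
  with r0 show ?thesis by blast
qed

lemma log_marginal_likelihood_expansion:
  fixes S :: "(real ^ 'n::finite) set"
  assumes M: "prob_space M" and S: "open S" "convex S" "x \<in> S"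
    and A: "\<And>n. A n = diag_matrix (c n)" and c: "\<And>i n. c n i > 0" "\<And>i. (\<lambda>n. c n i) \<longlonglongrightarrow> 0"
    and p: "prior_densities S p" and A1: "cond_A1 M S A x H \<Gamma>0" and A2: "cond_A2 S A x p"
    and pb: "prior_bounded_below x p" and A3: "cond_A3 M S A x H"
  shows "small_op M (\<lambda>n \<omega>. ln (marginal_likelihood S (H n \<omega>) (p n))
    - (H n \<omega> x + (\<Sum>i\<in>UNIV. ln (c n i)) + ln (gauss_mass (Delta (A n) (H n \<omega>) x) (\<Gamma>0 \<omega>)) + ln (p n x)))"
  unfolding small_op_iff
proof (intro allI impI)
  fix \<epsilon> \<delta> :: real assume \<epsilon>: "0 < \<epsilon>" and \<delta>: "0 < \<delta>"
  have pp: "0 < p n y" if "y \<in> S" for n y using p that by (simp add: prior_densities_def)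
  have pm: "set_borel_measurable lborel S (p n)" for n using p by (simp add: prior_densities_def)
  obtain B where B: "\<And>n y. y \<in> S \<Longrightarrow> p n y \<le> B"
    using A2 by (fastforce simp: cond_A2_def bdd_above_def)
  have "B > 0" using pp[OF S(3), of 0] B[OF S(3), of 0] by linarith
  obtain c0 where c0: "c0 > 0" "\<And>n. c0 \<le> p n x" using pb by (auto simp: prior_bounded_below_def)
  obtain m C where mC: "m > 0" "C > 0"
    and R: "\<And>\<eta>. \<eta> > 0 \<Longrightarrow> ev_prob M (\<delta> / 2) (\<lambda>n \<omega>. regular_path S (A n) x m C \<eta> (H n \<omega>) (\<Gamma>0 \<omega>))"
    using regular_path_ev_prob[OF M A1, of "\<delta> / 2"] \<delta> by auto
  obtain r0 \<tau> where r0: "r0 > 0" "\<tau> > 0" and L: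
    "\<forall>r\<ge>r0. \<exists>\<eta>>0. \<forall>A c h G p.
       regular_path S A x m C \<eta> h G \<longrightarrow> A = diag_matrix c \<longrightarrow> (\<forall>i. c i > 0) \<longrightarrow>
       set_borel_measurable lborel S p \<longrightarrow> (\<forall>y\<in>S. 0 < p y \<and> p y \<le> B) \<longrightarrow> c0 \<le> p x \<longrightarrow>
       {u. norm u < r} \<subseteq> local_set S A x \<longrightarrow> (\<forall>u. norm u < r \<longrightarrow> \<bar>p (x + A *v u) - p x\<bar> \<le> \<eta>) \<longrightarrow>
       (\<integral>\<^sup>+u\<in>local_set S A x \<inter> {u. r \<le> norm u}. ennreal (local_field A h x u) \<partial>lborel) \<le> ennreal \<tau> \<longrightarrow>
       \<bar>ln (marginal_likelihood S h p) - (h x + (\<Sum>i\<in>UNIV. ln (c i)) + ln (gauss_mass (Delta A h x) G) + ln (p x))\<bar> \<le> \<epsilon>"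
    using laplace_expansion[OF S mC c0(1) \<open>B > 0\<close> \<epsilon>] by (elim exE conjE) (rule that)
  obtain r1 where r1: "r1 > 0" and T: "\<And>r. r1 \<le> r \<Longrightarrow> ev_prob M (\<delta> / 2) (\<lambda>n \<omega>.
    (\<integral>\<^sup>+u\<in>local_set S (A n) x \<inter> {u. r \<le> norm u}. ennreal (local_field (A n) (H n \<omega>) x u) \<partial>lborel) \<le> ennreal \<tau>)"
    using cond_A3_ev_prob[OF A3 r0(2), of "\<delta> / 2"] \<delta> by auto
  \<comment> \<open>\<open>r0\<close> makes the Gaussian tail small and \<open>r1\<close> the tail
    of \<open>Z\<close>, both relative to the same \<open>\<tau>\<close>; only now can
    \<open>\<eta>\<close> be extracted.\<close>
  define r where "r = max r0 r1"
  have r: "r > 0" "r0 \<le> r" "r1 \<le> r" using r0 by (auto simp: r_def)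
  from L[THEN spec, THEN mp, OF r(2)] obtain \<eta> where \<eta>: "\<eta> > 0" and L':
    "\<forall>A c h G p. regular_path S A x m C \<eta> h G \<longrightarrow> A = diag_matrix c \<longrightarrow> (\<forall>i. c i > 0) \<longrightarrow>
       set_borel_measurable lborel S p \<longrightarrow> (\<forall>y\<in>S. 0 < p y \<and> p y \<le> B) \<longrightarrow> c0 \<le> p x \<longrightarrow>
       {u. norm u < r} \<subseteq> local_set S A x \<longrightarrow> (\<forall>u. norm u < r \<longrightarrow> \<bar>p (x + A *v u) - p x\<bar> \<le> \<eta>) \<longrightarrow>
       (\<integral>\<^sup>+u\<in>local_set S A x \<inter> {u. r \<le> norm u}. ennreal (local_field A h x u) \<partial>lborel) \<le> ennreal \<tau> \<longrightarrow>
       \<bar>ln (marginal_likelihood S h p) - (h x + (\<Sum>i\<in>UNIV. ln (c i)) + ln (gauss_mass (Delta A h x) G) + ln (p x))\<bar> \<le> \<epsilon>"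
    by (elim exE conjE) (rule that)
  have evU: "\<forall>\<^sub>F n in sequentially. {u. norm u < r} \<subseteq> local_set S (A n) x"
    by (rule eventually_ball_subset_local_set[OF S(1,3) A c(2)])
  have evp: "\<forall>\<^sub>F n in sequentially. \<forall>u. norm u < r \<longrightarrow> \<bar>p n (x + A n *v u) - p n x\<bar> \<le> \<eta>"
    by (rule cond_A2_eventually[OF A2 pp S(3) evU r(1) \<eta>])
  show "ev_prob M \<delta> (\<lambda>n \<omega>. norm (ln (marginal_likelihood S (H n \<omega>) (p n))
    - (H n \<omega> x + (\<Sum>i\<in>UNIV. ln (c n i)) + ln (gauss_mass (Delta (A n) (H n \<omega>) x) (\<Gamma>0 \<omega>)) + ln (p n x))) \<le> \<epsilon>)"
  proof (rule ev_prob_mono[OF ev_prob_conj_half[OF R[OF \<eta>] T[OF r(3)]] order_refl])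
    show "\<forall>\<^sub>F n in sequentially. \<forall>\<omega>\<in>space M. regular_path S (A n) x m C \<eta> (H n \<omega>) (\<Gamma>0 \<omega>) \<and>
      (\<integral>\<^sup>+u\<in>local_set S (A n) x \<inter> {u. r \<le> norm u}. ennreal (local_field (A n) (H n \<omega>) x u) \<partial>lborel) \<le> ennreal \<tau> \<longrightarrow>
      norm (ln (marginal_likelihood S (H n \<omega>) (p n))
    - (H n \<omega> x + (\<Sum>i\<in>UNIV. ln (c n i)) + ln (gauss_mass (Delta (A n) (H n \<omega>) x) (\<Gamma>0 \<omega>)) + ln (p n x))) \<le> \<epsilon>"
      using evU evp
    proof eventually_elim
      case (elim n)
      show ?case
        unfolding real_norm_def
      proof (intro ballI impI)
        fix \<omega> assume "regular_path S (A n) x m C \<eta> (H n \<omega>) (\<Gamma>0 \<omega>) \<and>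
          (\<integral>\<^sup>+u\<in>local_set S (A n) x \<inter> {u. r \<le> norm u}. ennreal (local_field (A n) (H n \<omega>) x u) \<partial>lborel) \<le> ennreal \<tau>"
        then show "\<bar>ln (marginal_likelihood S (H n \<omega>) (p n))
          - (H n \<omega> x + (\<Sum>i\<in>UNIV. ln (c n i)) + ln (gauss_mass (Delta (A n) (H n \<omega>) x) (\<Gamma>0 \<omega>)) + ln (p n x))\<bar> \<le> \<epsilon>"
          using c(1) pp B by (intro L'[rule_format, OF _ A _ pm _ c0(2)] elim[rule_format]) auto
      qed
    qed
  qed
qed

text \<open>Tightness places the rescaled maximizer in a fixed ball, on which the quadratic
  approximation and the variation bound for \<open>Gam\<close> are uniform. Both statements are kept
  on one event, together with positivity of the determinant.\<close>

lemma QMLE_expansion: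
  fixes S :: "(real ^ 'n::finite) set"
  assumes M: "prob_space M" and S: "open S" "convex S" "x \<in> S"
    and A: "\<And>n. A n = diag_matrix (c n)" and c: "\<And>i n. c n i > 0" "\<And>i. (\<lambda>n. c n i) \<longlonglongrightarrow> 0"
    and A1: "cond_A1 M S A x H \<Gamma>0" and th: "is_QMLE M S H \<theta>h"
    and \<mu>: "prob_space \<mu>" "sets \<mu> = sets borel"
    and law: "converges_in_law M (\<lambda>n \<omega>. matrix_inv (A n) *v (\<theta>h n \<omega> - x)) \<mu>"
    and \<epsilon>: "\<epsilon> > 0" and \<delta>: "\<delta> > 0"
  shows "ev_prob M \<delta> (\<lambda>n \<omega>. pos_definite (\<Gamma>0 \<omega>) \<and>
    \<bar>H n \<omega> (\<theta>h n \<omega>) - H n \<omega> x - (norm (inv_sqrt_matrix (\<Gamma>0 \<omega>) *v Delta (A n) (H n \<omega>) x))\<^sup>2 / 2\<bar> \<le> \<epsilon> \<and>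
    0 < det (Gam (A n) (H n \<omega>) (\<theta>h n \<omega>)) \<and>
    \<bar>ln (det (Gam (A n) (H n \<omega>) (\<theta>h n \<omega>))) - ln (det (\<Gamma>0 \<omega>))\<bar> \<le> \<epsilon>)"
proof -
  let ?N = "real CARD('n)"
  let ?u = "\<lambda>n \<omega>. matrix_inv (A n) *v (\<theta>h n \<omega> - x)"
  have \<delta>3: "\<delta> / 3 > 0" using \<delta> by simp
  obtain m C where mC: "m > 0" "C > 0"
    and R: "\<And>\<eta>. \<eta> > 0 \<Longrightarrow> ev_prob M (\<delta> / 3) (\<lambda>n \<omega>. regular_path S (A n) x m C \<eta> (H n \<omega>) (\<Gamma>0 \<omega>))"
    using regular_path_ev_prob[OF M A1 \<delta>3] by auto
  have "(\<lambda>\<omega>. ?u n \<omega>) \<in> borel_measurable M" for n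
  proof -
    have "\<theta>h n \<in> borel_measurable M" using th by (simp add: is_QMLE_def)
    then have 1: "(\<lambda>\<omega>. \<theta>h n \<omega> - x) \<in> borel_measurable M" by measurable
    have 2: "(\<lambda>v. matrix_inv (A n) *v v) \<in> borel_measurable borel"
      by (intro borel_measurable_continuous_onI continuous_intros)
    show ?thesis by (rule measurable_compose[OF 1 2])
  qed
  then obtain C' where C': "C' > 0" "ev_prob M (\<delta> / 3) (\<lambda>n \<omega>. norm (?u n \<omega>) \<le> C')"
    using converges_in_law_tight[OF M \<mu> _ law \<delta>3] by auto
  obtain \<eta>1 where \<eta>1: "\<eta>1 > 0" and det: "\<And>G G' :: real ^ 'n ^ 'n::finite. G \<in> pd_compact m \<Longrightarrow> norm (G' - G) \<le> \<eta>1 \<Longrightarrow>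
     0 < det G' \<and> \<bar>ln (det G') - ln (det G)\<bar> \<le> \<epsilon>"
    using ln_det_uniform_on_pd_compact[OF mC(1) \<epsilon>, where ?'n = 'n] by auto
  \<comment> \<open>Large enough to contain both the rescaled maximizer and the vertex of the
    quadratic, strictly.\<close>
  define r where "r = max C' (m * C) + 1"
  have r: "C' < r" "m * C < r" "r > 0" using C' mC by (auto simp: r_def less_max_iff_disj)
  define q where "q = (?N * r) ^ 3 + ?N * r\<^sup>2"
  have q: "q > 0" using r by (simp add: q_def add_pos_pos)
  \<comment> \<open>The first entry serves the maximum. In the second, \<open>1\<close> accounts for
    passing from \<open>\<Gamma>0\<close> to \<open>Gam\<close> at \<open>x\<close>, and
    \<open>?N ^ 3 * r\<close> for moving on to the maximizer.\<close>
  define \<eta> where "\<eta> = min (\<epsilon> / q) (\<eta>1 / (1 + ?N ^ 3 * r))"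
  have Nr: "1 + ?N ^ 3 * r > 0" using r by (simp add: add_pos_nonneg)
  have \<eta>: "\<eta> > 0" using \<epsilon> q \<eta>1 Nr by (simp add: \<eta>_def)
  have \<eta>q: "\<eta> * q \<le> \<epsilon>" using q by (simp add: \<eta>_def min_def field_simps)
  have \<eta>N: "\<eta> * (1 + ?N ^ 3 * r) \<le> \<eta>1"
  proof -
    have "\<eta> \<le> \<eta>1 / (1 + ?N ^ 3 * r)" by (simp add: \<eta>_def)
    then show ?thesis using Nr by (simp only: pos_le_divide_eq)
  qed
  have Q: "ev_prob M (\<delta> / 3) (\<lambda>n \<omega>. \<forall>y\<in>closure S. H n \<omega> y \<le> H n \<omega> (\<theta>h n \<omega>))"
  proof (rule ev_prob_AE[OF _ \<delta>3])
    fix n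
    have "AE \<omega> in M. \<theta>h n \<omega> \<in> closure S \<and> (\<forall>y\<in>closure S. H n \<omega> y \<le> H n \<omega> (\<theta>h n \<omega>))"
      using th by (simp add: is_QMLE_def)
    then show "AE \<omega> in M. \<forall>y\<in>closure S. H n \<omega> y \<le> H n \<omega> (\<theta>h n \<omega>)" by eventually_elim blast
  qed
  show ?thesis
  proof (rule ev_prob_mono[OF ev_prob_conj[OF R[OF \<eta>] ev_prob_conj[OF C'(2) Q]]])
    show "\<delta> / 3 + (\<delta> / 3 + \<delta> / 3) \<le> \<delta>" by simp
    show "\<forall>\<^sub>F n in sequentially. \<forall>\<omega>\<in>space M. regular_path S (A n) x m C \<eta> (H n \<omega>) (\<Gamma>0 \<omega>) \<and>
       norm (?u n \<omega>) \<le> C' \<and> (\<forall>y\<in>closure S. H n \<omega> y \<le> H n \<omega> (\<theta>h n \<omega>)) \<longrightarrow>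
       pos_definite (\<Gamma>0 \<omega>) \<and>
       \<bar>H n \<omega> (\<theta>h n \<omega>) - H n \<omega> x - (norm (inv_sqrt_matrix (\<Gamma>0 \<omega>) *v Delta (A n) (H n \<omega>) x))\<^sup>2 / 2\<bar> \<le> \<epsilon> \<and>
       0 < det (Gam (A n) (H n \<omega>) (\<theta>h n \<omega>)) \<and>
       \<bar>ln (det (Gam (A n) (H n \<omega>) (\<theta>h n \<omega>))) - ln (det (\<Gamma>0 \<omega>))\<bar> \<le> \<epsilon>"
      using eventually_ball_subset_local_set[OF S(1,3) A c(2), of r]
    proof eventually_elim
      case (elim n)
      show ?case
      proof (intro ballI impI)
        fix \<omega> assume "regular_path S (A n) x m C \<eta> (H n \<omega>) (\<Gamma>0 \<omega>) \<and>
          norm (?u n \<omega>) \<le> C' \<and> (\<forall>y\<in>closure S. H n \<omega> y \<le> H n \<omega> (\<theta>h n \<omega>))"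
        then have reg: "regular_path S (A n) x m C \<eta> (H n \<omega>) (\<Gamma>0 \<omega>)" and u: "norm (?u n \<omega>) < r"
          and mx: "\<And>y. y \<in> S \<Longrightarrow> H n \<omega> y \<le> H n \<omega> (\<theta>h n \<omega>)"
          using r closure_subset[of S] by auto
        have inv: "A n ** matrix_inv (A n) = mat 1"
        proof -
          have "A n ** diag_matrix (\<lambda>i. 1 / c n i) = mat 1"
            using c(1)[THEN less_imp_neq] by (simp add: A diag_matrix_mult flip: diag_matrix_1)
          then show ?thesis by (simp only: matrix_inv_eqI)
        qed
        have \<theta>: "\<theta>h n \<omega> = x + A n *v ?u n \<omega>"
          by (simp add: matrix_vector_mul_assoc inv)
        \<comment> \<open>A maximizer is known a priori to lie only in the closure, while
          derivatives are controlled on the open set; the inclusion of the ball puts it in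
          \<open>S\<close>.\<close>
        have inS: "x + A n *v ?u n \<omega> \<in> S" using elim u by (auto simp: local_set_def)
        have "\<bar>H n \<omega> (x + A n *v ?u n \<omega>) - H n \<omega> x - (norm (inv_sqrt_matrix (\<Gamma>0 \<omega>) *v Delta (A n) (H n \<omega>) x))\<^sup>2 / 2\<bar> \<le> \<eta> * q"
          unfolding q_def
          by (rule maximum_expansion[OF reg S(2,3) A less_imp_le[OF \<eta>] mC elim u r(2)])
            (use mx \<theta> in auto)
        with \<eta>q have 1: "\<bar>H n \<omega> (\<theta>h n \<omega>) - H n \<omega> x - (norm (inv_sqrt_matrix (\<Gamma>0 \<omega>) *v Delta (A n) (H n \<omega>) x))\<^sup>2 / 2\<bar> \<le> \<epsilon>"
          unfolding \<theta>[symmetric] by linarith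
        have "norm (Gam (A n) (H n \<omega>) (x + A n *v ?u n \<omega>) - Gam (A n) (H n \<omega>) x) \<le> ?N ^ 3 * \<eta> * norm (?u n \<omega>)"
          using reg \<eta> by (intro Gam_variation_bound[OF S(2,3) inS _ A]) (auto simp: regular_path_def)
        also have "\<dots> \<le> ?N ^ 3 * \<eta> * r" using u \<eta> by (intro mult_left_mono) auto
        finally have "norm (Gam (A n) (H n \<omega>) (\<theta>h n \<omega>) - Gam (A n) (H n \<omega>) x) \<le> ?N ^ 3 * \<eta> * r"
          unfolding \<theta>[symmetric] .
        moreover have "norm (Gam (A n) (H n \<omega>) x - \<Gamma>0 \<omega>) \<le> \<eta>" using reg by (simp add: regular_path_def)
        ultimately have "norm (Gam (A n) (H n \<omega>) (\<theta>h n \<omega>) - \<Gamma>0 \<omega>) \<le> ?N ^ 3 * \<eta> * r + \<eta>"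
          using norm_triangle_ineq[of "Gam (A n) (H n \<omega>) (\<theta>h n \<omega>) - Gam (A n) (H n \<omega>) x" "Gam (A n) (H n \<omega>) x - \<Gamma>0 \<omega>"]
          by simp
        then have "norm (Gam (A n) (H n \<omega>) (\<theta>h n \<omega>) - \<Gamma>0 \<omega>) \<le> \<eta>1"
          using \<eta>N by (simp add: algebra_simps)
        from det[OF _ this] 1 reg
        show "pos_definite (\<Gamma>0 \<omega>) \<and>
          \<bar>H n \<omega> (\<theta>h n \<omega>) - H n \<omega> x - (norm (inv_sqrt_matrix (\<Gamma>0 \<omega>) *v Delta (A n) (H n \<omega>) x))\<^sup>2 / 2\<bar> \<le> \<epsilon> \<and>
          0 < det (Gam (A n) (H n \<omega>) (\<theta>h n \<omega>)) \<and>
          \<bar>ln (det (Gam (A n) (H n \<omega>) (\<theta>h n \<omega>))) - ln (det (\<Gamma>0 \<omega>))\<bar> \<le> \<epsilon>"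
          by (simp add: regular_path_def)
      qed
    qed
  qed
qed

text \<open>The squared product of rates is the link between the two forms of (ii): half its
  logarithm is the sum of the logarithms of the rates.\<close>

lemma det_Gam:
  fixes h :: "real ^ 'n::finite \<Rightarrow> real"
  assumes "A = diag_matrix c"
  shows "det (Gam A h y) = (\<Prod>i\<in>UNIV. c i)\<^sup>2 * det (- hessian h y)"
proof -
  have "- (A ** X ** A) = A ** (- X) ** A" for X :: "real ^ 'n ^ 'n"
    by (simp add: vec_eq_iff matrix_matrix_mult_def sum_negf)
  then show ?thesis
    by (simp add: Gam_def det_mul assms det_diag_matrix power2_eq_square)
qed

lemma sum_over_blocks:
  fixes blk :: "'n::finite \<Rightarrow> nat" and f :: "nat \<Rightarrow> real"
  assumes "range blk = I"
  shows "(\<Sum>i\<in>UNIV. f (blk i)) = (\<Sum>k\<in>I. real (block_dim blk k) * f k)"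
proof -
  have "(\<Sum>i\<in>UNIV. f (blk i)) = (\<Sum>k\<in>I. \<Sum>i\<in>{i \<in> UNIV. blk i = k}. f (blk i))"
    using sum.image_gen[of UNIV "\<lambda>i. f (blk i)" blk] assms by simp
  also have "\<dots> = (\<Sum>k\<in>I. real (block_dim blk k) * f k)"
    by (intro sum.cong refl) (simp add: block_dim_def)
  finally show ?thesis .
qed

theorem theorem3p7:
  fixes M :: "'w measure"
    and blk :: "'p::finite \<Rightarrow> nat" and K :: nat
    and D :: "nat \<Rightarrow> (real ^ 'p) set" and \<Theta> :: "(real ^ 'p) set"
    and H :: "nat \<Rightarrow> 'w \<Rightarrow> real ^ 'p \<Rightarrow> real"
    and \<pi> :: "nat \<Rightarrow> real ^ 'p \<Rightarrow> real"
    and a :: "nat \<Rightarrow> nat \<Rightarrow> real ^ 'p \<Rightarrow> real"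
    and \<theta>0 :: "real ^ 'p"
    and \<theta>h :: "nat \<Rightarrow> 'w \<Rightarrow> real ^ 'p"
    and \<Gamma>0 :: "'w \<Rightarrow> real ^ 'p ^ 'p"
    and A :: "nat \<Rightarrow> real ^ 'p ^ 'p"
    and \<mu> :: "(real ^ 'p) measure"
  assumes "prob_space M"
    and "range blk = {1..K}"
    and "\<And>k. k \<in> {1..K} \<Longrightarrow> bounded_convex_block_domain blk k (D k)"
    and \<Theta>_def: "\<Theta> = block_product blk K D"
    and "\<theta>0 \<in> \<Theta>"
    and "\<And>n \<theta>. \<theta> \<in> closure \<Theta> \<Longrightarrow> (\<lambda>\<omega>. H n \<omega> \<theta>) \<in> borel_measurable M"
    and "\<And>n. AE \<omega> in M. continuous_on (closure \<Theta>) (H n \<omega>)"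
    and "prior_densities \<Theta> \<pi>"
    and "\<And>k n \<theta>. k \<in> {1..K} \<Longrightarrow> \<theta> \<in> \<Theta> \<Longrightarrow> 0 < a k n \<theta>"
    and "\<And>k. k \<in> {1..K} \<Longrightarrow> decseq (\<lambda>n. a k n \<theta>0)"
    and "\<And>k. k \<in> {1..K} \<Longrightarrow> (\<lambda>n. a k n \<theta>0) \<longlonglongrightarrow> 0"
    and "\<And>i j. i \<in> {1..K} \<Longrightarrow> j \<in> {1..K} \<Longrightarrow> i < j \<Longrightarrow> (\<lambda>n. a i n \<theta>0 / a j n \<theta>0) \<longlonglongrightarrow> 0"
    and A_def: "A = (\<lambda>n. rate_matrix blk a n \<theta>0)"
    and "is_QMLE M \<Theta> H \<theta>h"
    and "prob_space \<mu>" and "sets \<mu> = sets borel" and "\<And>y. \<mu> \<noteq> return borel y"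
    and "converges_in_law M (\<lambda>n \<omega>. matrix_inv (A n) *v (\<theta>h n \<omega> - \<theta>0)) \<mu>"
    and "cond_A1 M \<Theta> A \<theta>0 H \<Gamma>0"
    and "cond_A2 \<Theta> A \<theta>0 \<pi>"
    and "prior_bounded_below \<theta>0 \<pi>"
    and "cond_A3 M \<Theta> A \<theta>0 H"
    and "small_op M (\<lambda>n \<omega>. \<theta>h n \<omega> - \<theta>0)"
  shows
    "small_op M (\<lambda>n \<omega>.
       ln (marginal_likelihood \<Theta> (H n \<omega>) (\<pi> n))
       - (H n \<omega> \<theta>0
          + (\<Sum>k\<in>{1..K}. real (block_dim blk k) * ln (a k n \<theta>0))
          - 1/2 * ln (det (\<Gamma>0 \<omega>))
          + real CARD('p) / 2 * ln (2 * pi)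
          + 1/2 * (norm (inv_sqrt_matrix (\<Gamma>0 \<omega>) *v Delta (A n) (H n \<omega>) \<theta>0))\<^sup>2
          + ln (\<pi> n \<theta>0)))
     \<and>
     ((\<forall>k\<in>{1..K}. small_op M (\<lambda>n \<omega>. ln (a k n (\<theta>h n \<omega>)) - ln (a k n \<theta>0))) \<and>
      small_op M (\<lambda>n \<omega>. ln (\<pi> n (\<theta>h n \<omega>)) - ln (\<pi> n \<theta>0))
      \<longrightarrow>
      (\<lambda>n. outer_measure_of M
             {\<omega> \<in> space M. \<not> 0 < det (Gam (A n) (H n \<omega>) (\<theta>h n \<omega>))}) \<longlonglongrightarrow> 0 \<and>
      small_op M (\<lambda>n \<omega>.
        ln (marginal_likelihood \<Theta> (H n \<omega>) (\<pi> n))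
        - (H n \<omega> (\<theta>h n \<omega>)
           + (\<Sum>k\<in>{1..K}. real (block_dim blk k) * ln (a k n (\<theta>h n \<omega>)))
           + real CARD('p) / 2 * ln (2 * pi)
           - 1/2 * ln (det (Gam (A n) (H n \<omega>) (\<theta>h n \<omega>)))
           + ln (\<pi> n (\<theta>h n \<omega>)))) \<and>
      (\<lambda>n. outer_measure_of M
             {\<omega> \<in> space M. \<not> 0 < det (- hessian (H n \<omega>) (\<theta>h n \<omega>))}) \<longlonglongrightarrow> 0 \<and>
      small_op M (\<lambda>n \<omega>.
        ln (marginal_likelihood \<Theta> (H n \<omega>) (\<pi> n))
        - (H n \<omega> (\<theta>h n \<omega>)
           + real CARD('p) / 2 * ln (2 * pi)
           - 1/2 * ln (det (- hessian (H n \<omega>) (\<theta>h n \<omega>)))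
           + ln (\<pi> n (\<theta>h n \<omega>)))))"
proof -
  let ?M0 = "\<lambda>n \<omega>. Delta (A n) (H n \<omega>) \<theta>0"
  let ?c = "\<lambda>n i. a (blk i) n \<theta>0"
  let ?lik = "\<lambda>n \<omega>. ln (marginal_likelihood \<Theta> (H n \<omega>) (\<pi> n))"
  let ?GQ = "\<lambda>n \<omega>. det (Gam (A n) (H n \<omega>) (\<theta>h n \<omega>))"
  have blk: "blk i \<in> {1..K}" for i using assms(2) by blast
  have oc: "open \<Theta>" "convex \<Theta>"
    unfolding \<Theta>_def using assms(3) by (auto intro: block_product_open block_product_convex)
  note S = oc \<open>\<theta>0 \<in> \<Theta>\<close>
  have A: "A n = diag_matrix (?c n)" for n
    by (simp add: A_def rate_matrix_def diag_matrix_def)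
  have c: "0 < ?c n i" for i n using assms(9)[OF blk \<open>\<theta>0 \<in> \<Theta>\<close>] .
  have c0: "(\<lambda>n. ?c n i) \<longlonglongrightarrow> 0" for i using assms(11)[OF blk] .
  have blocks: "(\<Sum>i\<in>UNIV. ln (?c n i)) = (\<Sum>k\<in>{1..K}. real (block_dim blk k) * ln (a k n \<theta>0))" for n
    using sum_over_blocks[OF assms(2), of "\<lambda>k. ln (a k n \<theta>0)"] .
  have pd: "ev_prob M \<delta> (\<lambda>n \<omega>. pos_definite (\<Gamma>0 \<omega>))" if "\<delta> > 0" for \<delta>
    using assms(19) that by (intro ev_prob_AE) (auto simp: cond_A1_def)
  have "small_op M (\<lambda>n \<omega>. ?lik n \<omega>
    - (H n \<omega> \<theta>0 + (\<Sum>i\<in>UNIV. ln (?c n i)) + ln (gauss_mass (?M0 n \<omega>) (\<Gamma>0 \<omega>)) + ln (\<pi> n \<theta>0)))"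
    by (rule log_marginal_likelihood_expansion[OF assms(1) S A c c0 assms(8,19,20,21,22)])
  then have i: "small_op M (\<lambda>n \<omega>. ?lik n \<omega>
       - (H n \<omega> \<theta>0 + (\<Sum>k\<in>{1..K}. real (block_dim blk k) * ln (a k n \<theta>0))
          - 1/2 * ln (det (\<Gamma>0 \<omega>)) + real CARD('p) / 2 * ln (2 * pi)
          + 1/2 * (norm (inv_sqrt_matrix (\<Gamma>0 \<omega>) *v ?M0 n \<omega>))\<^sup>2 + ln (\<pi> n \<theta>0)))"
  \<comment> \<open>The logarithm of the Gaussian mass splits where \<open>\<Gamma>0\<close> is
    positive definite, hence on events of probability close to one.\<close>
  proof (rule small_op_cong_ev)
    fix \<delta> :: real assume "\<delta> > 0"
    then show "ev_prob M \<delta> (\<lambda>n \<omega>. ?lik n \<omega>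
      - (H n \<omega> \<theta>0 + (\<Sum>i\<in>UNIV. ln (?c n i)) + ln (gauss_mass (?M0 n \<omega>) (\<Gamma>0 \<omega>)) + ln (\<pi> n \<theta>0))
      = ?lik n \<omega> - (H n \<omega> \<theta>0 + (\<Sum>k\<in>{1..K}. real (block_dim blk k) * ln (a k n \<theta>0))
          - 1/2 * ln (det (\<Gamma>0 \<omega>)) + real CARD('p) / 2 * ln (2 * pi)
          + 1/2 * (norm (inv_sqrt_matrix (\<Gamma>0 \<omega>) *v ?M0 n \<omega>))\<^sup>2 + ln (\<pi> n \<theta>0)))"
      by (rule ev_prob_weaken[OF pd]) (simp add: ln_gauss_mass(2) blocks)
  qed
  have Q: "ev_prob M \<delta> (\<lambda>n \<omega>. pos_definite (\<Gamma>0 \<omega>) \<and>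
      \<bar>H n \<omega> (\<theta>h n \<omega>) - H n \<omega> \<theta>0 - (norm (inv_sqrt_matrix (\<Gamma>0 \<omega>) *v ?M0 n \<omega>))\<^sup>2 / 2\<bar> \<le> \<epsilon> \<and>
      0 < ?GQ n \<omega> \<and> \<bar>ln (?GQ n \<omega>) - ln (det (\<Gamma>0 \<omega>))\<bar> \<le> \<epsilon>)" if "\<epsilon> > 0" "\<delta> > 0" for \<epsilon> \<delta>
    by (rule QMLE_expansion[OF assms(1) S A c c0 assms(19,14,15,16,18) that])
  have Q1: "small_op M (\<lambda>n \<omega>. H n \<omega> (\<theta>h n \<omega>) - H n \<omega> \<theta>0 - (norm (inv_sqrt_matrix (\<Gamma>0 \<omega>) *v ?M0 n \<omega>))\<^sup>2 / 2)"
    unfolding small_op_iff real_norm_def by (intro allI impI, rule ev_prob_weaken[OF Q]) auto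
  have Q2: "small_op M (\<lambda>n \<omega>. ln (?GQ n \<omega>) - ln (det (\<Gamma>0 \<omega>)))"
    unfolding small_op_iff real_norm_def by (intro allI impI, rule ev_prob_weaken[OF Q]) auto
  have Q3: "ev_prob M \<delta> (\<lambda>n \<omega>. 0 < ?GQ n \<omega>)" if "\<delta> > 0" for \<delta>
    by (rule ev_prob_weaken[OF Q[OF zero_less_one that]]) auto
  have detG: "?GQ n \<omega> = (\<Prod>i\<in>UNIV. ?c n i)\<^sup>2 * det (- hessian (H n \<omega>) (\<theta>h n \<omega>))" for n \<omega>
    by (rule det_Gam[OF A])
  have cpos: "0 < (\<Prod>i\<in>UNIV. ?c n i)" for n using c by (intro prod_pos) auto
  have detG_pos: "0 < ?GQ n \<omega> \<longleftrightarrow> 0 < det (- hessian (H n \<omega>) (\<theta>h n \<omega>))" for n \<omega>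
    unfolding detG using zero_less_power[OF cpos[of n], of 2]
    by (meson mult_pos_pos zero_less_mult_pos)
  have Q4: "ev_prob M \<delta> (\<lambda>n \<omega>. 0 < det (- hessian (H n \<omega>) (\<theta>h n \<omega>)))" if "\<delta> > 0" for \<delta>
    using Q3[OF that] by (simp only: detG_pos)
  have ln_detG: "ln (?GQ n \<omega>) = 2 * (\<Sum>k\<in>{1..K}. real (block_dim blk k) * ln (a k n \<theta>0))
      + ln (det (- hessian (H n \<omega>) (\<theta>h n \<omega>)))" if "0 < det (- hessian (H n \<omega>) (\<theta>h n \<omega>))" for n \<omega>
  proof -
    have "ln (\<Prod>i\<in>UNIV. ?c n i) = (\<Sum>i\<in>UNIV. ln (?c n i))" 
      by (rule ln_prod) (simp_all add: less_imp_neq[OF c, symmetric])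
    then show ?thesis
      using that zero_less_power[OF cpos[of n], of 2] cpos[of n]
      unfolding detG blocks[symmetric] by (simp add: ln_mult_pos ln_realpow)
  qed
  show ?thesis
  proof (intro conjI impI)
    assume "(\<forall>k\<in>{1..K}. small_op M (\<lambda>n \<omega>. ln (a k n (\<theta>h n \<omega>)) - ln (a k n \<theta>0))) \<and>
      small_op M (\<lambda>n \<omega>. ln (\<pi> n (\<theta>h n \<omega>)) - ln (\<pi> n \<theta>0))"
    then have a: "\<And>k. k \<in> {1..K} \<Longrightarrow> small_op M (\<lambda>n \<omega>. ln (a k n (\<theta>h n \<omega>)) - ln (a k n \<theta>0))"
      and \<pi>: "small_op M (\<lambda>n \<omega>. ln (\<pi> n (\<theta>h n \<omega>)) - ln (\<pi> n \<theta>0))" by auto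
    have asum: "small_op M (\<lambda>n \<omega>. (\<Sum>k\<in>{1..K}. real (block_dim blk k) * ln (a k n (\<theta>h n \<omega>)))
        - (\<Sum>k\<in>{1..K}. real (block_dim blk k) * ln (a k n \<theta>0)))"
      using small_op_sum[OF small_op_scaleR[OF a], of "{1..K}" "\<lambda>k. k" "\<lambda>k. real (block_dim blk k)"]
      by (simp add: right_diff_distrib sum_subtractf)
    \<comment> \<open>Each summand exchanges one quantity at \<open>\<theta>0\<close> in (i) for its
      counterpart at the maximizer. The coefficient 1/2 belongs to the log determinant; the squared
      norm in (i) is cancelled by the maximum expansion.\<close>
    have "small_op M (\<lambda>n \<omega>. (?lik n \<omega>
       - (H n \<omega> \<theta>0 + (\<Sum>k\<in>{1..K}. real (block_dim blk k) * ln (a k n \<theta>0))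
          - 1/2 * ln (det (\<Gamma>0 \<omega>)) + real CARD('p) / 2 * ln (2 * pi)
          + 1/2 * (norm (inv_sqrt_matrix (\<Gamma>0 \<omega>) *v ?M0 n \<omega>))\<^sup>2 + ln (\<pi> n \<theta>0)))
       + ((-1) *\<^sub>R (H n \<omega> (\<theta>h n \<omega>) - H n \<omega> \<theta>0 - (norm (inv_sqrt_matrix (\<Gamma>0 \<omega>) *v ?M0 n \<omega>))\<^sup>2 / 2)
       + ((1/2) *\<^sub>R (ln (?GQ n \<omega>) - ln (det (\<Gamma>0 \<omega>)))
       + ((-1) *\<^sub>R ((\<Sum>k\<in>{1..K}. real (block_dim blk k) * ln (a k n (\<theta>h n \<omega>)))
           - (\<Sum>k\<in>{1..K}. real (block_dim blk k) * ln (a k n \<theta>0)))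
       + (-1) *\<^sub>R (ln (\<pi> n (\<theta>h n \<omega>)) - ln (\<pi> n \<theta>0))))))"
      by (intro small_op_add small_op_scaleR i Q1 Q2 asum \<pi>)
    then show ii: "small_op M (\<lambda>n \<omega>. ?lik n \<omega> - (H n \<omega> (\<theta>h n \<omega>)
           + (\<Sum>k\<in>{1..K}. real (block_dim blk k) * ln (a k n (\<theta>h n \<omega>)))
           + real CARD('p) / 2 * ln (2 * pi) - 1/2 * ln (?GQ n \<omega>) + ln (\<pi> n (\<theta>h n \<omega>))))"
      by (rule small_op_cong_ev) (rule ev_prob_AE, simp_all add: field_simps)
    show "small_op M (\<lambda>n \<omega>. ?lik n \<omega> - (H n \<omega> (\<theta>h n \<omega>) + real CARD('p) / 2 * ln (2 * pi)
           - 1/2 * ln (det (- hessian (H n \<omega>) (\<theta>h n \<omega>))) + ln (\<pi> n (\<theta>h n \<omega>))))"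
    \<comment> \<open>Adding \<open>asum\<close> returns the rates to \<open>\<theta>0\<close>,
      where they cancel exactly against those contained in the determinant of
      \<open>Gam\<close>.\<close>
    proof (rule small_op_cong_ev[OF small_op_add[OF ii asum]])
      fix \<delta> :: real assume "\<delta> > 0"
      show "ev_prob M \<delta> (\<lambda>n \<omega>. ?lik n \<omega> - (H n \<omega> (\<theta>h n \<omega>)
           + (\<Sum>k\<in>{1..K}. real (block_dim blk k) * ln (a k n (\<theta>h n \<omega>)))
           + real CARD('p) / 2 * ln (2 * pi) - 1/2 * ln (?GQ n \<omega>) + ln (\<pi> n (\<theta>h n \<omega>)))
         + ((\<Sum>k\<in>{1..K}. real (block_dim blk k) * ln (a k n (\<theta>h n \<omega>)))
           - (\<Sum>k\<in>{1..K}. real (block_dim blk k) * ln (a k n \<theta>0)))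
         = ?lik n \<omega> - (H n \<omega> (\<theta>h n \<omega>) + real CARD('p) / 2 * ln (2 * pi)
           - 1/2 * ln (det (- hessian (H n \<omega>) (\<theta>h n \<omega>))) + ln (\<pi> n (\<theta>h n \<omega>))))"
        by (rule ev_prob_weaken[OF Q4[OF \<open>\<delta> > 0\<close>]]) (simp add: ln_detG field_simps)
    qed
  qed (use i Q3 Q4 in \<open>simp_all only: outer_tendsto_0_iff, blast+\<close>)
qed

end
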